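(* Let $\mathbf{X}=(\mathbf{X}_1^\top,\mathbf{X}_2^\top)^\top\sim EC_{r}(\boldsymbol{\xi},\boldsymbol{\Omega},h^{(r)})$ with $\dim(\mathbf{X}_1)=r_1$, $\dim(\mathbf{X}_2)=r_2$, $r_1+r_2=r$, and let $\boldsymbol{\alpha}=(\boldsymbol{\alpha}_1^\top,\boldsymbol{\alpha}_2^\top)^\top$, $\boldsymbol{\beta}=(\boldsymbol{\beta}_1^\top,\boldsymbol{\beta}_2^\top)^\top$ be lower and upper truncation limits, where $r_1$ is the number of pairs in $(\boldsymbol{\alpha},\boldsymbol{\beta})$ that are both infinite, so that $\boldsymbol{\alpha}_1=-\boldsymbol{\infty}$, $\boldsymbol{\beta}_1=\boldsymbol{\infty}$, while for each coordinate of $\mathbf{X}_2$ at least one of its two truncation limits is finite. Let $\boldsymbol{\mu}_2=\mathbb{E}[\mathbf{X}_2\mid\boldsymbol{\alpha}_2\le\mathbf{X}_2\le\boldsymbol{\beta}_2]$ and $\boldsymbol{\Sigma}_{22}=\mathrm{cov}[\mathbf{X}_2\mid\boldsymbol{\alpha}_2\le\mathbf{X}_2\le\boldsymbol{\beta}_2]$. Then $$\mathbb{E}[\mathbf{X}\mid\boldsymbol{\alpha}\le\mathbf{X}\le\boldsymbol{\beta}]=\begin{bmatrix}\boldsymbol{\xi}_1+\boldsymbol{\Omega}_{12}\boldsymbol{\Omega}_{22}^{-1}(\boldsymbol{\mu}_2-\boldsymbol{\xi}_2)\\ \boldsymbol{\mu}_2\end{bmatrix}$$ and $$\mathrm{cov}[\mathbf{X}\mid\boldsymbol{\alpha}\le\mathbf{X}\le\boldsymbol{\beta}]=\begin{bmatrix}\omega_{1.2}\boldsymbol{\Omega}_{11}-\boldsymbol{\Omega}_{12}\boldsymbol{\Omega}_{22}^{-1}\big(\omega_{1.2}\mathbf{I}_{r_2}-\boldsymbol{\Sigma}_{22}\boldsymbol{\Omega}_{22}^{-1}\big)\boldsymbol{\Omega}_{21}&\boldsymbol{\Omega}_{12}\boldsymbol{\Omega}_{22}^{-1}\boldsymbol{\Sigma}_{22}\\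 \boldsymbol{\Sigma}_{22}\boldsymbol{\Omega}_{22}^{-1}\boldsymbol{\Omega}_{21}&\boldsymbol{\Sigma}_{22}\end{bmatrix},$$ where $\omega_{1.2}$ is a scalar constant, depending on the conditional generating function $h^{(r_1)}_{\mathbf{X}_2}$ of $\mathbf{X}_1$ given $\mathbf{X}_2$, such that $\mathbb{E}\big[\mathrm{cov}[\mathbf{X}_1\mid\mathbf{X}_2]\,\big|\,\boldsymbol{\alpha}_2\le\mathbf{X}_2\le\boldsymbol{\beta}_2\big]=\omega_{1.2}(\boldsymbol{\Omega}_{11}-\boldsymbol{\Omega}_{12}\boldsymbol{\Omega}_{22}^{-1}\boldsymbol{\Omega}_{21})$. In particular, if $\mathbf{X}\sim t_{r_1+r_2}(\boldsymbol{\xi},\boldsymbol{\Omega},\nu)$, then, with $\delta(\mathbf{x}_2)=(\mathbf{x}_2-\boldsymbol{\xi}_2)^\top\boldsymbol{\Omega}_{22}^{-1}(\mathbf{x}_2-\boldsymbol{\xi}_2)$, $$\omega_{1.2}=\mathbb{E}\left[\frac{\nu+\delta(\mathbf{X}_2)}{\nu+r_2-2}\,\middle|\,\boldsymbol{\alpha}_2\le\mathbf{X}_2\le\boldsymbol{\beta}_2\right]=\left(\frac{\nu}{\nu-2}\right)\frac{L_{r_2}\big(\boldsymbol{\alpha}_2,\boldsymbol{\beta}_2;\boldsymbol{\xi}_2,\nu\boldsymbol{\Omega}_{22}/(\nu-2),\nu-2\big)}{L_{r_2}(\boldsymbol{\alpha}_2,\boldsymbol{\beta}_2;\boldsymbol{\xi}_2,\boldsymbol{\Omega}_{22},\nu)},$$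 and for the normal case (the limit $\nu\to\infty$), $\omega_{1.2}=1$.
   Context: Elliptical distribution: $\mathbf{X}\sim EC_{r}(\boldsymbol{\xi},\boldsymbol{\Omega},h^{(r)})$ means that $\mathbf{X}$ has density $|\boldsymbol{\Omega}|^{-1/2}h^{(r)}\big((\mathbf{x}-\boldsymbol{\xi})^\top\boldsymbol{\Omega}^{-1}(\mathbf{x}-\boldsymbol{\xi})\big)$ on $\mathbb{R}^r$, with location $\boldsymbol{\xi}$, dispersion matrix $\boldsymbol{\Omega}$ and density generator $h^{(r)}$; $\boldsymbol{\xi}=(\boldsymbol{\xi}_1^\top,\boldsymbol{\xi}_2^\top)^\top$ and $\boldsymbol{\Omega}=\begin{pmatrix}\boldsymbol{\Omega}_{11}&\boldsymbol{\Omega}_{12}\\ \boldsymbol{\Omega}_{21}&\boldsymbol{\Omega}_{22}\end{pmatrix}$ are partitioned conformably with $(\mathbf{X}_1,\mathbf{X}_2)$. The marginal of $\mathbf{X}_2$ is $EC_{r_2}(\boldsymbol{\xi}_2,\boldsymbol{\Omega}_{22},h^{(r_2)})$, and $\mathbf{X}_1\mid\mathbf{X}_2\sim EC_{r_1}\big(\boldsymbol{\xi}_1+\boldsymbol{\Omega}_{12}\boldsymbol{\Omega}_{22}^{-1}(\mathbf{X}_2-\boldsymbol{\xi}_2),\,\boldsymbol{\Omega}_{11}-\boldsymbol{\Omega}_{12}\boldsymbol{\Omega}_{22}^{-1}\boldsymbol{\Omega}_{21},\,h^{(r_1)}_{\mathbf{X}_2}\big)$, where $h^{(r_1)}_{\mathbf{x}_2}(u)=h^{(r)}(u+\delta(\mathbf{x}_2))/h^{(r_2)}(\delta(\mathbf{x}_2))$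 is the conditional generator, with $\delta(\mathbf{x}_2)=(\mathbf{x}_2-\boldsymbol{\xi}_2)^\top\boldsymbol{\Omega}_{22}^{-1}(\mathbf{x}_2-\boldsymbol{\xi}_2)$. $t_r(\boldsymbol{\xi},\boldsymbol{\Omega},\nu)$ is the $r$-variate Student-$t$ distribution with location $\boldsymbol{\xi}$, scale matrix $\boldsymbol{\Omega}$ and $\nu$ degrees of freedom, and $L_r(\boldsymbol{\alpha},\boldsymbol{\beta};\boldsymbol{\xi},\boldsymbol{\Omega},\nu)=\mathbb{P}(\boldsymbol{\alpha}\le\mathbf{Z}\le\boldsymbol{\beta})$ for $\mathbf{Z}\sim t_r(\boldsymbol{\xi},\boldsymbol{\Omega},\nu)$. $\mathbf{I}_{r_2}$ is the $r_2\times r_2$ identity matrix. Vector inequalities are componentwise. *)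

theory Defs
  imports "HOL-Probability.Probability"
begin

section \<open>Partitioned vectors and matrices\<close>

text \<open>
  Vectors of dimension \<open>r = r1 + r2\<close> are indexed by the sum type \<open>'m + 'n\<close>, with
  \<open>r1 = CARD('m)\<close> and \<open>r2 = CARD('n)\<close>.
\<close>

definition part1 :: "'a ^ ('m::finite + 'n::finite) \<Rightarrow> 'a ^ 'm" where
  "part1 v = (\<chi> i. v $ Inl i)"

definition part2 :: "'a ^ ('m::finite + 'n::finite) \<Rightarrow> 'a ^ 'n" where
  "part2 v = (\<chi> j. v $ Inr j)"

definition stack :: "'a ^ 'm::finite \<Rightarrow> 'a ^ 'n::finite \<Rightarrow> 'a ^ ('m + 'n)" where
  "stack u v = (\<chi> k. case k of Inl i \<Rightarrow> u $ i | Inr j \<Rightarrow> v $ j)"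

definition block11 :: "'a ^ ('m::finite + 'n::finite) ^ ('m + 'n) \<Rightarrow> 'a ^ 'm ^ 'm" where
  "block11 A = (\<chi> i j. A $ Inl i $ Inl j)"

definition block12 :: "'a ^ ('m::finite + 'n::finite) ^ ('m + 'n) \<Rightarrow> 'a ^ 'n ^ 'm" where
  "block12 A = (\<chi> i j. A $ Inl i $ Inr j)"

definition block21 :: "'a ^ ('m::finite + 'n::finite) ^ ('m + 'n) \<Rightarrow> 'a ^ 'm ^ 'n" where
  "block21 A = (\<chi> i j. A $ Inr i $ Inl j)"

definition block22 :: "'a ^ ('m::finite + 'n::finite) ^ ('m + 'n) \<Rightarrow> 'a ^ 'n ^ 'n" where
  "block22 A = (\<chi> i j. A $ Inr i $ Inr j)"

definition block_matrix ::
  "'a ^ 'm ^ 'm \<Rightarrow> 'a ^ 'n ^ 'm \<Rightarrow> 'a ^ 'm ^ 'n \<Rightarrow> 'a ^ 'n ^ 'n \<Rightarrow> 'a ^ ('m::finite + 'n::finite) ^ ('m + 'n)" where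
  "block_matrix A B C D =
     (\<chi> k. case k of Inl i \<Rightarrow> stack (A $ i) (B $ i) | Inr j \<Rightarrow> stack (C $ j) (D $ j))"

section \<open>Elliptical distributions\<close>

definition dispersion_matrix :: "real ^ 'r::finite ^ 'r \<Rightarrow> bool" where
  "dispersion_matrix \<Omega> \<longleftrightarrow> transpose \<Omega> = \<Omega> \<and> (\<forall>x. x \<noteq> 0 \<longrightarrow> 0 < x \<bullet> (\<Omega> *v x))"

definition mahalanobis :: "real ^ 'r::finite \<Rightarrow> real ^ 'r ^ 'r \<Rightarrow> real ^ 'r \<Rightarrow> real" where
  "mahalanobis \<xi> \<Omega> x = (x - \<xi>) \<bullet> (matrix_inv \<Omega> *v (x - \<xi>))"

definition elliptical_density ::
  "real ^ 'r::finite \<Rightarrow> real ^ 'r ^ 'r \<Rightarrow> (real \<Rightarrow> real) \<Rightarrow> real ^ 'r \<Rightarrow> real" where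
  "elliptical_density \<xi> \<Omega> h x = det \<Omega> powr (- 1 / 2) * h (mahalanobis \<xi> \<Omega> x)"

definition elliptical ::
  "'w measure \<Rightarrow> ('w \<Rightarrow> real ^ 'r::finite) \<Rightarrow> real ^ 'r \<Rightarrow> real ^ 'r ^ 'r \<Rightarrow> (real \<Rightarrow> real) \<Rightarrow> bool" where
  "elliptical M X \<xi> \<Omega> h \<longleftrightarrow> dispersion_matrix \<Omega> \<and> (\<forall>u\<ge>0. 0 \<le> h u) \<and>
     distributed M lborel X (\<lambda>x. ennreal (elliptical_density \<xi> \<Omega> h x))"

definition student_generator :: "nat \<Rightarrow> real \<Rightarrow> real \<Rightarrow> real" where
  "student_generator r \<nu> u =
     Gamma ((\<nu> + real r) / 2) / (Gamma (\<nu> / 2) * (\<nu> * pi) powr (real r / 2))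
       * (1 + u / \<nu>) powr (- (\<nu> + real r) / 2)"

definition normal_generator :: "nat \<Rightarrow> real \<Rightarrow> real" where
  "normal_generator r u = (2 * pi) powr (- real r / 2) * exp (- u / 2)"

definition student_t ::
  "'w measure \<Rightarrow> ('w \<Rightarrow> real ^ 'r::finite) \<Rightarrow> real ^ 'r \<Rightarrow> real ^ 'r ^ 'r \<Rightarrow> real \<Rightarrow> bool" where
  "student_t M X \<xi> \<Omega> \<nu> \<longleftrightarrow> 0 < \<nu> \<and> elliptical M X \<xi> \<Omega> (student_generator CARD('r) \<nu>)"

definition multivariate_normal ::
  "'w measure \<Rightarrow> ('w \<Rightarrow> real ^ 'r::finite) \<Rightarrow> real ^ 'r \<Rightarrow> real ^ 'r ^ 'r \<Rightarrow> bool" where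
  "multivariate_normal M X \<xi> \<Omega> \<longleftrightarrow> elliptical M X \<xi> \<Omega> (normal_generator CARD('r))"

text \<open>
  If \<open>h\<close> generates the law of \<open>(X1, X2)\<close>, integrating \<open>x1\<close> out of the joint density gives the
  generator of the marginal law of \<open>X2\<close>; the type argument fixes the dimension of \<open>X1\<close>.
\<close>

definition marginal_generator :: "'m::finite itself \<Rightarrow> (real \<Rightarrow> real) \<Rightarrow> real \<Rightarrow> real" where
  "marginal_generator _ h u = (\<integral>z. h (u + z \<bullet> z) \<partial>(lborel :: (real ^ 'm) measure))"

definition conditional_generator :: "'m::finite itself \<Rightarrow> (real \<Rightarrow> real) \<Rightarrow> real \<Rightarrow> real \<Rightarrow> real" where
  "conditional_generator T h \<delta> u = h (u + \<delta>) / marginal_generator T h \<delta>"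

text \<open>
  The factor \<open>c\<close> for which an elliptical law on \<open>real ^ 'm\<close> with dispersion matrix \<open>S\<close> and
  generator \<open>g\<close> has covariance matrix \<open>c S\<close>: the trace of the covariance of the spherical law
  with density \<open>g (z \<bullet> z)\<close>, divided by the dimension.
\<close>

definition covariance_factor :: "'m::finite itself \<Rightarrow> (real \<Rightarrow> real) \<Rightarrow> real" where
  "covariance_factor _ g =
     (\<integral>z. (z \<bullet> z) * g (z \<bullet> z) \<partial>(lborel :: (real ^ 'm) measure)) / real CARD('m)"

section \<open>Truncation and conditional moments\<close>

definition in_limits :: "ereal ^ 'r::finite \<Rightarrow> ereal ^ 'r \<Rightarrow> real ^ 'r \<Rightarrow> bool" where
  "in_limits \<alpha> \<beta> x \<longleftrightarrow> (\<forall>i. \<alpha> $ i \<le> ereal (x $ i) \<and> ereal (x $ i) \<le> \<beta> $ i)"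

definition trunc_event ::
  "'w measure \<Rightarrow> ('w \<Rightarrow> real ^ 'r::finite) \<Rightarrow> ereal ^ 'r \<Rightarrow> ereal ^ 'r \<Rightarrow> 'w set" where
  "trunc_event M X \<alpha> \<beta> = {\<omega> \<in> space M. in_limits \<alpha> \<beta> (X \<omega>)}"

definition L_prob ::
  "ereal ^ 'r::finite \<Rightarrow> ereal ^ 'r \<Rightarrow> real ^ 'r \<Rightarrow> real ^ 'r ^ 'r \<Rightarrow> real \<Rightarrow> real" where
  "L_prob \<alpha> \<beta> \<xi> \<Omega> \<nu> =
     measure (density lborel
         (\<lambda>z. ennreal (elliptical_density \<xi> \<Omega> (student_generator CARD('r) \<nu>) z)))
       {z. in_limits \<alpha> \<beta> z}"

text \<open>
  Conditioning on an event \<open>A\<close> of positive probability means taking moments under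
  \<open>uniform_measure M A\<close>, which is the conditional probability measure \<open>P( \<cdot> | A)\<close>.
\<close>

definition event_expectation ::
  "'w measure \<Rightarrow> 'w set \<Rightarrow> ('w \<Rightarrow> 'b::{banach, second_countable_topology}) \<Rightarrow> 'b" where
  "event_expectation M A Y = (\<integral>\<omega>. Y \<omega> \<partial>uniform_measure M A)"

definition event_cov :: "'w measure \<Rightarrow> 'w set \<Rightarrow> ('w \<Rightarrow> real ^ 'r::finite) \<Rightarrow> real ^ 'r ^ 'r" where
  "event_cov M A Y =
     (\<chi> i j. event_expectation M A
        (\<lambda>\<omega>. (Y \<omega> $ i - event_expectation M A Y $ i) * (Y \<omega> $ j - event_expectation M A Y $ j)))"

definition event_square_integrable :: "'w measure \<Rightarrow> 'w set \<Rightarrow> ('w \<Rightarrow> real ^ 'r::finite) \<Rightarrow> bool" where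
  "event_square_integrable M A Y \<longleftrightarrow>
     Y \<in> borel_measurable M \<and> integrable (uniform_measure M A) (\<lambda>\<omega>. (norm (Y \<omega>))\<^sup>2)"

definition cond_exp_given ::
  "'w measure \<Rightarrow> ('w \<Rightarrow> real ^ 's::finite) \<Rightarrow> ('w \<Rightarrow> real) \<Rightarrow> 'w \<Rightarrow> real" where
  "cond_exp_given M Y f = real_cond_exp M (vimage_algebra (space M) Y borel) f"

definition cond_cov ::
  "'w measure \<Rightarrow> ('w \<Rightarrow> real ^ 'r::finite) \<Rightarrow> ('w \<Rightarrow> real ^ 's::finite) \<Rightarrow> 'w \<Rightarrow> real ^ 'r ^ 'r" where
  "cond_cov M Z Y = (\<lambda>\<omega>. \<chi> i j.
     cond_exp_given M Y
       (\<lambda>\<eta>. (Z \<eta> $ i - cond_exp_given M Y (\<lambda>\<zeta>. Z \<zeta> $ i) \<eta>) *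
            (Z \<eta> $ j - cond_exp_given M Y (\<lambda>\<zeta>. Z \<zeta> $ j) \<eta>)) \<omega>)"

end

(* Write Omega = P P^T with the block upper triangular root P = [[L, B K], [0, K]], where
   B = Omega12 Omega22^-1, L L^T is the Schur complement and K K^T = Omega22. Then X = xi + P Y with Y
   spherical, X2 = xi2 + K Y2, delta(X2) = |Y2|^2, and the residual X1 - xi1 - B (X2 - xi2) = L Y1.
   Coordinate reflections and transpositions of Y1 preserve the law of (Y1, Y2) and fix Y2, so against
   any function of X2 the residual averages to zero and Y1 Y1^T averages to a multiple of the identity.
   This gives the mean, the block covariance and omega = E[|Y1|^2 | A] / r1, which Fubini turns into the
   expectation of the covariance factor of the conditional generator.

   For the t and normal generators that factor comes from the virial identity
   int |y|^2 k1(|y|^2) dy = (n/2) int k(|y|^2) dy with k' = - k1. The ratio of the L's follows from a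
   pointwise identity between the t densities with nu and nu - 2 degrees of freedom, so no normalizing
   constant is evaluated, and its limit from dominated convergence to the Gaussian kernel. *)

theory Submission
  imports Defs "HOL-Real_Asymp.Real_Asymp"
begin

section \<open>Linear changes of variables\<close>

text \<open>The generator \<open>h\<close> is known only to be nonnegative and to give a density,
  and moments are assumed only under the conditional law. \<open>X1\<close> may fail to be
  integrable outside the truncation event, so every expectation carries the indicator of the event.
  Since the limits of the first block are infinite, the event says that \<open>X2\<close> lies in a
  Borel set, and its indicator is one of the functions of \<open>X2\<close> to which the symmetry
  argument applies. The Jacobian of the standardizing map and the determinant factor of the density
  merge into one positive constant, which disappears because the conditional generator is a
  quotient. \<open>omega\<close> is defined from \<open>Y\<close> without reference to the
  generator; if X is also t or normal, the formula for it may therefore be read with that generator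
  in place of \<open>h\<close>. Uniqueness of the scalar holds because the Schur complement is
  positive definite and so cannot vanish. The first t formula has the threshold 2 < \<nu> + r2,
  weaker than 2 < \<nu>: given X2 the law of X1 has \<nu> + r2 degrees of freedom, and truncation
  may supply the moments of X2 that the full law lacks.\<close>

lemma matrix_inv_mult:
  fixes A :: "real ^ 'n::finite ^ 'm::finite"
  assumes "invertible A"
  shows "A ** matrix_inv A = mat 1" "matrix_inv A ** A = mat 1"
proof -
  have "A ** matrix_inv A = mat 1 \<and> matrix_inv A ** A = mat 1"
    unfolding matrix_inv_def by (rule someI_ex) (use assms in \<open>auto simp: invertible_def\<close>)
  then show "A ** matrix_inv A = mat 1" "matrix_inv A ** A = mat 1" by auto
qed

lemma prod_Basis_vec:
  fixes x :: "real ^ 'n::finite"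
  shows "(\<Prod>b\<in>Basis. x \<bullet> b) = (\<Prod>i\<in>UNIV. x $ i)"
proof -
  have B: "(Basis :: (real^'n) set) = (\<lambda>i. axis i 1) ` UNIV" by (auto simp: Basis_vec_def)
  have "inj (\<lambda>i::'n. axis i (1::real))" by (auto simp: inj_on_def axis_eq_axis)
  then show ?thesis unfolding B by (subst prod.reindex) (auto simp: inner_axis)
qed

lemma emeasure_lborel_box_cart:
  fixes l u :: "real ^ 'n::finite"
  assumes "\<And>i. l $ i \<le> u $ i"
  shows "emeasure lborel (box l u) = (\<Prod>i\<in>UNIV. u $ i - l $ i)"
proof -
  have "l \<bullet> b \<le> u \<bullet> b" if "b \<in> Basis" for b
    using that assms by (auto simp: Basis_vec_def inner_axis)
  then show ?thesis
    by (subst emeasure_lborel_box) (auto simp: prod_Basis_vec)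
qed

lemma lborel_eqI_cart:
  fixes M :: "(real ^ 'n::finite) measure"
  assumes "\<And>l u. (\<And>i. l $ i \<le> u $ i) \<Longrightarrow> emeasure M (box l u) = emeasure lborel (box l u)"
    and "sets M = sets borel"
  shows "lborel = M"
proof (rule lborel_eqI[OF _ assms(2)])
  fix l u :: "real ^ 'n"
  assume le: "\<And>b. b \<in> Basis \<Longrightarrow> l \<bullet> b \<le> u \<bullet> b"
  have le': "l $ i \<le> u $ i" for i using le[of "axis i 1"] by (simp add: inner_axis)
  show "emeasure M (box l u) = (\<Prod>b\<in>Basis. (u - l) \<bullet> b)"
    using assms(1)[OF le'] emeasure_lborel_box_cart[OF le'] by (simp add: prod_Basis_vec)
qed

lemma borel_measurable_linear:
  fixes f :: "'a::euclidean_space \<Rightarrow> 'b::euclidean_space"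
  shows "linear f \<Longrightarrow> f \<in> borel_measurable borel"
  by (intro borel_measurable_continuous_onI linear_continuous_on) (simp add: linear_conv_bounded_linear)

text \<open>The preimage of a box is again a box with permuted sides, so its volume is the same
  product in another order.\<close>

lemma lborel_permute_coordinates:
  fixes \<pi> :: "'n::finite \<Rightarrow> 'n"
  assumes "bij \<pi>"
  shows "lborel = distr lborel borel (\<lambda>x::real ^ 'n. \<chi> i. x $ \<pi> i)"
proof (rule lborel_eqI_cart)
  fix l u :: "real ^ 'n"
  assume le: "\<And>i. l $ i \<le> u $ i"
  define \<rho> where "\<rho> = inv \<pi>"
  have \<rho>: "\<pi> (\<rho> i) = i" "\<rho> (\<pi> i) = i" for i
    using assms by (simp_all add: \<rho>_def bij_is_surj surj_f_inv_f bij_is_inj)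
  have m: "(\<lambda>x::real ^ 'n. \<chi> i. x $ \<pi> i) \<in> borel_measurable borel"
    by (intro borel_measurable_linear linearI) (auto simp: vec_eq_iff)
  have "(\<lambda>x::real ^ 'n. \<chi> i. x $ \<pi> i) -` box l u = box (\<chi> i. l $ \<rho> i) (\<chi> i. u $ \<rho> i)"
    by (auto simp: mem_box_cart \<rho>) (metis \<rho>)+
  then have "emeasure (distr lborel borel (\<lambda>x::real ^ 'n. \<chi> i. x $ \<pi> i)) (box l u) =
      (\<Prod>i\<in>UNIV. u $ \<rho> i - l $ \<rho> i)"
    using m le by (simp add: emeasure_distr emeasure_lborel_box_cart)
  also have "(\<Prod>i\<in>UNIV. u $ \<rho> i - l $ \<rho> i) = (\<Prod>i\<in>UNIV. u $ i - l $ i)"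
    by (rule prod.reindex_bij_betw) (simp add: \<rho>_def assms bij_imp_bij_inv)
  finally show "emeasure (distr lborel borel (\<lambda>x::real ^ 'n. \<chi> i. x $ \<pi> i)) (box l u) = emeasure lborel (box l u)"
    by (simp add: emeasure_lborel_box_cart le)
qed simp

text \<open>The preimage of a box under this shear is its image under the inverse shear, and
  \<open>measure_shear_interval\<close> gives the volume of such an image for closed boxes. The work
  lies in passing to open boxes, the test sets of \<open>lborel_eqI_cart\<close>.\<close>

lemma lborel_shear:
  fixes m n :: "'n::finite"
  assumes mn: "m \<noteq> n"
  shows "lborel = distr lborel borel (\<lambda>x::real ^ 'n. \<chi> i. if i = m then x $ m - x $ n else x $ i)"
proof (rule lborel_eqI_cart)
  fix l u :: "real ^ 'n"
  assume le: "\<And>i. l $ i \<le> u $ i"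
  let ?f = "\<lambda>x::real ^ 'n. \<chi> i. if i = m then x $ m + x $ n else x $ i"
  let ?g = "\<lambda>x::real ^ 'n. \<chi> i. if i = m then x $ m - x $ n else x $ i"
  have f: "linear ?f" and g: "linear ?g"
    by (auto intro!: linearI simp: vec_eq_iff algebra_simps)
  note gm[measurable] = borel_measurable_linear[OF g]
  have gf: "?g (?f x) = x" "?f (?g x) = x" for x
    using mn by (auto simp: vec_eq_iff)
  have img: "?g -` S = ?f ` S" for S
  proof (intro set_eqI iffI)
    fix x assume "x \<in> ?g -` S"
    then show "x \<in> ?f ` S" by (intro image_eqI[of _ _ "?g x"]) (simp_all only: gf vimage_eq)
  next
    fix x assume "x \<in> ?f ` S"
    then obtain y where "y \<in> S" "x = ?f y" by blast
    then show "x \<in> ?g -` S" by (simp only: gf vimage_eq)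
  qed
  \<comment> \<open>translating the box meets the sign condition of \<open>measure_shear_interval\<close>\<close>
  define t :: "real ^ 'n" where "t = (\<chi> i. \<bar>l $ n\<bar>)"
  have ne: "cbox (t + l) (t + u) \<noteq> {}" using le by (simp add: interval_ne_empty_cart)
  have "?f ` cbox (t + l) (t + u) = (+) (?f t) ` (?f ` cbox l u)"
    unfolding cbox_translation image_image by (simp add: linear_add[OF f])
  then have "measure lebesgue (?f ` cbox l u) = measure lebesgue (?f ` cbox (t + l) (t + u))"
    by (simp add: measure_translation)
  also have "\<dots> = measure lebesgue (cbox (t + l) (t + u))"
    by (rule measure_shear_interval[OF mn ne]) (simp add: t_def)
  also have "\<dots> = measure lebesgue (cbox l u)"
    by (simp add: cbox_translation measure_translation)
  finally have M: "measure lebesgue (?f ` cbox l u) = measure lebesgue (box l u)"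
    by (simp add: measure_lborel_box_eq measure_lborel_cbox_eq)
  have "?f ` cbox l u \<in> lmeasurable"
    by (intro lmeasurable_compact compact_continuous_image linear_continuous_on)
       (use f in \<open>auto simp: linear_conv_bounded_linear\<close>)
  \<comment> \<open>The images of the closed and the open box differ only inside the image of the
    boundary, which is negligible because a linear map is differentiable.\<close>
  moreover have "negligible (?f ` (cbox l u - box l u))"
    by (intro negligible_differentiable_image_negligible negligible_frontier_interval
        linear_imp_differentiable_on f) simp
  moreover have "sym_diff (?f ` box l u) (?f ` cbox l u) \<subseteq> ?f ` (cbox l u - box l u)"
    using box_subset_cbox[of l u] by blast
  ultimately have C: "?f ` cbox l u \<in> lmeasurable" "negligible (sym_diff (?f ` cbox l u) (?f ` box l u))"
    by (auto intro: negligible_subset simp: Un_commute)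
  have B: "?f ` box l u \<in> lmeasurable" "measure lebesgue (?f ` box l u) = measure lebesgue (?f ` cbox l u)"
    using lmeasurable_negligible_symdiff[OF C] measure_negligible_symdiff[OF C] by blast+
  have "emeasure (distr lborel borel ?g) (box l u) = emeasure lebesgue (?g -` box l u)"
    using measurable_sets_borel[OF gm, of "box l u"] by (simp add: emeasure_distr)
  also have "\<dots> = ennreal (measure lebesgue (box l u))"
    unfolding img using B M by (simp add: emeasure_eq_measure2)
  also have "\<dots> = emeasure lborel (box l u)"
    using emeasure_eq_measure2[of "box l u" lebesgue] by simp
  finally show "emeasure (distr lborel borel ?g) (box l u) = emeasure lborel (box l u)" .
qed simp

text \<open>The volume formula for linear images in the library needs a well-ordered index type, which
  \<open>'m + 'n\<close> is not; the value of the constant never matters here.\<close>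

lemma nn_integral_lborel_linear:
  fixes f :: "real ^ 'n::finite \<Rightarrow> real ^ 'n"
  assumes "linear f" "inj f"
  shows "\<exists>c>0. \<forall>h\<in>borel_measurable borel. (\<integral>\<^sup>+x. h x \<partial>lborel) = ennreal c * (\<integral>\<^sup>+y. h (f y) \<partial>lborel)"
proof -
  let ?Q = "\<lambda>f c. 0 < c \<and> (\<forall>h\<in>borel_measurable borel. (\<integral>\<^sup>+x. h x \<partial>lborel) = ennreal c * (\<integral>\<^sup>+y. h (f y) \<partial>lborel))"
  \<comment> \<open>Injectivity stays inside the statement proved by induction: one kind of
    elementary map annihilates a coordinate, and there the claim must be vacuous.\<close>
  have "inj f \<longrightarrow> (\<exists>c. ?Q f c)"
  proof (rule induct_linear_elementary[OF assms(1)])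
    fix f g :: "real ^ 'n \<Rightarrow> real ^ 'n"
    assume f: "linear f" and g: "linear g"
      and IH: "inj f \<longrightarrow> (\<exists>c. ?Q f c)" "inj g \<longrightarrow> (\<exists>c. ?Q g c)"
    show "inj (f \<circ> g) \<longrightarrow> (\<exists>c. ?Q (f \<circ> g) c)"
    proof
      assume inj: "inj (f \<circ> g)"
      then have "inj g" by (rule inj_on_imageI2)
      then have "surj g" using g by (simp add: linear_injective_imp_surjective)
      then have "inj f" using inj \<open>inj g\<close> by (metis comp_def inj_def surjD)
      then obtain a b where ab: "?Q f a" "?Q g b" using IH \<open>inj g\<close> by blast
      have [measurable]: "f \<in> borel_measurable borel" using borel_measurable_linear f by blast
      have "?Q (f \<circ> g) (a * b)"
      proof (intro conjI ballI)
        fix h :: "real ^ 'n \<Rightarrow> ennreal" assume [measurable]: "h \<in> borel_measurable borel"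
        have "(\<integral>\<^sup>+x. h x \<partial>lborel) = ennreal a * (\<integral>\<^sup>+y. h (f y) \<partial>lborel)"
          by (rule ab(1)[THEN conjunct2, rule_format]) measurable
        also have "(\<integral>\<^sup>+y. h (f y) \<partial>lborel) = ennreal b * (\<integral>\<^sup>+y. h (f (g y)) \<partial>lborel)"
          by (rule ab(2)[THEN conjunct2, rule_format]) measurable
        finally show "(\<integral>\<^sup>+x. h x \<partial>lborel) = ennreal (a * b) * (\<integral>\<^sup>+y. h ((f \<circ> g) y) \<partial>lborel)"
          using ab(1)[THEN conjunct1] by (simp add: ennreal_mult' mult.assoc)
      qed (rule mult_pos_pos[OF ab(1)[THEN conjunct1] ab(2)[THEN conjunct1]])
      then show "\<exists>c. ?Q (f \<circ> g) c" by blast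
    qed
  next
    fix f :: "real ^ 'n \<Rightarrow> real ^ 'n" and i
    assume f: "linear f" "\<And>x. f x $ i = 0"
    have "\<not> inj f"
    proof
      assume "inj f"
      then have "surj f" using f by (simp add: linear_injective_imp_surjective)
      then obtain x where "f x = axis i 1" by (metis surjD)
      then show False using f(2)[of x] by (simp add: axis_def)
    qed
    then show "inj f \<longrightarrow> (\<exists>c. ?Q f c)" by blast
  next
    fix c :: "'n \<Rightarrow> real"
    let ?f = "\<lambda>x::real ^ 'n. \<chi> i. c i * x $ i"
    show "inj ?f \<longrightarrow> (\<exists>c. ?Q ?f c)"
    proof
      assume inj: "inj ?f"
      have c: "c i \<noteq> 0" for i
      proof
        assume "c i = 0"
        then have "?f (axis i 1) = ?f 0" by (auto simp: vec_eq_iff axis_def)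
        from injD[OF inj this] show False by (simp add: axis_eq_0_iff)
      qed
      \<comment> \<open>The scale factors are reindexed by basis vectors, the form that
        \<open>lborel_affine_euclidean\<close> expects; the choice is unambiguous because distinct
        indices give distinct axes.\<close>
      define k where "k b = c (SOME i. b = axis i (1::real))" for b :: "real ^ 'n"
      have k: "k (axis i 1) = c i" for i
        by (simp add: k_def axis_eq_axis)
      have kn: "k b \<noteq> 0" if "b \<in> Basis" for b
        using that c k by (auto simp: Basis_vec_def)
      have "(\<Sum>j\<in>Basis. (k j * (x \<bullet> j)) *\<^sub>R j) = ?f x" for x
      proof (rule euclidean_eqI)
        fix b :: "real ^ 'n" assume b: "b \<in> Basis"
        then obtain i where i: "b = axis i 1" by (auto simp: Basis_vec_def)
        show "(\<Sum>j\<in>Basis. (k j * (x \<bullet> j)) *\<^sub>R j) \<bullet> b = ?f x \<bullet> b"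
          using b by (simp add: inner_sum_left inner_Basis if_distrib[of "\<lambda>x. _ * x"] sum.delta cong: if_cong)
             (simp add: i k inner_axis)
      qed
      then have *: "lborel = density (distr lborel borel ?f) (\<lambda>_. ennreal (\<Prod>j\<in>Basis. \<bar>k j\<bar>))"
        using lborel_affine_euclidean[of k 0] kn by simp
      have [measurable]: "?f \<in> borel_measurable borel"
        by (intro borel_measurable_linear linearI) (auto simp: vec_eq_iff algebra_simps)
      have "(\<integral>\<^sup>+x. h x \<partial>lborel) = ennreal (\<Prod>j\<in>Basis. \<bar>k j\<bar>) * (\<integral>\<^sup>+y. h (?f y) \<partial>lborel)"
        if [measurable]: "h \<in> borel_measurable borel" for h
        by (subst *) (simp add: nn_integral_density nn_integral_distr nn_integral_cmult)
      moreover have "0 < (\<Prod>j\<in>Basis. \<bar>k j\<bar>)" using kn by (intro prod_pos) auto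
      ultimately show "\<exists>c. ?Q ?f c" by blast
    qed
  next
    fix m n :: 'n
    let ?f = "\<lambda>x::real ^ 'n. \<chi> i. x $ Transposition.transpose m n i"
    have [measurable]: "?f \<in> borel_measurable borel"
      by (intro borel_measurable_linear linearI) (auto simp: vec_eq_iff)
    have "(\<integral>\<^sup>+x. h x \<partial>lborel) = (\<integral>\<^sup>+y. h (?f y) \<partial>lborel)" if [measurable]: "h \<in> borel_measurable borel" for h
      by (subst lborel_permute_coordinates[of "Transposition.transpose m n"]) (simp_all add: nn_integral_distr)
    then have "?Q ?f 1" unfolding ennreal_1 mult_1 using zero_less_one by blast
    then show "inj ?f \<longrightarrow> (\<exists>c. ?Q ?f c)" by blast
  next
    fix m n :: 'n
    assume mn: "m \<noteq> n"
    let ?f = "\<lambda>x::real ^ 'n. \<chi> i. if i = m then x $ m + x $ n else x $ i"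
    let ?g = "\<lambda>x::real ^ 'n. \<chi> i. if i = m then x $ m - x $ n else x $ i"
    have [measurable]: "?f \<in> borel_measurable borel" "?g \<in> borel_measurable borel"
      by (intro borel_measurable_linear linearI; auto simp: vec_eq_iff algebra_simps)+
    have fg: "?f (?g x) = x" for x using mn by (auto simp: vec_eq_iff)
    have "(\<integral>\<^sup>+x. h x \<partial>lborel) = (\<integral>\<^sup>+y. h (?f y) \<partial>lborel)" if [measurable]: "h \<in> borel_measurable borel" for h
    proof -
      have "(\<integral>\<^sup>+y. h (?f y) \<partial>lborel) = (\<integral>\<^sup>+y. h (?f (?g y)) \<partial>lborel)"
        by (subst lborel_shear[OF mn]) (subst nn_integral_distr, measurable)
      then show ?thesis unfolding fg by simp
    qed
    then have "?Q ?f 1" unfolding ennreal_1 mult_1 using zero_less_one by blast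
    then show "inj ?f \<longrightarrow> (\<exists>c. ?Q ?f c)" by blast
  qed
  then show ?thesis using assms(2) by blast
qed

text \<open>The factor supplied by \<open>nn_integral_lborel_linear\<close> is found by testing on
  the unit ball: the map leaves its indicator unchanged, and its volume is finite and
  positive.\<close>

lemma nn_integral_lborel_norm_preserving:
  fixes f :: "real ^ 'n::finite \<Rightarrow> real ^ 'n"
  assumes f: "linear f" "\<And>x. norm (f x) = norm x" and h: "h \<in> borel_measurable borel"
  shows "(\<integral>\<^sup>+x. h x \<partial>lborel) = (\<integral>\<^sup>+y. h (f y) \<partial>lborel)"
proof -
  have "x = 0" if "f x = 0" for x using f(2)[of x] that by simp
  then have "inj f" using linear_injective_0[OF f(1)] by blast
  then obtain c where c: "0 < c"
    "\<And>h. h \<in> borel_measurable borel \<Longrightarrow> (\<integral>\<^sup>+x. h x \<partial>lborel) = ennreal c * (\<integral>\<^sup>+y. h (f y) \<partial>lborel)"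
    using nn_integral_lborel_linear[OF f(1)] by blast
  let ?b = "ball (0 :: real ^ 'n) 1"
  have ind: "indicator ?b (f y) = (indicator ?b y :: ennreal)" for y
    by (simp add: indicator_def f)
  have "emeasure lborel ?b = ennreal c * emeasure lborel ?b"
    using c(2)[of "indicator ?b"] by (simp add: ind borel_measurable_indicator)
  moreover have "emeasure lborel ?b = ennreal (measure lborel ?b)"
    by (rule emeasure_eq_ennreal_measure) (metis emeasure_lborel_ball_finite less_irrefl infinity_ennreal_def)
  moreover have "0 < measure lborel ?b"
    by (rule content_ball_pos) simp
  ultimately have "c = 1" using c(1) by (simp flip: ennreal_mult)
  then show ?thesis using c(2)[OF h] by simp
qed

lemma nn_integral_lborel_affine_matrix:
  fixes P :: "real ^ 'n::finite ^ 'n"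
  assumes P: "invertible P"
  obtains C where "0 < C"
    "\<And>c f. f \<in> borel_measurable borel \<Longrightarrow>
      (\<integral>\<^sup>+x. f x \<partial>lborel) = ennreal C * (\<integral>\<^sup>+y. f (c + P *v y) \<partial>lborel)"
proof -
  have "linear ((*v) P)" "inj ((*v) P)"
    using inj_matrix_vector_mult[OF P] by auto
  then obtain C where C: "0 < C"
    "\<And>h. h \<in> borel_measurable borel \<Longrightarrow> (\<integral>\<^sup>+x. h x \<partial>lborel) = ennreal C * (\<integral>\<^sup>+y. h (P *v y) \<partial>lborel)"
    using nn_integral_lborel_linear by blast
  have "(\<integral>\<^sup>+x. f x \<partial>lborel) = ennreal C * (\<integral>\<^sup>+y. f (c + P *v y) \<partial>lborel)"
    if [measurable]: "f \<in> borel_measurable borel" for c f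
  proof -
    have "(\<integral>\<^sup>+x. f x \<partial>lborel) = (\<integral>\<^sup>+x. f (c + x) \<partial>lborel)"
      by (subst lborel_distr_plus[of c, symmetric]) (simp add: nn_integral_distr)
    also have "\<dots> = ennreal C * (\<integral>\<^sup>+y. f (c + P *v y) \<partial>lborel)"
      by (rule C(2)) measurable
    finally show ?thesis .
  qed
  with C(1) show ?thesis by (rule that)
qed

section \<open>Splitting vectors, integrals and Lebesgue measure into two blocks\<close>

lemma stack_component [simp]: "stack u v $ Inl i = u $ i" "stack u v $ Inr j = v $ j"
  by (simp_all add: stack_def)

lemma part_stack [simp]: "part1 (stack u v) = u" "part2 (stack u v) = v"
  by (simp_all add: part1_def part2_def vec_eq_iff)

lemma stack_part [simp]: "stack (part1 x) (part2 x) = x"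
  unfolding vec_eq_iff part1_def part2_def stack_def by (auto split: sum.split)

lemma part_component: "part1 x $ i = x $ Inl i" "part2 x $ j = x $ Inr j"
  by (simp_all add: part1_def part2_def)

lemma sum_UNIV_Plus:
  "(\<Sum>k\<in>UNIV. f (k :: 'm::finite + 'n::finite)) = (\<Sum>i\<in>UNIV. f (Inl i)) + (\<Sum>j\<in>UNIV. f (Inr j))"
  by (subst UNIV_Plus_UNIV[symmetric], subst sum.Plus) auto

lemma prod_UNIV_Plus:
  "(\<Prod>k\<in>UNIV. f (k :: 'm::finite + 'n::finite)) = (\<Prod>i\<in>UNIV. f (Inl i)) * (\<Prod>j\<in>UNIV. f (Inr j))"
  by (subst UNIV_Plus_UNIV[symmetric], subst prod.Plus) auto

lemma inner_split_parts:
  fixes x :: "real ^ ('m::finite + 'n::finite)"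
  shows "x \<bullet> y = part1 x \<bullet> part1 y + part2 x \<bullet> part2 y"
  by (simp add: inner_vec_def sum_UNIV_Plus part_component)

lemma linear_parts:
  "linear (part1 :: real ^ ('m::finite + 'n::finite) \<Rightarrow> _)"
  "linear (part2 :: real ^ ('m::finite + 'n::finite) \<Rightarrow> _)"
  by (auto intro!: linearI simp: part1_def part2_def vec_eq_iff)

lemma linear_stack: "linear (\<lambda>(u::real^'m::finite, v::real^'n::finite). stack u v)"
  by (auto intro!: linearI simp: stack_def vec_eq_iff split: sum.split)

lemma borel_measurable_parts [measurable]:
  "(part1 :: real ^ ('m::finite + 'n::finite) \<Rightarrow> _) \<in> borel_measurable borel"
  "(part2 :: real ^ ('m::finite + 'n::finite) \<Rightarrow> _) \<in> borel_measurable borel"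
  by (intro borel_measurable_linear linear_parts)+

lemma borel_measurable_stack [measurable]:
  "(\<lambda>(u::real^'m::finite, v::real^'n::finite). stack u v) \<in> borel_measurable (borel \<Otimes>\<^sub>M borel)"
  unfolding borel_prod
  by (intro borel_measurable_linear linear_stack)

text \<open>A box in the stacked space is a product of two boxes, and its volume factors
  accordingly.\<close>

lemma distr_stack_lborel:
  "lborel = distr (lborel \<Otimes>\<^sub>M lborel) borel (\<lambda>(u::real^'m::finite, v::real^'n::finite). stack u v)"
proof (rule lborel_eqI_cart)
  fix l u :: "real ^ ('m + 'n)"
  assume le: "\<And>i. l $ i \<le> u $ i"
  have "(\<lambda>(u::real^'m, v::real^'n). stack u v) -` box l u = box (part1 l) (part1 u) \<times> box (part2 l) (part2 u)"
    by (auto simp: mem_box_cart part_component split_sum_all)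
  then have "emeasure (distr (lborel \<Otimes>\<^sub>M lborel) borel (\<lambda>(u::real^'m, v::real^'n). stack u v)) (box l u)
      = emeasure lborel (box (part1 l) (part1 u)) * emeasure lborel (box (part2 l) (part2 u))"
    by (subst emeasure_distr) (auto simp: space_pair_measure lborel.emeasure_pair_measure_Times)
  also have "\<dots> = emeasure lborel (box l u)"
    using le by (simp add: emeasure_lborel_box_cart part_component prod_UNIV_Plus ennreal_mult prod_nonneg)
  finally show "emeasure (distr (lborel \<Otimes>\<^sub>M lborel) borel (\<lambda>(u::real^'m, v::real^'n). stack u v)) (box l u)
      = emeasure lborel (box l u)" .
qed simp

lemma nn_integral_lborel_stack:
  fixes f :: "real ^ ('m::finite + 'n::finite) \<Rightarrow> ennreal"
  assumes [measurable]: "f \<in> borel_measurable borel"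
  shows "(\<integral>\<^sup>+x. f x \<partial>lborel) = (\<integral>\<^sup>+v. (\<integral>\<^sup>+u. f (stack u v) \<partial>lborel) \<partial>lborel)"
proof -
  have "(\<integral>\<^sup>+x. f x \<partial>lborel) = (\<integral>\<^sup>+p. f (case p of (u, v) \<Rightarrow> stack u v) \<partial>(lborel \<Otimes>\<^sub>M lborel))"
    by (subst distr_stack_lborel) (simp add: nn_integral_distr)
  also have "\<dots> = (\<integral>\<^sup>+v. (\<integral>\<^sup>+u. f (stack u v) \<partial>lborel) \<partial>lborel)"
    by (subst lborel_pair.nn_integral_snd[symmetric]) (auto simp: case_prod_beta)
  finally show ?thesis .
qed


section \<open>Factors of dispersion matrices and standardization\<close>

lemma dispersion_matrix_invertible:
  assumes "dispersion_matrix S"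
  shows "invertible S"
proof -
  have "x = 0" if "S *v x = 0" for x
    using assms that unfolding dispersion_matrix_def by (metis inner_zero_right less_irrefl)
  then show ?thesis
    unfolding invertible_left_inverse matrix_left_invertible_ker by blast
qed

text \<open>Gram-Schmidt for the inner product \<open>x \<bullet> (S *v y)\<close>, with a dimension
  count in place of projections: fewer than \<open>CARD('n)\<close> vectors \<open>S *v f j\<close>
  leave a nonzero vector orthogonal to all of them, which is then normalized.\<close>

lemma ex_orthonormal_family:
  fixes S :: "real ^ 'n::finite ^ 'n"
  assumes S: "dispersion_matrix S"
  shows "\<exists>f :: 'n \<Rightarrow> real ^ 'n. \<forall>i\<in>I. \<forall>j\<in>I. f i \<bullet> (S *v f j) = (if i = j then 1 else 0)"
proof (induction I rule: finite_induct[OF finite])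
  case 1 then show ?case by simp
next
  case (2 k I)
  then obtain f where f: "\<And>i j. i \<in> I \<Longrightarrow> j \<in> I \<Longrightarrow> f i \<bullet> (S *v f j) = (if i = j then 1 else 0)"
    by metis
  let ?U = "(\<lambda>j. S *v f j) ` I"
  have "dim ?U \<le> card I" by (metis card_image_le dim_le_card' finite finite_imageI le_trans)
  also have "\<dots> < CARD('n)" using 2 by (metis UNIV_I finite psubset_card_mono psubsetI subset_UNIV)
  finally have "dim ?U < DIM(real ^ 'n)" by simp
  then obtain x where x: "x \<noteq> 0" "\<And>y. y \<in> span ?U \<Longrightarrow> orthogonal x y"
    using orthogonal_to_subspace_exists[of ?U] by metis
  have ortho: "x \<bullet> (S *v f j) = 0" if "j \<in> I" for j
    using x(2)[of "S *v f j"] that by (auto simp: orthogonal_def intro: span_base)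
  have sym: "a \<bullet> (S *v b) = b \<bullet> (S *v a)" for a b
    using S unfolding dispersion_matrix_def by (metis dot_lmul_matrix inner_commute transpose_matrix_vector)
  define q where "q = x \<bullet> (S *v x)"
  have q: "0 < q" using S x(1) by (auto simp: dispersion_matrix_def q_def)
  define g where "g = f(k := (1 / sqrt q) *\<^sub>R x)"
  have "g i \<bullet> (S *v g j) = (if i = j then 1 else 0)" if "i \<in> insert k I" "j \<in> insert k I" for i j
  proof -
    have gk: "g k = (1 / sqrt q) *\<^sub>R x" and gI: "\<And>i. i \<in> I \<Longrightarrow> g i = f i"
      using 2 by (auto simp: g_def)
    have kk: "g k \<bullet> (S *v g k) = 1"
      using q by (simp add: gk matrix_vector_mult_scaleR flip: q_def)
    have kI: "g k \<bullet> (S *v g j) = 0" if "j \<in> I" for j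
      using ortho[OF that] by (simp add: gk gI that)
    show ?thesis
    proof (cases "i = k"; cases "j = k")
      assume "i \<noteq> k" "j = k"
      then show ?thesis using that kI[of i] sym[of "g i" "g k"] by auto
    qed (use that kk kI f gI in auto)
  qed
  then show ?case by blast
qed

text \<open>With an S-orthonormal family as the rows of F one has F S F^T = 1. Hence L = S F^T is
  inverse to F, and L L^T = L F S = S. Any such factor will do; no triangular or symmetric shape is
  asked for.\<close>

lemma dispersion_matrix_factor:
  fixes S :: "real ^ 'n::finite ^ 'n"
  assumes S: "dispersion_matrix S"
  obtains L :: "real ^ 'n ^ 'n" where "L ** transpose L = S"
proof -
  obtain f :: "'n \<Rightarrow> real ^ 'n"
    where f0: "\<forall>i\<in>UNIV. \<forall>j\<in>UNIV. f i \<bullet> (S *v f j) = (if i = j then 1 else 0)"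
    using ex_orthonormal_family[OF S, of UNIV] by (rule exE)
  have f: "f i \<bullet> (S *v f j) = (if i = j then 1 else 0)" for i j
    using f0 by blast
  define F where "F = (\<chi> i. f i)"
  define L where "L = S ** transpose F"
  have "(F ** L) $ i $ j = f i \<bullet> (S *v f j)" for i j
    by (simp add: matrix_matrix_mult_def F_def L_def inner_vec_def transpose_def matrix_vector_mult_def)
  then have "F ** L = mat 1" by (simp add: f vec_eq_iff mat_def)
  then have LF: "L ** F = mat 1" by (simp add: matrix_left_right_inverse)
  have "transpose L = F ** S"
    using S by (simp add: L_def matrix_transpose_mul transpose_transpose dispersion_matrix_def)
  then have "L ** transpose L = S" by (simp add: matrix_mul_assoc LF)
  then show ?thesis by (rule that)
qed

lemma dispersion_factor_invertible:
  fixes S :: "real ^ 'n::finite ^ 'n" and L :: "real ^ 'n ^ 'n"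
  assumes S: "dispersion_matrix S" and L: "L ** transpose L = S"
  shows "invertible L"
proof -
  have "L ** (transpose L ** matrix_inv S) = mat 1"
    using matrix_inv_mult(1)[OF dispersion_matrix_invertible[OF S]] by (simp add: matrix_mul_assoc L)
  then show ?thesis using invertible_right_inverse by blast
qed

text \<open>For z = S^-1 L y the equation S z = L y reads L L^T z = L y, so L^T z = y because L is
  injective. The quadratic form is then L y \<bullet> z = y \<bullet> L^T z.\<close>

lemma mahalanobis_factor:
  fixes S :: "real ^ 'n::finite ^ 'n" and L :: "real ^ 'n ^ 'n"
  assumes S: "dispersion_matrix S" and L: "L ** transpose L = S"
  shows "mahalanobis \<xi> S (\<xi> + L *v y) = y \<bullet> y"
proof -
  define z where "z = matrix_inv S *v (L *v y)"
  have "S *v z = L *v y"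
    by (simp add: z_def matrix_vector_mul_assoc matrix_mul_assoc
        matrix_inv_mult(1)[OF dispersion_matrix_invertible[OF S]])
  then have "L *v (transpose L *v z) = L *v y"
    by (simp only: matrix_vector_mul_assoc L)
  then have "transpose L *v z = y"
    using inj_matrix_vector_mult[OF dispersion_factor_invertible[OF S L]] by (simp only: inj_eq)
  then have "(L *v y) \<bullet> z = y \<bullet> y"
    using dot_lmul_matrix[of z L y] by (simp add: inner_commute)
  then show ?thesis
    by (simp add: mahalanobis_def flip: z_def)
qed

text \<open>\<open>C\<close> collects the Jacobian of the affine map and the determinant factor of
  the density; its value is left open and only its sign is recorded.\<close>

lemma distributed_standardize:
  fixes S :: "real ^ 'n::finite ^ 'n" and P :: "real ^ 'n ^ 'n"
  assumes S: "dispersion_matrix S" and P: "P ** transpose P = S"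
    and X: "distributed M lborel X (\<lambda>x. ennreal (elliptical_density \<xi> S h x))"
  obtains C where "0 < C"
    "distributed M lborel (\<lambda>\<omega>. matrix_inv P *v (X \<omega> - \<xi>)) (\<lambda>y. ennreal (C * h (y \<bullet> y)))"
proof -
  note inv = dispersion_factor_invertible[OF S P]
  obtain c where c: "0 < c"
    "\<And>t f. f \<in> borel_measurable borel \<Longrightarrow>
      (\<integral>\<^sup>+x. f x \<partial>lborel) = ennreal c * (\<integral>\<^sup>+y. f (t + P *v y) \<partial>lborel)"
    using nn_integral_lborel_affine_matrix[OF inv] by metis
  define C where "C = c * det S powr (- 1 / 2)"
  have "det S \<noteq> 0" using dispersion_matrix_invertible[OF S] by (simp add: invertible_det_nz)
  then have C0: "0 < C" using c(1) by (simp add: C_def)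
  define e where "e x = ennreal (elliptical_density \<xi> S h x)" for x
  have X': "distributed M lborel X e" using X by (simp add: e_def[abs_def])
  let ?g = "\<lambda>x. matrix_inv P *v (x - \<xi>)"
  have Xm[measurable]: "X \<in> borel_measurable M" using distributed_measurable[OF X] by simp
  have gm[measurable]: "?g \<in> borel_measurable borel"
    by (intro borel_measurable_continuous_onI continuous_on_compose2[OF matrix_vector_mult_linear_continuous_on] continuous_intros) auto
  have am[measurable]: "(\<lambda>y. \<xi> + P *v y) \<in> borel_measurable borel"
    by (intro borel_measurable_continuous_onI continuous_intros)
  have em[measurable]: "e \<in> borel_measurable borel"
    using distributed_borel_measurable[OF X'] by simp
  have g: "?g (\<xi> + P *v y) = y" for y
    by (simp add: matrix_vector_mul_assoc matrix_inv_mult(2)[OF inv])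
  have eq: "ennreal (C * h (y \<bullet> y)) = ennreal c * e (\<xi> + P *v y)" for y
    using c(1) by (simp add: e_def elliptical_density_def mahalanobis_factor[OF S P] C_def mult.assoc ennreal_mult')
  \<comment> \<open>Nothing is assumed about the measurability of \<open>h\<close> itself, so that
    of the new density is drawn from the given density through the affine map.\<close>
  have "(\<lambda>y. ennreal c * e (\<xi> + P *v y)) \<in> borel_measurable borel"
    by measurable
  then have hm[measurable]: "(\<lambda>y::real ^ 'n. ennreal (C * h (y \<bullet> y))) \<in> borel_measurable borel"
    by (simp only: eq)
  have "emeasure (distr M lborel (\<lambda>\<omega>. ?g (X \<omega>))) E = emeasure (density lborel (\<lambda>y. ennreal (C * h (y \<bullet> y)))) E"
    if [measurable]: "E \<in> sets borel" for E
  proof -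
    have "emeasure (distr M lborel (\<lambda>\<omega>. ?g (X \<omega>))) E = emeasure (distr M lborel X) (?g -` E)"
      using measurable_sets_borel[OF gm that]
      by (simp add: emeasure_distr vimage_def Int_def)
    also have "\<dots> = (\<integral>\<^sup>+x. e x * indicator E (?g x) \<partial>lborel)"
      using measurable_sets_borel[OF gm that]
      by (simp add: distributed_distr_eq_density[OF X'] emeasure_density indicator_def vimage_def)
    also have "\<dots> = ennreal c * (\<integral>\<^sup>+y. e (\<xi> + P *v y) * indicator E (?g (\<xi> + P *v y)) \<partial>lborel)"
      by (rule c(2)) measurable
    also have "\<dots> = (\<integral>\<^sup>+y. ennreal (C * h (y \<bullet> y)) * indicator E y \<partial>lborel)"
      unfolding g eq by (subst nn_integral_cmult[symmetric]) (auto simp: mult.assoc)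
    finally show ?thesis by (simp add: emeasure_density)
  qed
  then have "distr M lborel (\<lambda>\<omega>. ?g (X \<omega>)) = density lborel (\<lambda>y. ennreal (C * h (y \<bullet> y)))"
    by (intro measure_eqI) auto
  then have "distributed M lborel (\<lambda>\<omega>. ?g (X \<omega>)) (\<lambda>y. ennreal (C * h (y \<bullet> y)))"
    unfolding distributed_def using hm by simp
  with C0 show ?thesis by (rule that)
qed

section \<open>Block matrices and the Schur complement\<close>

lemma block_matrix_component:
  "block_matrix A B C D $ Inl i $ Inl i' = A $ i $ i'"
  "block_matrix A B C D $ Inl i $ Inr j = B $ i $ j"
  "block_matrix A B C D $ Inr j $ Inl i = C $ j $ i"
  "block_matrix A B C D $ Inr j $ Inr j' = D $ j $ j'"
  by (simp_all add: block_matrix_def)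

lemma block_matrix_blocks:
  "block_matrix (block11 \<Omega>) (block12 \<Omega>) (block21 \<Omega>) (block22 \<Omega>) = \<Omega>"
  by (simp add: vec_eq_iff split_sum_all block_matrix_component block11_def block12_def block21_def block22_def)

lemma block_matrix_mult:
  fixes A :: "real ^ 'm::finite ^ 'm" and D :: "real ^ 'n::finite ^ 'n"
  shows "block_matrix A B C D ** block_matrix A' B' C' D' =
    block_matrix (A ** A' + B ** C') (A ** B' + B ** D') (C ** A' + D ** C') (C ** B' + D ** D')"
  by (simp add: vec_eq_iff split_sum_all matrix_matrix_mult_def sum_UNIV_Plus block_matrix_component)

lemma block_matrix_vector_mult:
  fixes A :: "real ^ 'm::finite ^ 'm" and D :: "real ^ 'n::finite ^ 'n"
  shows "block_matrix A B C D *v stack u v = stack (A *v u + B *v v) (C *v u + D *v v)"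
  by (simp add: vec_eq_iff split_sum_all matrix_vector_mult_def sum_UNIV_Plus block_matrix_component)

lemma transpose_block_matrix:
  "transpose (block_matrix A B C D) = block_matrix (transpose A) (transpose C) (transpose B) (transpose D)"
  by (simp add: vec_eq_iff split_sum_all transpose_def block_matrix_component)

lemma transpose_matrix_inv:
  fixes A :: "real ^ 'n::finite ^ 'n"
  assumes "invertible A" "transpose A = A"
  shows "transpose (matrix_inv A) = matrix_inv A"
proof -
  have "transpose (matrix_inv A) ** A = transpose (A ** matrix_inv A)"
    by (simp add: matrix_transpose_mul assms(2))
  then have "transpose (matrix_inv A) ** A = mat 1"
    by (simp add: matrix_inv_mult assms(1))
  then have "transpose (matrix_inv A) ** A ** matrix_inv A = matrix_inv A" by simp
  then show ?thesis
    by (simp add: matrix_inv_mult assms(1) flip: matrix_mul_assoc)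
qed

lemma inner_stack: "stack u v \<bullet> stack u' v' = u \<bullet> u' + v \<bullet> (v' :: real ^ 'n::finite)"
  for u u' :: "real ^ 'm::finite"
  by (simp add: inner_split_parts)

context
  fixes \<Omega> :: "real ^ ('m::finite + 'n::finite) ^ ('m + 'n)"
  assumes \<Omega>: "dispersion_matrix \<Omega>"
begin

lemma transpose_blocks:
  "transpose (block22 \<Omega>) = block22 \<Omega>" "transpose (block12 \<Omega>) = block21 \<Omega>"
  "transpose (block21 \<Omega>) = block12 \<Omega>" "transpose (block11 \<Omega>) = block11 \<Omega>"
proof -
  have "\<Omega> $ a $ b = transpose \<Omega> $ a $ b" for a b
    using \<Omega> by (simp add: dispersion_matrix_def)
  then have "\<Omega> $ a $ b = \<Omega> $ b $ a" for a b
    by (simp add: transpose_def)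
  then show "transpose (block22 \<Omega>) = block22 \<Omega>" "transpose (block12 \<Omega>) = block21 \<Omega>"
    "transpose (block21 \<Omega>) = block12 \<Omega>" "transpose (block11 \<Omega>) = block11 \<Omega>"
    unfolding vec_eq_iff transpose_def block22_def block12_def block21_def block11_def
    by (metis (no_types, lifting) vec_lambda_beta)+
qed

text \<open>Test vectors with vanishing first block see only this block of \<Omega>.\<close>

lemma dispersion_block22: "dispersion_matrix (block22 \<Omega>)"
  unfolding dispersion_matrix_def
proof (intro conjI allI impI)
  fix v :: "real ^ 'n" assume "v \<noteq> 0"
  then have "stack (0 :: real ^ 'm) v \<noteq> 0" by (auto simp: vec_eq_iff split_sum_all)
  then have "0 < stack 0 v \<bullet> (\<Omega> *v stack 0 v)" using \<Omega> by (simp add: dispersion_matrix_def)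
  also have "\<dots> = v \<bullet> (block22 \<Omega> *v v)"
    by (subst block_matrix_blocks[symmetric])
       (simp add: block_matrix_vector_mult inner_stack)
  finally show "0 < v \<bullet> (block22 \<Omega> *v v)" .
qed (rule transpose_blocks)

lemma dispersion_schur:
  "dispersion_matrix (block11 \<Omega> - block12 \<Omega> ** matrix_inv (block22 \<Omega>) ** block21 \<Omega>)" (is "dispersion_matrix ?S")
  unfolding dispersion_matrix_def
proof (intro conjI allI impI)
  note inv = dispersion_matrix_invertible[OF dispersion_block22]
  have "transpose (A - B) = transpose A - transpose B" for A B :: "real ^ 'm ^ 'm"
    by (simp add: transpose_def vec_eq_iff)
  then show "transpose ?S = ?S"
    by (simp add: matrix_transpose_mul transpose_blocks transpose_matrix_inv[OF inv] matrix_mul_assoc)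
  fix u :: "real ^ 'm" assume u: "u \<noteq> 0"
  \<comment> \<open>For fixed \<open>u\<close> this second block minimizes the quadratic form: it
    makes the second block of \<open>\<Omega> *v stack u ?v\<close> vanish and leaves the Schur
    complement applied to \<open>u\<close> in the first.\<close>
  let ?v = "- (matrix_inv (block22 \<Omega>) ** block21 \<Omega> *v u)"
  have "stack u ?v \<noteq> 0" using u by (auto simp: vec_eq_iff split_sum_all)
  then have "0 < stack u ?v \<bullet> (\<Omega> *v stack u ?v)" using \<Omega> by (simp add: dispersion_matrix_def)
  also have "\<Omega> *v stack u ?v = stack (?S *v u) 0"
  proof -
    have neg: "A *v (- x) = - (A *v x)" for A :: "real ^ 'n ^ 'k::finite" and x
      by (simp add: matrix_vector_mult_def vec_eq_iff sum_negf)
    show ?thesis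
      by (subst (1) block_matrix_blocks[symmetric])
         (simp add: block_matrix_vector_mult neg matrix_vector_mul_assoc matrix_mul_assoc
           matrix_inv_mult(1)[OF inv] matrix_vector_mult_diff_rdistrib)
  qed
  also have "stack u ?v \<bullet> stack (?S *v u) 0 = u \<bullet> (?S *v u)"
    by (simp add: inner_stack)
  finally show "0 < u \<bullet> (?S *v u)" .
qed

text \<open>The off-diagonal block is forced: B K must satisfy (B K) K^T = \<Omega>12. Its square B
  K (B K)^T = B \<Omega>21 is then exactly what the Schur complement subtracts from
  \<Omega>11.\<close>

lemma block_factor:
  assumes L: "L ** transpose L = block11 \<Omega> - block12 \<Omega> ** matrix_inv (block22 \<Omega>) ** block21 \<Omega>"
    and K: "K ** transpose K = block22 \<Omega>"
  defines "P \<equiv> block_matrix L (block12 \<Omega> ** matrix_inv (block22 \<Omega>) ** K) 0 K"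
  shows "P ** transpose P = \<Omega>"
proof -
  note inv = dispersion_matrix_invertible[OF dispersion_block22]
  define B where "B = block12 \<Omega> ** matrix_inv (block22 \<Omega>)"
  have B: "B ** block22 \<Omega> = block12 \<Omega>" "block22 \<Omega> ** transpose B = block21 \<Omega>"
    by (simp_all add: B_def matrix_transpose_mul transpose_matrix_inv[OF inv] transpose_blocks
        matrix_inv_mult[OF inv] matrix_mul_assoc) (simp add: matrix_inv_mult[OF inv] flip: matrix_mul_assoc)
  have t0: "transpose (0 :: real ^ 'm ^ 'n) = 0" by (simp add: transpose_def vec_eq_iff)
  have z: "X ** (0 :: real ^ 'n ^ 'm) = 0" "(0 :: real ^ 'm ^ 'n) ** Y = 0"
     for X :: "real ^ 'm ^ 'm" and Y :: "real ^ 'm ^ 'm"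
    by (simp_all add: matrix_matrix_mult_def vec_eq_iff)
  have z': "(0 :: real ^ 'm ^ 'n) ** Y = 0" for Y :: "real ^ 'n ^ 'm"
    by (simp_all add: matrix_matrix_mult_def vec_eq_iff)
  have "B ** K ** transpose (B ** K) = B ** (K ** transpose K) ** transpose B"
    by (simp add: matrix_transpose_mul matrix_mul_assoc)
  also have "\<dots> = B ** (block22 \<Omega> ** transpose B)" by (simp only: K matrix_mul_assoc)
  also have "\<dots> = B ** block21 \<Omega>" by (simp only: B)
  finally have 1: "B ** K ** transpose (B ** K) = B ** block21 \<Omega>" .
  have 2: "B ** K ** transpose K = block12 \<Omega>" using B by (simp add: K flip: matrix_mul_assoc)
  have 3: "K ** transpose (B ** K) = block21 \<Omega>"
    using B K by (simp add: matrix_transpose_mul matrix_mul_assoc)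
  have "P ** transpose P = block_matrix (block11 \<Omega>) (block12 \<Omega>) (block21 \<Omega>) (block22 \<Omega>)"
    unfolding P_def B_def[symmetric] transpose_block_matrix block_matrix_mult
    by (simp add: t0 z z' 1 2 3 K L) (simp add: B_def)
  then show ?thesis by (simp add: block_matrix_blocks)
qed

end

section \<open>Radial integrals\<close>

lemma nn_integral_lborel_scaleR:
  fixes f :: "real ^ 'n::finite \<Rightarrow> ennreal"
  assumes [measurable]: "f \<in> borel_measurable borel" and c: "0 < c"
  shows "(\<integral>\<^sup>+y. f y \<partial>lborel) = ennreal (c ^ CARD('n)) * (\<integral>\<^sup>+y. f (c *\<^sub>R y) \<partial>lborel)"
  using c by (subst lborel_affine[of c 0]) (simp_all add: nn_integral_density nn_integral_distr nn_integral_cmult)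

lemma powr_at_top_0:
  assumes "a < 0" "0 < c"
  shows "((\<lambda>x::real. (1 + c * x) powr a) \<longlongrightarrow> 0) at_top"
  using assms by (intro tendsto_neg_powr) (real_asymp | simp)+

text \<open>Layer cake: the integrand is the integral of b c (1 + c s)^(-b - 1) over s above y
  \<bullet> y. After Fubini the inner integral is the volume of a ball of radius sqrt s, which grows
  at most like (1 + c s)^(n/2).\<close>

lemma powr_radial_finite:
  assumes c: "0 < c" and b: "real CARD('n::finite) / 2 < b"
  shows "(\<integral>\<^sup>+y. ennreal ((1 + c * (y \<bullet> y)) powr - b) \<partial>(lborel :: (real ^ 'n) measure)) < \<infinity>"
proof -
  let ?n = "CARD('n)"
  have b0: "0 < b" using b by (meson divide_nonneg_nonneg le_less_trans of_nat_0_le_iff zero_le_numeral)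
  define g where "g s = (if 0 \<le> s then b * c * (1 + c * s) powr (- b - 1) else 0)" for s :: real
  define f where "f y s = ennreal (g s) * (if y \<bullet> y \<le> s then 1 else 0)" for y :: "real ^ 'n" and s
  have [measurable]: "g \<in> borel_measurable borel" unfolding g_def by measurable
  have fm[measurable]: "case_prod f \<in> borel_measurable (lborel \<Otimes>\<^sub>M lborel)"
    unfolding f_def by measurable
  have "ennreal ((1 + c * (y \<bullet> y)) powr - b) = (\<integral>\<^sup>+s. f y s \<partial>lborel)" for y :: "real ^ 'n"
  proof -
    have "(\<integral>\<^sup>+s. ennreal (g s) * indicator {y \<bullet> y..} s \<partial>lborel) = ennreal (0 - (- ((1 + c * (y \<bullet> y)) powr - b)))"
    proof (rule nn_integral_FTC_atLeast)
      fix s :: real assume s: "y \<bullet> y \<le> s"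
      have s0: "0 \<le> s" using s by (meson inner_ge_zero order_trans)
      show "0 \<le> g s" using b0 c by (simp add: g_def)
      show "((\<lambda>s. - ((1 + c * s) powr - b)) has_real_derivative g s) (at s)"
        using s0 c by (auto intro!: derivative_eq_intros simp: g_def add_pos_nonneg field_simps)
    next
      show "((\<lambda>s. - ((1 + c * s) powr - b)) \<longlongrightarrow> 0) at_top"
        using tendsto_minus[OF powr_at_top_0[of "- b" c]] b0 c by simp
    qed measurable
    then show ?thesis by (simp add: f_def indicator_def of_bool_def)
  qed
  then have "(\<integral>\<^sup>+y. ennreal ((1 + c * (y \<bullet> y)) powr - b) \<partial>(lborel :: (real ^ 'n) measure))
      = (\<integral>\<^sup>+s. \<integral>\<^sup>+y. f y s \<partial>lborel \<partial>lborel)"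
    by (simp add: lborel_pair.Fubini'[OF fm])
  also have "\<dots> \<le> (\<integral>\<^sup>+s. ennreal (b * c * unit_ball_vol ?n * (1 / c) powr (?n / 2) *
      (1 + c * s) powr (?n / 2 - b - 1)) * indicator {0..} s \<partial>lborel)"
  proof (rule nn_integral_mono)
    fix s :: real
    show "(\<integral>\<^sup>+y. f y s \<partial>lborel) \<le> ennreal (b * c * unit_ball_vol ?n * (1 / c) powr (?n / 2) *
      (1 + c * s) powr (?n / 2 - b - 1)) * indicator {0..} s"
    proof (cases "0 \<le> s")
      case True
      have "(if y \<bullet> y \<le> s then 1 else 0 :: ennreal) = indicator (cball 0 (sqrt s)) y" for y :: "real ^ 'n"
        by (simp add: indicator_def norm_eq_sqrt_inner)
      then have "(\<integral>\<^sup>+y. f y s \<partial>lborel) = ennreal (g s) * emeasure lborel (cball (0 :: real ^ 'n) (sqrt s))"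
        unfolding f_def by (simp add: nn_integral_cmult_indicator)
      also have "\<dots> = ennreal (g s * (unit_ball_vol ?n * sqrt s ^ ?n))"
        using True b0 c by (simp add: emeasure_cball ennreal_mult g_def)
      also have "\<dots> \<le> ennreal (b * c * unit_ball_vol ?n * (1 / c) powr (?n / 2) *
          (1 + c * s) powr (?n / 2 - b - 1))"
      proof (rule ennreal_leI)
        have "sqrt s ^ ?n = s powr (?n / 2)"
          using True by (cases "s = 0") (simp_all add: powr_half_sqrt[symmetric] powr_realpow[symmetric] powr_powr)
        also have "\<dots> \<le> ((1 / c) * (1 + c * s)) powr (?n / 2)"
          using True c by (intro powr_mono2) (auto simp: field_simps)
        also have "\<dots> = (1 / c) powr (?n / 2) * (1 + c * s) powr (?n / 2)"
          by (rule powr_mult)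
        finally have "g s * (unit_ball_vol ?n * sqrt s ^ ?n) \<le> 
            b * c * (1 + c * s) powr (- b - 1) * (unit_ball_vol ?n * ((1 / c) powr (?n / 2) * (1 + c * s) powr (?n / 2)))"
          using True b0 c by (auto simp: g_def intro!: mult_left_mono)
        also have "\<dots> = b * c * unit_ball_vol ?n * (1 / c) powr (?n / 2) *
            ((1 + c * s) powr (- b - 1) * (1 + c * s) powr (?n / 2))"
          by (simp only: mult_ac)
        also have "(1 + c * s) powr (- b - 1) * (1 + c * s) powr (?n / 2) = (1 + c * s) powr (?n / 2 - b - 1)"
          by (simp flip: powr_add add: algebra_simps)
        finally show "g s * (unit_ball_vol ?n * sqrt s ^ ?n) \<le> b * c * unit_ball_vol ?n * (1 / c) powr (?n / 2) *
          (1 + c * s) powr (?n / 2 - b - 1)" .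
      qed
      finally show ?thesis using True by simp
    qed (simp add: f_def g_def)
  qed
  also have "\<dots> < \<infinity>"
  proof -
    \<comment> \<open>The remaining exponent n/2 - b - 1 lies below -1 by the margin
      \<open>e\<close>, so the tail integral has an explicit antiderivative vanishing at
      infinity.\<close>
    define e where "e = b - ?n / 2"
    have e: "0 < e" using b by (simp add: e_def)
    define D where "D = b * c * unit_ball_vol ?n * (1 / c) powr (?n / 2)"
    have D: "0 \<le> D" using b0 c by (simp add: D_def)
    have "(\<integral>\<^sup>+s. ennreal (D * (1 + c * s) powr (- e - 1)) * indicator {0..} s \<partial>lborel)
        = ennreal (0 - (- (D / (c * e) * (1 + c * 0) powr - e)))"
    proof (rule nn_integral_FTC_atLeast)
      fix s :: real assume s: "0 \<le> s"
      show "0 \<le> D * (1 + c * s) powr (- e - 1)" using D by simp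
      show "((\<lambda>s. - (D / (c * e) * (1 + c * s) powr - e)) has_real_derivative D * (1 + c * s) powr (- e - 1)) (at s)"
        using s c e by (auto intro!: derivative_eq_intros simp: add_pos_nonneg field_simps)
    next
      have "((\<lambda>s. - (D / (c * e) * (1 + c * s) powr - e)) \<longlongrightarrow> - (D / (c * e) * 0)) at_top"
        using e c by (intro tendsto_intros powr_at_top_0) auto
      then show "((\<lambda>s. - (D / (c * e) * (1 + c * s) powr - e)) \<longlongrightarrow> 0) at_top" by simp
    qed measurable
    then show ?thesis unfolding D_def[symmetric] e_def by (simp add: algebra_simps)
  qed
  finally show ?thesis .
qed

text \<open>Integrate \<open>k q = (\<integral>s\<ge>1. q * k1 (s * q))\<close> over \<open>q = y \<bullet> y\<close> and rescale \<open>y\<close> by \<open>sqrt s\<close>.\<close>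

lemma radial_virial:
  fixes k k1 :: "real \<Rightarrow> real"
  assumes deriv: "\<And>u. 0 \<le> u \<Longrightarrow> (k has_real_derivative - k1 u) (at u)"
    and nonneg: "\<And>u. 0 \<le> u \<Longrightarrow> 0 \<le> k1 u"
    and lim: "(k \<longlongrightarrow> 0) at_top"
    and [measurable]: "k1 \<in> borel_measurable borel"
  shows "(\<integral>\<^sup>+y. ennreal (k (y \<bullet> y)) \<partial>(lborel :: (real ^ 'n::finite) measure)) =
    ennreal (2 / CARD('n)) * (\<integral>\<^sup>+y. ennreal ((y \<bullet> y) * k1 (y \<bullet> y)) \<partial>(lborel :: (real ^ 'n) measure))"
proof -
  let ?n = "CARD('n)"
  define f where "f y s = ennreal ((y \<bullet> y) * k1 (s * (y \<bullet> y))) * indicator {1..} s" for y :: "real ^ 'n" and s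
  define J where "J = (\<integral>\<^sup>+y. ennreal ((y \<bullet> y) * k1 (y \<bullet> y)) \<partial>(lborel :: (real ^ 'n) measure))"
  have fm[measurable]: "case_prod f \<in> borel_measurable (lborel \<Otimes>\<^sub>M lborel)"
    unfolding f_def by measurable
  \<comment> \<open>The origin is left out because \<open>f\<close> vanishes there while
    \<open>k 0\<close> need not; as a single point it is null.\<close>
  have "ennreal (k (y \<bullet> y)) = (\<integral>\<^sup>+s. f y s \<partial>lborel)" if "y \<noteq> 0" for y :: "real ^ 'n"
  proof -
    have q: "0 < y \<bullet> y" using that by simp
    have "(\<integral>\<^sup>+s. ennreal ((y \<bullet> y) * k1 (s * (y \<bullet> y))) * indicator {1..} s \<partial>lborel) = ennreal (0 - (- k (1 * (y \<bullet> y))))"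
    proof (rule nn_integral_FTC_atLeast)
      fix s :: real assume s: "1 \<le> s"
      have sq: "0 \<le> s * (y \<bullet> y)" using s q by simp
      show "0 \<le> (y \<bullet> y) * k1 (s * (y \<bullet> y))" using q nonneg[OF sq] by simp
      have "((\<lambda>s. k (s * (y \<bullet> y))) has_real_derivative (- k1 (s * (y \<bullet> y)) * (y \<bullet> y))) (at s)"
        by (rule DERIV_chain2[where f = k and g = "\<lambda>s. s * (y \<bullet> y)", OF deriv[OF sq]]) (auto intro!: derivative_eq_intros)
      then show "((\<lambda>s. - k (s * (y \<bullet> y))) has_real_derivative ((y \<bullet> y) * k1 (s * (y \<bullet> y)))) (at s)"
        by (auto intro!: derivative_eq_intros simp: mult.commute)
    next
      have "filterlim (\<lambda>s. s * (y \<bullet> y)) at_top at_top"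
        using q by (simp add: filterlim_tendsto_pos_mult_at_top filterlim_at_top_mult_tendsto_pos[OF tendsto_const _ filterlim_ident])
      from tendsto_minus[OF filterlim_compose[OF lim this]]
      show "((\<lambda>s. - k (s * (y \<bullet> y))) \<longlongrightarrow> 0) at_top" by simp
    qed measurable
    then show ?thesis by (simp add: f_def)
  qed
  then have "(\<integral>\<^sup>+y. ennreal (k (y \<bullet> y)) \<partial>(lborel :: (real ^ 'n) measure)) = (\<integral>\<^sup>+y. \<integral>\<^sup>+s. f y s \<partial>lborel \<partial>lborel)"
    by (intro nn_integral_cong_AE) (use AE_lborel_singleton[of "0 :: real ^ 'n"] in auto)
  also have "\<dots> = (\<integral>\<^sup>+s. \<integral>\<^sup>+y. f y s \<partial>lborel \<partial>lborel)"
    by (simp add: lborel_pair.Fubini'[OF fm])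
  also have "\<dots> = (\<integral>\<^sup>+s. ennreal (s powr (- (?n / 2) - 1)) * indicator {1..} s * J \<partial>lborel)"
  proof (rule nn_integral_cong)
    fix s :: real
    show "(\<integral>\<^sup>+y. f y s \<partial>lborel) = ennreal (s powr (- (?n / 2) - 1)) * indicator {1..} s * J"
    proof (cases "1 \<le> s")
      case True
      \<comment> \<open>Scaling \<open>y\<close> by \<open>r\<close> removes \<open>s\<close> from
        the argument of \<open>k1\<close>. The volume contributes s^(-n/2) and the factor y
        \<bullet> y contributes 1/s, so the integral over s is that of s^(-n/2 - 1) from 1 on, which
        is the constant 2/n.\<close>
      define r where "r = s powr (- 1 / 2)"
      have r: "0 < r" using True by (simp add: r_def)
      have rr: "r * r = 1 / s" using True by (simp add: r_def powr_minus field_simps flip: powr_add)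
      have rn: "r ^ ?n = s powr (- (?n / 2))"
        using True by (simp add: r_def powr_powr flip: powr_realpow)
      have "(\<integral>\<^sup>+y. f y s \<partial>lborel) = ennreal (r ^ ?n) * (\<integral>\<^sup>+y. f (r *\<^sub>R y) s \<partial>lborel)"
        by (rule nn_integral_lborel_scaleR[OF _ r]) (simp add: f_def)
      also have "(\<lambda>y. f (r *\<^sub>R y) s) = (\<lambda>y::real ^ 'n. ennreal (1 / s) * ennreal ((y \<bullet> y) * k1 (y \<bullet> y)))"
        using True by (auto simp: f_def fun_eq_iff rr mult.assoc[symmetric] ennreal_mult'[symmetric])
      also have "(\<integral>\<^sup>+y. ennreal (1 / s) * ennreal ((y \<bullet> y) * k1 (y \<bullet> y)) \<partial>(lborel :: (real ^ 'n) measure)) = ennreal (1 / s) * J"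
        unfolding J_def by (rule nn_integral_cmult) measurable
      also have "ennreal (r ^ ?n) * (ennreal (1 / s) * J) = ennreal (s powr (- (?n / 2)) * (1 / s)) * J"
        using True by (simp add: rn mult.assoc[symmetric] ennreal_mult'[symmetric])
      also have "s powr (- (?n / 2)) * (1 / s) = s powr (- (?n / 2) - 1)"
        using True by (simp add: powr_diff)
      finally show ?thesis using True by simp
    qed (simp add: f_def)
  qed
  also have "\<dots> = (\<integral>\<^sup>+s. ennreal (s powr (- (?n / 2) - 1)) * indicator {1..} s \<partial>lborel) * J"
    by (rule nn_integral_multc) measurable
  also have "(\<integral>\<^sup>+s. ennreal (s powr (- (?n / 2) - 1)) * indicator {1..} s \<partial>lborel) = ennreal (0 - (- (2 / ?n * 1 powr (- (?n / 2)))))"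
  proof (rule nn_integral_FTC_atLeast)
    fix s :: real assume s: "1 \<le> s"
    show "((\<lambda>s. - (2 / ?n * s powr (- (?n / 2)))) has_real_derivative s powr (- (?n / 2) - 1)) (at s)"
      using s by (auto intro!: derivative_eq_intros simp: field_simps)
  next
    have "((\<lambda>s. - (2 / ?n * s powr (- (?n / 2)))) \<longlongrightarrow> - (2 / ?n * 0)) at_top"
      by (intro tendsto_intros tendsto_neg_powr filterlim_ident) simp
    then show "((\<lambda>s. - (2 / ?n * s powr (- (?n / 2)))) \<longlongrightarrow> 0) at_top" by simp
  qed auto
  finally show ?thesis by (simp add: J_def)
qed

text \<open>The bound (1 + x/n)^n \<le> exp x at x = (y \<bullet> y)/2 dominates the Gaussian by a
  power with exponent n, above the threshold n/2 of \<open>powr_radial_finite\<close>.\<close>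

lemma exp_radial_finite:
  "(\<integral>\<^sup>+y. ennreal (exp (- (d + y \<bullet> y) / 2)) \<partial>(lborel :: (real ^ 'n::finite) measure)) < \<infinity>"
proof -
  let ?n = "CARD('n)"
  have "exp (- (d + y \<bullet> y) / 2) \<le> exp (- d / 2) * (1 + 1 / (2 * ?n) * (y \<bullet> y)) powr - real ?n" for y :: "real ^ 'n"
  proof -
    have "(1 + (y \<bullet> y / 2) / ?n) ^ ?n \<le> exp (y \<bullet> y / 2)"
      by (rule exp_ge_one_plus_x_over_n_power_n) (auto intro: order_trans[of _ 0])
    moreover have "0 < 1 + (y \<bullet> y / 2) / ?n" by (simp add: add_pos_nonneg)
    ultimately have "exp (- (y \<bullet> y) / 2) \<le> inverse ((1 + (y \<bullet> y / 2) / ?n) ^ ?n)"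
      by (simp add: exp_minus le_imp_inverse_le)
    also have "\<dots> = (1 + 1 / (2 * ?n) * (y \<bullet> y)) powr - real ?n"
      using \<open>0 < 1 + (y \<bullet> y / 2) / ?n\<close> by (simp add: powr_minus powr_realpow)
    finally have "exp (- (y \<bullet> y) / 2) \<le> (1 + 1 / (2 * ?n) * (y \<bullet> y)) powr - real ?n" .
    moreover have "- (d + y \<bullet> y) / 2 = - d / 2 + - (y \<bullet> y) / 2" by simp
    ultimately show ?thesis by (simp only: exp_add mult_left_mono exp_ge_zero)
  qed
  then have "(\<integral>\<^sup>+y. ennreal (exp (- (d + y \<bullet> y) / 2)) \<partial>(lborel :: (real ^ 'n) measure))
      \<le> (\<integral>\<^sup>+y. ennreal (exp (- d / 2)) * ennreal ((1 + 1 / (2 * ?n) * (y \<bullet> y)) powr - real ?n) \<partial>(lborel :: (real ^ 'n) measure))"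
    by (intro nn_integral_mono) (auto simp flip: ennreal_mult intro!: ennreal_leI)
  also have "\<dots> = ennreal (exp (- d / 2)) * (\<integral>\<^sup>+y. ennreal ((1 + 1 / (2 * ?n) * (y \<bullet> y)) powr - real ?n) \<partial>(lborel :: (real ^ 'n) measure))"
    by (rule nn_integral_cmult) measurable
  also have "\<dots> < \<infinity>"
    using powr_radial_finite[where 'n = 'n, of "1 / (2 * ?n)" ?n] by (simp add: ennreal_mult_less_top)
  finally show ?thesis .
qed

lemma nn_integral_lborel_pos:
  fixes f :: "'a::euclidean_space \<Rightarrow> real"
  assumes [measurable]: "f \<in> borel_measurable borel" and pos: "\<And>x. 0 < f x"
  shows "(\<integral>\<^sup>+x. ennreal (f x) \<partial>lborel) \<noteq> 0"
proof
  assume "(\<integral>\<^sup>+x. ennreal (f x) \<partial>lborel) = 0"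
  then have "AE x in lborel. ennreal (f x) = 0" by (subst (asm) nn_integral_0_iff_AE) auto
  then have "AE x in (lborel :: 'a measure). False" by (rule eventually_mono) (metis ennreal_eq_0_iff not_le pos)
  then show False by (auto simp: eventually_ae_filter null_sets_def top.extremum_unique)
qed

lemma integral_eq_of_nn_integral:
  assumes "f \<in> borel_measurable M" "\<And>x. 0 \<le> f x" "(\<integral>\<^sup>+x. ennreal (f x) \<partial>M) = ennreal r" "0 \<le> r"
  shows "(\<integral>x. f x \<partial>M) = r"
  using assms by (simp add: integral_eq_nn_integral)

text \<open>\<open>I\<close> and \<open>J\<close> are the zeroth and second radial moments of the
  shifted generator. In the degenerate case \<open>I = 0\<close> both sides are 0, since division by
  zero gives 0.\<close>

lemma covariance_factor_conditional:
  fixes h :: "real \<Rightarrow> real" and I J :: real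
  assumes [measurable]: "h \<in> borel_measurable borel"
    and nonneg: "\<And>u. d \<le> u \<Longrightarrow> 0 \<le> h u"
    and I: "(\<integral>\<^sup>+z. ennreal (h (d + z \<bullet> z)) \<partial>(lborel :: (real ^ 'm::finite) measure)) = ennreal I" "0 \<le> I"
    and J: "(\<integral>\<^sup>+z. ennreal ((z \<bullet> z) * h (d + z \<bullet> z)) \<partial>(lborel :: (real ^ 'm) measure)) = ennreal J" "0 \<le> J"
  shows "covariance_factor TYPE('m) (conditional_generator TYPE('m) h d) = J / (CARD('m) * I)"
proof -
  have "marginal_generator TYPE('m) h d = I"
    unfolding marginal_generator_def by (rule integral_eq_of_nn_integral[OF _ _ I]) (auto intro: nonneg)
  moreover have "(\<integral>z. (z \<bullet> z) * h (d + z \<bullet> z) \<partial>(lborel :: (real ^ 'm) measure)) = J"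
    by (rule integral_eq_of_nn_integral[OF _ _ J]) (auto intro!: mult_nonneg_nonneg nonneg)
  ultimately show ?thesis
    by (simp add: covariance_factor_def conditional_generator_def add.commute divide_simps)
qed

text \<open>Write p for the base of the power and I' for the integral of p^(1 - a). The virial
  identity expresses I' through J alone, and the splitting p^(1 - a) = p p^(-a) expresses it through
  I and J; eliminating I' gives the relation. \<open>s\<close> counts the coordinates already
  integrated into the exponent: r2 for the conditional law, 0 for the full vector.\<close>

lemma student_radial_moments:
  fixes \<nu> d s :: real
  defines "a \<equiv> (\<nu> + real CARD('m::finite) + s) / 2"
  assumes \<nu>: "0 < \<nu>" "2 < \<nu> + s" and d: "0 \<le> d"
  obtains I J :: real where
    "(\<integral>\<^sup>+z. ennreal ((1 + (d + z \<bullet> z) / \<nu>) powr - a) \<partial>(lborel :: (real ^ 'm) measure)) = ennreal I"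
    "(\<integral>\<^sup>+z. ennreal ((z \<bullet> z) * (1 + (d + z \<bullet> z) / \<nu>) powr - a) \<partial>(lborel :: (real ^ 'm) measure)) = ennreal J"
    "0 < I" "0 \<le> J" "J * (\<nu> + s - 2) = CARD('m) * (\<nu> + d) * I"
proof -
  let ?m = "real CARD('m)"
  let ?p = "\<lambda>q. 1 + (d + q) / \<nu>"
  let ?NI = "\<lambda>f. \<integral>\<^sup>+z. ennreal (f (z \<bullet> z)) \<partial>(lborel :: (real ^ 'm) measure)"
  have p1: "1 + 1 / \<nu> * q \<le> ?p q" "0 < 1 + 1 / \<nu> * q" "0 < ?p q" if "0 \<le> q" for q
    using that \<nu> d by (auto simp: field_simps add_pos_nonneg intro: add_pos_nonneg)
  \<comment> \<open>The hypothesis 2 < \<nu> + s is precisely the integrability threshold for the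
    exponent \<open>a - 1\<close>.\<close>
  have a: "?m / 2 < a - 1" "?m / 2 < a" using \<nu> by (simp_all add: a_def add_divide_distrib)
  have m0: "0 < ?m" by simp
  have a1: "0 < a - 1" using a m0 by linarith
  have fin: "?NI (\<lambda>q. ?p q powr - b) < \<infinity>" if b: "?m / 2 < b" for b
  proof (rule le_less_trans[OF _ powr_radial_finite[where 'n = 'm and c = "1 / \<nu>", OF _ b]])
    show "?NI (\<lambda>q. ?p q powr - b) \<le> ?NI (\<lambda>q. (1 + 1 / \<nu> * q) powr - b)"
      using p1 b m0 by (intro nn_integral_mono ennreal_leI powr_mono2') auto
  qed (use \<nu> in simp)
  obtain I where I: "?NI (\<lambda>q. ?p q powr - a) = ennreal I" "0 \<le> I"
    using fin[OF a(2)] by (cases "?NI (\<lambda>q. ?p q powr - a)") auto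
  obtain I' where I': "?NI (\<lambda>q. ?p q powr - (a - 1)) = ennreal I'" "0 \<le> I'"
    using fin[OF a(1)] by (cases "?NI (\<lambda>q. ?p q powr - (a - 1))") auto
  have "?NI (\<lambda>q. ?p q powr - a) \<noteq> 0"
    by (rule nn_integral_lborel_pos) (use p1 in \<open>auto simp: less_le\<close>)
  then have I0: "0 < I" using I by (cases "I = 0") auto
  define J' where "J' = ?NI (\<lambda>q. q * ?p q powr - a)"
  have V: "?NI (\<lambda>q. ?p q powr - (a - 1)) = ennreal (2 / ?m) * ?NI (\<lambda>q. q * ((a - 1) / \<nu> * ?p q powr - a))"
  proof (rule radial_virial)
    fix u :: real assume u: "0 \<le> u"
    show "((\<lambda>q. ?p q powr - (a - 1)) has_real_derivative - ((a - 1) / \<nu> * ?p u powr - a)) (at u)"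
    proof -
      have "(?p has_real_derivative 1 / \<nu>) (at u)" using \<nu>(1) by (auto intro!: derivative_eq_intros)
      from DERIV_fun_powr[OF this p1(3)[OF u], of "- (a - 1)"] show ?thesis
        by (simp add: left_diff_distrib diff_divide_distrib)
    qed
    show "0 \<le> (a - 1) / \<nu> * ?p u powr - a" using a1 \<nu> by simp
  next
    have "filterlim ?p at_top at_top" using \<nu>(1) by real_asymp
    then show "((\<lambda>q. ?p q powr - (a - 1)) \<longlongrightarrow> 0) at_top"
      using a1 by (intro tendsto_neg_powr) auto
  qed measurable
  have "?NI (\<lambda>q. q * ((a - 1) / \<nu> * ?p q powr - a)) = ennreal ((a - 1) / \<nu>) * J'"
    unfolding J'_def using a1 \<nu>
    by (subst nn_integral_cmult[symmetric]) (auto simp: ennreal_mult'[symmetric] mult_ac intro!: nn_integral_cong)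
  then have V1: "ennreal I' = ennreal (2 / ?m * ((a - 1) / \<nu>)) * J'"
  proof -
    have "ennreal (2 / ?m * ((a - 1) / \<nu>)) = ennreal (2 / ?m) * ennreal ((a - 1) / \<nu>)"
      by (rule ennreal_mult') simp
    then show ?thesis using V I' \<open>?NI (\<lambda>q. q * ((a - 1) / \<nu> * ?p q powr - a)) = _\<close>
      by (simp only: mult.assoc)
  qed
  \<comment> \<open>Finiteness of the second moment is read off the virial identity, whose other
    side is already known to be finite.\<close>
  have "J' \<noteq> \<infinity>"
  proof
    assume "J' = \<infinity>"
    then have "ennreal I' = \<infinity>"
      unfolding V1 using a1 \<nu> by (simp add: ennreal_mult_eq_top_iff)
    then show False by simp
  qed
  then obtain J where J: "J' = ennreal J" "0 \<le> J" by (cases J') auto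
  have e1: "I' = 2 / ?m * ((a - 1) / \<nu>) * J"
    using V1 I' J a1 \<nu> by (simp flip: ennreal_mult)
  have "ennreal (?p q powr - (a - 1)) = ennreal (1 + d / \<nu>) * ennreal (?p q powr - a) + ennreal (1 / \<nu>) * ennreal (q * ?p q powr - a)"
    if "0 \<le> q" for q
  proof -
    have "?p q powr - (a - 1) = ?p q powr (1 + - a)" by simp
    also have "\<dots> = ?p q * ?p q powr - a" using p1(3)[OF that] by (subst powr_add) simp
    also have "\<dots> = (1 + d / \<nu>) * ?p q powr - a + 1 / \<nu> * (q * ?p q powr - a)"
      by (simp add: algebra_simps add_divide_distrib)
    finally show ?thesis using that \<nu> d by (simp flip: ennreal_mult ennreal_plus)
  qed
  then have "?NI (\<lambda>q. ?p q powr - (a - 1)) = ennreal (1 + d / \<nu>) * ?NI (\<lambda>q. ?p q powr - a) + ennreal (1 / \<nu>) * J'"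
    unfolding J'_def by (simp add: nn_integral_add nn_integral_cmult)
  then have e2: "I' = (1 + d / \<nu>) * I + 1 / \<nu> * J"
    using I I' J \<nu> d by (simp flip: ennreal_mult ennreal_plus)
  have "J * (2 * (a - 1) - ?m) = ?m * (\<nu> + d) * I"
  proof -
    have f1: "2 * (a - 1) * J = ?m * (\<nu> * I')" using e1 \<nu>(1) m0 by (simp add: field_simps)
    have f2: "\<nu> * I' = (\<nu> + d) * I + J" using e2 \<nu>(1) by (simp add: field_simps)
    have "J * (2 * (a - 1) - ?m) = 2 * (a - 1) * J - ?m * J" by (simp add: algebra_simps)
    then show ?thesis unfolding f1 f2 by (simp add: algebra_simps)
  qed
  then have "J * (\<nu> + s - 2) = ?m * (\<nu> + d) * I" by (simp add: a_def algebra_simps)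
  then show ?thesis using that I I0 J unfolding J'_def by blast
qed

text \<open>For k q = exp (-(d + q)/2) the function k1 of the virial identity is k/2, so the
  identity itself relates the zeroth and second moments.\<close>

lemma normal_radial_moments:
  fixes d :: real
  obtains I :: real where "0 < I"
    "(\<integral>\<^sup>+z. ennreal (exp (- (d + z \<bullet> z) / 2)) \<partial>(lborel :: (real ^ 'm::finite) measure)) = ennreal I"
    "(\<integral>\<^sup>+z. ennreal ((z \<bullet> z) * exp (- (d + z \<bullet> z) / 2)) \<partial>(lborel :: (real ^ 'm) measure)) = ennreal (CARD('m) * I)"
proof -
  let ?NI = "\<lambda>f. \<integral>\<^sup>+z. ennreal (f (z \<bullet> z)) \<partial>(lborel :: (real ^ 'm) measure)"
  let ?k = "\<lambda>q. exp (- (d + q) / 2)"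
  obtain I where I: "?NI ?k = ennreal I" "0 \<le> I"
    using exp_radial_finite[where 'n = 'm, of d] by (cases "?NI ?k") auto
  have "?NI ?k \<noteq> 0" by (rule nn_integral_lborel_pos) auto
  then have I0: "0 < I" using I by (cases "I = 0") auto
  have V: "?NI ?k = ennreal (2 / CARD('m)) * ?NI (\<lambda>q. q * (1 / 2 * ?k q))"
  proof (rule radial_virial)
    fix u :: real
    show "(?k has_real_derivative - (1 / 2 * ?k u)) (at u)"
      by (auto intro!: derivative_eq_intros)
  next
    show "(?k \<longlongrightarrow> 0) at_top" by real_asymp
  qed auto
  have "?NI (\<lambda>q. q * (1 / 2 * ?k q)) = ennreal (1 / 2) * ?NI (\<lambda>q. q * ?k q)"
  proof -
    have "ennreal (q * (1 / 2 * ?k q)) = ennreal (1 / 2) * ennreal (q * ?k q)" for q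
      by (subst ennreal_mult'[symmetric]) simp_all
    then show ?thesis by (simp only:) (rule nn_integral_cmult, measurable)
  qed
  moreover have "ennreal (1 / CARD('m)) = ennreal (2 / CARD('m)) * ennreal (1 / 2)"
    by (subst ennreal_mult'[symmetric]) simp_all
  ultimately have V1: "ennreal I = ennreal (1 / CARD('m)) * ?NI (\<lambda>q. q * ?k q)"
    using V I by (simp only: mult.assoc)
  have "ennreal (CARD('m) * I) = ennreal (CARD('m)) * (ennreal (1 / CARD('m)) * ?NI (\<lambda>q. q * ?k q))"
    unfolding V1[symmetric] by (simp add: ennreal_mult')
  also have "\<dots> = ?NI (\<lambda>q. q * ?k q)"
  proof -
    have "ennreal (CARD('m)) * ennreal (1 / CARD('m)) = 1"
      by (subst ennreal_mult'[symmetric]) simp_all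
    then show ?thesis by (simp only: mult.assoc[symmetric] mult_1)
  qed
  finally show ?thesis using that[OF I0 I(1)] by simp
qed

section \<open>Covariance factors and second moments of the t and normal generators\<close>

lemma borel_measurable_generators [measurable]:
  "student_generator r \<nu> \<in> borel_measurable borel" "normal_generator r \<in> borel_measurable borel"
  unfolding student_generator_def[abs_def] normal_generator_def[abs_def] by measurable

text \<open>Keeps the Gamma factors out of the radial integrals, where only a positive constant
  matters.\<close>

lemma student_generator_eq:
  assumes "0 < \<nu>"
  obtains C where "0 < C" "\<And>u. student_generator r \<nu> u = C * (1 + u / \<nu>) powr - ((\<nu> + real r) / 2)"
proof -
  let ?C = "Gamma ((\<nu> + real r) / 2) / (Gamma (\<nu> / 2) * (\<nu> * pi) powr (real r / 2))"
  have "0 < ?C" using assms by (simp add: Gamma_real_pos)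
  then show ?thesis by (rule that) (simp only: student_generator_def minus_divide_left)
qed

text \<open>The conditional law is again t with \<nu> + r2 degrees of freedom, which explains both
  the denominator and the threshold 2 < \<nu> + r2.\<close>

lemma covariance_factor_student:
  assumes \<nu>: "0 < \<nu>" "2 < \<nu> + real CARD('n::finite)" and d: "0 \<le> d"
  shows "covariance_factor TYPE('m::finite)
      (conditional_generator TYPE('m) (student_generator CARD('m + 'n) \<nu>) d)
    = (\<nu> + d) / (\<nu> + real CARD('n) - 2)"
proof -
  obtain C where C: "0 < C" "\<And>u. student_generator CARD('m + 'n) \<nu> u = C * (1 + u / \<nu>) powr - ((\<nu> + real CARD('m + 'n)) / 2)"
    using student_generator_eq[OF \<nu>(1)] by metis
  let ?a = "(\<nu> + real CARD('m) + real CARD('n)) / 2"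
  define G where "G = student_generator CARD('m + 'n) \<nu>"
  have h: "G u = C * (1 + u / \<nu>) powr - ?a" for u
    unfolding G_def C(2) by (simp add: add.assoc)
  have [measurable]: "G \<in> borel_measurable borel" unfolding G_def by measurable
  obtain I J where IJ:
    "(\<integral>\<^sup>+z. ennreal ((1 + (d + z \<bullet> z) / \<nu>) powr - ?a) \<partial>(lborel :: (real ^ 'm) measure)) = ennreal I"
    "(\<integral>\<^sup>+z. ennreal ((z \<bullet> z) * (1 + (d + z \<bullet> z) / \<nu>) powr - ?a) \<partial>(lborel :: (real ^ 'm) measure)) = ennreal J"
    "0 < I" "0 \<le> J" "J * (\<nu> + real CARD('n) - 2) = CARD('m) * (\<nu> + d) * I"
    by (rule student_radial_moments[where 'm = 'm, OF \<nu> d])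
  have "covariance_factor TYPE('m) (conditional_generator TYPE('m) (G) d)
      = (C * J) / (CARD('m) * (C * I))"
  proof (rule covariance_factor_conditional)
    show "(\<integral>\<^sup>+z. ennreal (G (d + z \<bullet> z)) \<partial>(lborel :: (real ^ 'm) measure)) = ennreal (C * I)"
      using C(1) IJ(3) by (simp add: h ennreal_mult IJ(1)[symmetric] nn_integral_cmult)
    have "(\<integral>\<^sup>+z. ennreal ((z \<bullet> z) * G (d + z \<bullet> z)) \<partial>(lborel :: (real ^ 'm) measure))
      = (\<integral>\<^sup>+z. ennreal C * ennreal ((z \<bullet> z) * (1 + (d + z \<bullet> z) / \<nu>) powr - ?a) \<partial>(lborel :: (real ^ 'm) measure))"
      using C(1) by (intro nn_integral_cong) (simp add: h ennreal_mult'[symmetric] mult_ac)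
    also have "\<dots> = ennreal (C * J)"
      unfolding ennreal_mult'[OF less_imp_le[OF C(1)]]
      by (subst nn_integral_cmult) (simp_all only: IJ(2), measurable)
    finally show "(\<integral>\<^sup>+z. ennreal ((z \<bullet> z) * G (d + z \<bullet> z)) \<partial>(lborel :: (real ^ 'm) measure)) = ennreal (C * J)" .
  qed (use C IJ h in auto)
  also have "\<dots> = J / (CARD('m) * I)" using C(1) by simp
  also have "\<dots> = (\<nu> + d) / (\<nu> + real CARD('n) - 2)"
    using IJ(3,5) \<nu> by (simp add: field_simps)
  finally show ?thesis unfolding G_def .
qed

text \<open>Shifting by \<open>d\<close> multiplies the normal generator by a constant, so the
  factor cannot depend on \<open>d\<close>; the virial identity makes it 1.\<close>

lemma covariance_factor_normal:
  "covariance_factor TYPE('m::finite) (conditional_generator TYPE('m) (normal_generator r) d) = 1"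
proof -
  define C where "C = (2 * pi) powr (- real r / 2)"
  have C: "0 < C" by (simp add: C_def)
  have h: "normal_generator r u = C * exp (- u / 2)" for u by (simp add: normal_generator_def C_def)
  obtain I :: real where I: "0 < I"
    "(\<integral>\<^sup>+z. ennreal (exp (- (d + z \<bullet> z) / 2)) \<partial>(lborel :: (real ^ 'm) measure)) = ennreal I"
    "(\<integral>\<^sup>+z. ennreal ((z \<bullet> z) * exp (- (d + z \<bullet> z) / 2)) \<partial>(lborel :: (real ^ 'm) measure)) = ennreal (CARD('m) * I)"
    by (rule normal_radial_moments[where 'm = 'm and d = d])
  have "covariance_factor TYPE('m) (conditional_generator TYPE('m) (normal_generator r) d)
      = (C * (CARD('m) * I)) / (CARD('m) * (C * I))"
  proof (rule covariance_factor_conditional)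
    show "(\<integral>\<^sup>+z. ennreal (normal_generator r (d + z \<bullet> z)) \<partial>(lborel :: (real ^ 'm) measure)) = ennreal (C * I)"
      unfolding h ennreal_mult'[OF less_imp_le[OF C]]
      by (subst nn_integral_cmult) (simp_all only: I(2), measurable)
    have "(\<integral>\<^sup>+z. ennreal ((z \<bullet> z) * normal_generator r (d + z \<bullet> z)) \<partial>(lborel :: (real ^ 'm) measure))
      = (\<integral>\<^sup>+z. ennreal C * ennreal ((z \<bullet> z) * exp (- (d + z \<bullet> z) / 2)) \<partial>(lborel :: (real ^ 'm) measure))"
      using C by (intro nn_integral_cong) (simp only: h ennreal_mult'[symmetric] mult_ac less_imp_le)
    also have "\<dots> = ennreal (C * (CARD('m) * I))"
      unfolding ennreal_mult'[OF less_imp_le[OF C]]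
      by (subst nn_integral_cmult) (simp_all only: I(3), measurable)
    finally show "(\<integral>\<^sup>+z. ennreal ((z \<bullet> z) * normal_generator r (d + z \<bullet> z)) \<partial>(lborel :: (real ^ 'm) measure)) = ennreal (C * (CARD('m) * I))" .
  qed (use C I h in auto)
  then show ?thesis using C I by simp
qed

text \<open>The case \<open>s = 0\<close>, \<open>d = 0\<close> of
  \<open>student_radial_moments\<close>, whose threshold then reads 2 < \<nu>.\<close>

lemma student_second_moment_finite:
  assumes "2 < \<nu>"
  shows "(\<integral>\<^sup>+y. ennreal ((y \<bullet> y) * student_generator CARD('r::finite) \<nu> (y \<bullet> y)) \<partial>(lborel :: (real ^ 'r) measure)) < \<infinity>"
proof -
  obtain C where C: "0 < C" "\<And>u. student_generator CARD('r) \<nu> u = C * (1 + u / \<nu>) powr - ((\<nu> + real CARD('r)) / 2)"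
    using student_generator_eq[of \<nu>] assms by (metis less_trans zero_less_numeral)
  obtain J where J: "(\<integral>\<^sup>+z. ennreal ((z \<bullet> z) * (1 + (z \<bullet> z) / \<nu>) powr - ((\<nu> + real CARD('r)) / 2)) \<partial>(lborel :: (real ^ 'r) measure)) = ennreal J"
    proof -
    have "0 < \<nu>" "2 < \<nu> + 0" "(0::real) \<le> 0" using assms by auto
    then show ?thesis
      by (rule student_radial_moments[where 'm = 'r]) (rule that, simp only: add_0 add_0_right)
  qed
  have "(\<integral>\<^sup>+y. ennreal ((y \<bullet> y) * student_generator CARD('r) \<nu> (y \<bullet> y)) \<partial>(lborel :: (real ^ 'r) measure))
    = (\<integral>\<^sup>+z. ennreal C * ennreal ((z \<bullet> z) * (1 + (z \<bullet> z) / \<nu>) powr - ((\<nu> + real CARD('r)) / 2)) \<partial>(lborel :: (real ^ 'r) measure))"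
    using C(1) by (intro nn_integral_cong) (simp only: C(2) ennreal_mult'[symmetric] mult_ac less_imp_le)
  also have "\<dots> = ennreal C * ennreal J" by (simp add: nn_integral_cmult J)
  also have "\<dots> < \<infinity>" by (simp add: ennreal_mult_less_top)
  finally show ?thesis .
qed

lemma normal_second_moment_finite:
  "(\<integral>\<^sup>+y. ennreal ((y \<bullet> y) * normal_generator CARD('r::finite) (y \<bullet> y)) \<partial>(lborel :: (real ^ 'r) measure)) < \<infinity>"
proof -
  define C where "C = (2 * pi) powr (- real CARD('r) / 2)"
  have C: "0 < C" by (simp add: C_def)
  have h: "normal_generator CARD('r) u = C * exp (- u / 2)" for u by (simp add: normal_generator_def C_def)
  obtain I :: real where I:
    "(\<integral>\<^sup>+z. ennreal ((z \<bullet> z) * exp (- (0 + z \<bullet> z) / 2)) \<partial>(lborel :: (real ^ 'r) measure)) = ennreal (CARD('r) * I)"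
    by (rule normal_radial_moments[where 'm = 'r and d = 0]) blast
  have "(\<integral>\<^sup>+z. ennreal ((z \<bullet> z) * normal_generator CARD('r) (z \<bullet> z)) \<partial>(lborel :: (real ^ 'r) measure))
      = (\<integral>\<^sup>+z. ennreal C * ennreal ((z \<bullet> z) * exp (- (0 + z \<bullet> z) / 2)) \<partial>(lborel :: (real ^ 'r) measure))"
    using C by (intro nn_integral_cong) (simp only: h ennreal_mult'[symmetric] mult_ac less_imp_le add_0)
  also have "\<dots> = ennreal C * ennreal (CARD('r) * I)"
    by (subst nn_integral_cmult) (simp_all only: I, measurable)
  also have "\<dots> < \<infinity>" by (simp add: ennreal_mult_less_top)
  finally show ?thesis .
qed

text \<open>Substituting \<open>z = sqrt (1 + d / \<nu>) y\<close> separates the two variables.\<close>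

lemma student_marginal:
  assumes \<nu>: "0 < \<nu>" and d: "0 \<le> d"
  shows "(\<integral>\<^sup>+z. ennreal ((1 + (d + z \<bullet> z) / \<nu>) powr - ((\<nu> + real CARD('m) + s) / 2)) \<partial>(lborel :: (real ^ 'm::finite) measure))
    = ennreal ((1 + d / \<nu>) powr - ((\<nu> + s) / 2)) *
      (\<integral>\<^sup>+z. ennreal ((1 + (z \<bullet> z) / \<nu>) powr - ((\<nu> + real CARD('m) + s) / 2)) \<partial>(lborel :: (real ^ 'm) measure))"
proof -
  define c where "c = 1 + d / \<nu>"
  define a where "a = (\<nu> + real CARD('m) + s) / 2"
  have c: "0 < c" using \<nu> d by (simp add: c_def add_pos_nonneg)
  have cn: "sqrt c ^ CARD('m) = c powr (real CARD('m) / 2)"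
    using c by (simp add: powr_half_sqrt[symmetric] powr_realpow[symmetric] powr_powr)
  have eq: "1 + (d + (sqrt c *\<^sub>R z) \<bullet> (sqrt c *\<^sub>R z)) / \<nu> = c * (1 + (z \<bullet> z) / \<nu>)" for z :: "real ^ 'm"
    using c \<nu> by (simp add: mult.assoc[symmetric]) (simp add: c_def field_simps)
  have "(\<integral>\<^sup>+z. ennreal ((1 + (d + z \<bullet> z) / \<nu>) powr - a) \<partial>(lborel :: (real ^ 'm) measure))
    = ennreal (sqrt c ^ CARD('m)) * (\<integral>\<^sup>+z. ennreal ((c * (1 + (z \<bullet> z) / \<nu>)) powr - a) \<partial>(lborel :: (real ^ 'm) measure))"
    unfolding eq[symmetric] by (rule nn_integral_lborel_scaleR) (use c in auto)
  also have "(\<integral>\<^sup>+z. ennreal ((c * (1 + (z \<bullet> z) / \<nu>)) powr - a) \<partial>(lborel :: (real ^ 'm) measure))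
    = ennreal (c powr - a) * (\<integral>\<^sup>+z. ennreal ((1 + (z \<bullet> z) / \<nu>) powr - a) \<partial>(lborel :: (real ^ 'm) measure))"
    by (simp add: powr_mult ennreal_mult nn_integral_cmult)
  finally have *: "(\<integral>\<^sup>+z. ennreal ((1 + (d + z \<bullet> z) / \<nu>) powr - a) \<partial>(lborel :: (real ^ 'm) measure))
    = ennreal (c powr (real CARD('m) / 2)) *
      (ennreal (c powr - a) * (\<integral>\<^sup>+z. ennreal ((1 + (z \<bullet> z) / \<nu>) powr - a) \<partial>(lborel :: (real ^ 'm) measure)))"
    by (simp only: cn)
  \<comment> \<open>The volume factor contributes c^(m/2) and the integrand c^(-a); the dimension m
    cancels, leaving the exponent of a t kernel with m fewer coordinates.\<close>
  have "c powr (real CARD('m) / 2) * c powr - a = c powr - ((\<nu> + s) / 2)"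
    by (simp only: powr_add[symmetric]) (simp add: a_def add_divide_distrib)
  then show ?thesis
    unfolding a_def[symmetric] c_def[symmetric] *
    by (simp only: mult.assoc[symmetric] ennreal_mult'[symmetric] powr_ge_zero)
qed

section \<open>Student weights and box probabilities\<close>

lemma in_limits_sets [measurable]: "{z. in_limits \<alpha> \<beta> z} \<in> sets borel"
  unfolding in_limits_def by measurable

lemma mahalanobis_nonneg:
  fixes S :: "real ^ 'n::finite ^ 'n"
  assumes S: "dispersion_matrix S"
  shows "0 \<le> mahalanobis \<xi> S x"
proof -
  obtain L :: "real ^ 'n ^ 'n" where L: "L ** transpose L = S" using dispersion_matrix_factor[OF S] .
  note inv = dispersion_factor_invertible[OF S L]
  have "x = \<xi> + L *v (matrix_inv L *v (x - \<xi>))"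
    by (simp add: matrix_vector_mul_assoc matrix_inv_mult(1)[OF inv])
  then show ?thesis by (metis mahalanobis_factor[OF S L] inner_ge_zero)
qed

lemma mahalanobis_measurable [measurable]: "mahalanobis \<xi> S \<in> borel_measurable borel"
  unfolding mahalanobis_def[abs_def]
  by (intro borel_measurable_continuous_onI continuous_intros
      continuous_on_compose2[OF matrix_vector_mult_linear_continuous_on]) auto

lemma matrix_inv_scaleR:
  fixes S :: "real ^ 'n::finite ^ 'n"
  assumes S: "invertible S" and c: "c \<noteq> 0"
  shows "matrix_inv (c *\<^sub>R S) = (1 / c) *\<^sub>R matrix_inv S"
proof -
  have 1: "(c *\<^sub>R S) ** ((1 / c) *\<^sub>R matrix_inv S) = mat 1"
    unfolding matrix_inv_mult(1)[OF S, symmetric] using c by (simp add: matrix_matrix_mult_def vec_eq_iff)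
  then have inv: "invertible (c *\<^sub>R S)" using invertible_right_inverse by blast
  have "matrix_inv (c *\<^sub>R S) = matrix_inv (c *\<^sub>R S) ** ((c *\<^sub>R S) ** ((1 / c) *\<^sub>R matrix_inv S))"
    by (simp add: 1)
  also have "\<dots> = (1 / c) *\<^sub>R matrix_inv S"
    by (simp only: matrix_mul_assoc matrix_inv_mult(2)[OF inv] matrix_mul_lid)
  finally show ?thesis .
qed

lemma mahalanobis_scaleR:
  fixes S :: "real ^ 'n::finite ^ 'n"
  assumes S: "dispersion_matrix S" and c: "c \<noteq> 0"
  shows "mahalanobis \<xi> (c *\<^sub>R S) x = mahalanobis \<xi> S x / c"
  unfolding mahalanobis_def matrix_inv_scaleR[OF dispersion_matrix_invertible[OF S] c]
  by (simp add: scaleR_matrix_vector_assoc[symmetric])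

lemma det_dispersion_pos:
  fixes S :: "real ^ 'n::finite ^ 'n"
  assumes S: "dispersion_matrix S"
  shows "0 < det S"
proof -
  obtain L :: "real ^ 'n ^ 'n" where L: "L ** transpose L = S" using dispersion_matrix_factor[OF S] .
  have "det L \<noteq> 0" using dispersion_factor_invertible[OF S L] by (simp add: invertible_det_nz)
  then show ?thesis unfolding L[symmetric] by (auto simp: det_mul det_transpose zero_less_mult_iff linorder_neq_iff)
qed

lemma det_scaleR:
  fixes S :: "real ^ 'n::finite ^ 'n"
  shows "det (c *\<^sub>R S) = c ^ CARD('n) * det S"
proof -
  have "c *\<^sub>R S = (\<chi> i. c *s S $ i)" by (simp add: vec_eq_iff)
  then show ?thesis using det_rows_mul[of "\<lambda>_. c" "\<lambda>i. S $ i"] by simp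
qed

text \<open>Scaling S by \<nu>/(\<nu> - 2) makes the quadratic form over the degrees of freedom
  equal to d/\<nu> in both densities. There remain one extra power of 1 + d/\<nu>, one step of the
  Gamma recursion above and one below, and a determinant factor that matches the change of (\<nu>
  pi)^(n/2).\<close>

lemma student_density_shift:
  fixes S :: "real ^ 'n::finite ^ 'n"
  assumes S: "dispersion_matrix S" and \<nu>: "2 < \<nu>"
  shows "\<nu> / (\<nu> - 2) * elliptical_density \<xi> ((\<nu> / (\<nu> - 2)) *\<^sub>R S) (student_generator CARD('n) (\<nu> - 2)) x
    = (\<nu> + mahalanobis \<xi> S x) / (\<nu> + real CARD('n) - 2) * elliptical_density \<xi> S (student_generator CARD('n) \<nu>) x"
proof -
  let ?n = "real CARD('n)"
  define d where "d = mahalanobis \<xi> S x"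
  define D where "D = det S"
  define c where "c = \<nu> / (\<nu> - 2)"
  have d: "0 \<le> d" using mahalanobis_nonneg[OF S] by (simp add: d_def)
  have D: "0 < D" using det_dispersion_pos[OF S] by (simp add: D_def)
  have c: "0 < c" using \<nu> by (simp add: c_def)
  have n: "0 < ?n" by simp
  have md: "mahalanobis \<xi> (c *\<^sub>R S) x / (\<nu> - 2) = d / \<nu>"
    using \<nu> c by (simp add: mahalanobis_scaleR[OF S] d_def) (simp add: c_def)
  have dp: "det (c *\<^sub>R S) powr (- 1 / 2) = c powr (- ?n / 2) * D powr (- 1 / 2)"
    using c D by (simp add: det_scaleR D_def powr_mult powr_powr flip: powr_realpow)
  have cp: "(\<nu> * pi) powr (?n / 2) = c powr (?n / 2) * ((\<nu> - 2) * pi) powr (?n / 2)"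
    using \<nu> by (simp add: c_def flip: powr_mult)
  have e: "(\<nu> - 2 + ?n) / 2 + 1 = (\<nu> + ?n) / 2" "(\<nu> - 2) / 2 + 1 = \<nu> / 2" by (simp_all add: field_simps)
  have G1: "Gamma ((\<nu> + ?n) / 2) = (\<nu> - 2 + ?n) / 2 * Gamma ((\<nu> - 2 + ?n) / 2)"
    using \<nu> n Gamma_plus1[of "(\<nu> - 2 + ?n) / 2"] nonpos_Ints_nonpos[of "(\<nu> - 2 + ?n) / 2"] unfolding e by fastforce
  have G2: "Gamma (\<nu> / 2) = (\<nu> - 2) / 2 * Gamma ((\<nu> - 2) / 2)"
    using \<nu> Gamma_plus1[of "(\<nu> - 2) / 2"] nonpos_Ints_nonpos[of "(\<nu> - 2) / 2"] unfolding e by fastforce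
  have b: "(\<nu> + d) / \<nu> = 1 + d / \<nu>" "0 < 1 + d / \<nu>" using \<nu> d by (auto simp: field_simps add_pos_nonneg)
  have w: "(1 + d / \<nu>) powr (- (\<nu> - 2 + ?n) / 2) = (1 + d / \<nu>) * (1 + d / \<nu>) powr (- (\<nu> + ?n) / 2)"
  proof -
    have "- (\<nu> - 2 + ?n) / 2 = 1 + - (\<nu> + ?n) / 2" by (simp add: field_simps)
    then show ?thesis using b by (simp only: powr_add) simp
  qed
  define g where "g = Gamma ((\<nu> - 2 + ?n) / 2)"
  define g' where "g' = Gamma ((\<nu> - 2) / 2)"
  define p where "p = ((\<nu> - 2) * pi) powr (?n / 2)"
  define q where "q = c powr (?n / 2)"
  define W where "W = (1 + d / \<nu>) powr (- (\<nu> + ?n) / 2)"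
  have pos: "0 < g" "0 < g'" "0 < p" "0 < q" using \<nu> c by (auto simp: g_def g'_def p_def q_def Gamma_real_pos)
  have cq: "c powr (- ?n / 2) = 1 / q" using c by (simp add: q_def powr_minus divide_simps)
  have "elliptical_density \<xi> (c *\<^sub>R S) (student_generator CARD('n) (\<nu> - 2)) x
      = 1 / q * D powr (- 1 / 2) * (g / (g' * p) * ((1 + d / \<nu>) * W))"
    unfolding elliptical_density_def student_generator_def md dp cq w by (simp add: g_def g'_def p_def W_def)
  moreover have "elliptical_density \<xi> S (student_generator CARD('n) \<nu>) x
      = D powr (- 1 / 2) * ((\<nu> - 2 + ?n) / 2 * g / ((\<nu> - 2) / 2 * g' * (q * p)) * W)"
    unfolding elliptical_density_def student_generator_def G1 G2 cp
    by (simp add: g_def g'_def p_def W_def q_def d_def D_def)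
  moreover have "c * (1 / q * Dp * (g / (g' * p) * ((1 + d / \<nu>) * W)))
    = (\<nu> + d) / (\<nu> + ?n - 2) * (Dp * ((\<nu> - 2 + ?n) / 2 * g / ((\<nu> - 2) / 2 * g' * (q * p)) * W))" for Dp
  proof -
    have n2: "\<nu> - 2 + ?n \<noteq> 0" "\<nu> - 2 \<noteq> 0" using \<nu> n by linarith+
    have "(\<nu> + d) / (\<nu> + ?n - 2) * (Dp * ((\<nu> - 2 + ?n) / 2 * g / ((\<nu> - 2) / 2 * g' * (q * p)) * W))
      = ((\<nu> - 2 + ?n) / (\<nu> + ?n - 2)) * ((\<nu> + d) * Dp * g * W / ((\<nu> - 2) * g' * q * p))"
    proof -
      \<comment> \<open>Stated for atomic letters, so that the rearrangement does not multiply out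
        the sums they stand for.\<close>
      have "A / M * (Dp * (N / 2 * g / (k / 2 * g' * (q * p)) * W)) = N / M * (A * Dp * g * W / (k * g' * q * p))"
        for A M N k :: real
        by (simp add: mult_ac)
      then show ?thesis .
    qed
    also have "(\<nu> - 2 + ?n) / (\<nu> + ?n - 2) = 1" using n2(1) by (simp add: algebra_simps)
    also have "(\<nu> + d) * Dp * g * W / ((\<nu> - 2) * g' * q * p) = c * (1 / q * Dp * (g / (g' * p) * ((\<nu> + d) / \<nu> * W)))"
      using \<nu> by (simp add: c_def mult_ac)
    finally show ?thesis by (simp only: b(1) mult_1)
  qed
  ultimately show ?thesis unfolding c_def[symmetric] d_def[symmetric] by simp
qed

text \<open>The t density without its normalizing constant. The constant cancels in all quotients,
  and its limit for large \<nu> never has to be found.\<close>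

definition student_weight :: "real ^ 'n::finite \<Rightarrow> real ^ 'n ^ 'n \<Rightarrow> real \<Rightarrow> real ^ 'n \<Rightarrow> real" where
  "student_weight \<xi> S \<nu> x = (1 + mahalanobis \<xi> S x / \<nu>) powr (- (\<nu> + real CARD('n)) / 2)"

lemma student_weight_measurable [measurable]: "student_weight \<xi> S \<nu> \<in> borel_measurable borel"
  unfolding student_weight_def[abs_def] by measurable

lemma L_prob_integral:
  fixes S :: "real ^ 'n::finite ^ 'n"
  shows "L_prob \<alpha> \<beta> \<xi> S \<nu> =
    enn2real (\<integral>\<^sup>+x. ennreal (elliptical_density \<xi> S (student_generator CARD('n) \<nu>) x) * indicator {z. in_limits \<alpha> \<beta> z} x \<partial>lborel)"
  unfolding L_prob_def measure_def elliptical_density_def[abs_def] by (subst emeasure_density) auto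

text \<open>By \<open>student_density_shift\<close> both box probabilities are integrals against the
  same weight with the same constant \<open>C'\<close>. The quotient is therefore the mean of (\<nu>
  + \<delta>)/(\<nu> + n - 2) over the box under the normalized weight.\<close>

lemma L_prob_ratio:
  fixes S :: "real ^ 'n::finite ^ 'n"
  assumes S: "dispersion_matrix S" and \<nu>: "2 < \<nu>"
  shows "\<nu> / (\<nu> - 2) * (L_prob \<alpha> \<beta> \<xi> ((\<nu> / (\<nu> - 2)) *\<^sub>R S) (\<nu> - 2) / L_prob \<alpha> \<beta> \<xi> S \<nu>)
    = (\<integral>x. indicator {z. in_limits \<alpha> \<beta> z} x * ((\<nu> + mahalanobis \<xi> S x) / (\<nu> + real CARD('n) - 2) * student_weight \<xi> S \<nu> x) \<partial>lborel)
      / (\<integral>x. indicator {z. in_limits \<alpha> \<beta> z} x * student_weight \<xi> S \<nu> x \<partial>lborel)"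
    (is "_ = ?N / ?D")
proof -
  let ?n = "CARD('n)"
  let ?B = "{z. in_limits \<alpha> \<beta> z} :: (real ^ 'n) set"
  obtain C where C: "0 < C" "\<And>u. student_generator ?n \<nu> u = C * (1 + u / \<nu>) powr - ((\<nu> + real ?n) / 2)"
    using student_generator_eq[of \<nu> ?n] \<nu> by auto
  define C' where "C' = det S powr (- 1 / 2) * C"
  have C': "0 < C'" using C det_dispersion_pos[OF S] by (simp add: C'_def)
  have ed: "elliptical_density \<xi> S (student_generator ?n \<nu>) x = C' * student_weight \<xi> S \<nu> x" for x
    unfolding elliptical_density_def C(2) C'_def student_weight_def minus_divide_left by simp
  note md = mahalanobis_nonneg[OF S]
  have "L_prob \<alpha> \<beta> \<xi> S \<nu> = (\<integral>x. indicator ?B x * (C' * student_weight \<xi> S \<nu> x) \<partial>lborel)"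
    unfolding L_prob_integral ed
    by (subst integral_eq_nn_integral, measurable)
       (use C' in \<open>auto simp: student_weight_def indicator_def intro!: arg_cong[where f = enn2real] nn_integral_cong\<close>)
  also have "\<dots> = C' * ?D"
    unfolding mult.left_commute[of _ C'] by simp
  finally have L1: "L_prob \<alpha> \<beta> \<xi> S \<nu> = C' * ?D" .
  define e where "e x = elliptical_density \<xi> ((\<nu> / (\<nu> - 2)) *\<^sub>R S) (student_generator ?n (\<nu> - 2)) x" for x
  have sh: "\<nu> / (\<nu> - 2) * e x = C' * ((\<nu> + mahalanobis \<xi> S x) / (\<nu> + real ?n - 2) * student_weight \<xi> S \<nu> x)" for x
    unfolding e_def student_density_shift[OF S \<nu>] ed by simp
  have e: "e x = C' * ((\<nu> - 2) / \<nu> * ((\<nu> + mahalanobis \<xi> S x) / (\<nu> + real ?n - 2) * student_weight \<xi> S \<nu> x))" for x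
  proof -
    have "e x = (\<nu> - 2) / \<nu> * (\<nu> / (\<nu> - 2) * e x)" using \<nu> by simp
    also have "\<dots> = (\<nu> - 2) / \<nu> * (C' * ((\<nu> + mahalanobis \<xi> S x) / (\<nu> + real ?n - 2) * student_weight \<xi> S \<nu> x))"
      by (simp only: sh)
    finally show ?thesis by (simp only: mult.left_commute)
  qed
  have e0: "0 \<le> e x" for x
    unfolding e using \<nu> C' md[of \<xi> x] by (intro mult_nonneg_nonneg divide_nonneg_nonneg add_nonneg_nonneg) (auto simp: student_weight_def)
  have em[measurable]: "e \<in> borel_measurable borel" unfolding e[abs_def] by measurable
  have "L_prob \<alpha> \<beta> \<xi> ((\<nu> / (\<nu> - 2)) *\<^sub>R S) (\<nu> - 2) = (\<integral>x. indicator ?B x * e x \<partial>lborel)"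
    unfolding L_prob_integral e_def[symmetric]
    by (subst integral_eq_nn_integral, measurable)
       (use e0 in \<open>auto simp: indicator_def intro!: arg_cong[where f = enn2real] nn_integral_cong\<close>)
  then have "\<nu> / (\<nu> - 2) * L_prob \<alpha> \<beta> \<xi> ((\<nu> / (\<nu> - 2)) *\<^sub>R S) (\<nu> - 2) = (\<integral>x. indicator ?B x * (\<nu> / (\<nu> - 2) * e x) \<partial>lborel)"
    unfolding mult.left_commute[of _ "\<nu> / (\<nu> - 2)"] by simp
  also have "\<dots> = C' * ?N" unfolding sh mult.left_commute[of _ C'] by simp
  finally have L2: "\<nu> / (\<nu> - 2) * L_prob \<alpha> \<beta> \<xi> ((\<nu> / (\<nu> - 2)) *\<^sub>R S) (\<nu> - 2) = C' * ?N" .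
  have "\<nu> / (\<nu> - 2) * (L_prob \<alpha> \<beta> \<xi> ((\<nu> / (\<nu> - 2)) *\<^sub>R S) (\<nu> - 2) / L_prob \<alpha> \<beta> \<xi> S \<nu>)
    = (\<nu> / (\<nu> - 2) * L_prob \<alpha> \<beta> \<xi> ((\<nu> / (\<nu> - 2)) *\<^sub>R S) (\<nu> - 2)) / L_prob \<alpha> \<beta> \<xi> S \<nu>" by simp
  also have "\<dots> = ?N / ?D" unfolding L1 L2 using C' by simp
  finally show ?thesis .
qed

text \<open>The point 1 + d/b divides the segment from 1 to 1 + d/a with weight a/b, so concavity of
  ln gives a ln (1 + d/a) \<le> b ln (1 + d/b). This yields a dominating function that does not
  depend on \<nu>.\<close>

lemma powr_one_plus_divide_antimono:
  fixes d :: real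
  assumes "0 < a" "a \<le> b" "0 \<le> d"
  shows "(1 + d / b) powr (- b / 2) \<le> (1 + d / a) powr (- a / 2)"
proof -
  have b: "0 < b" and pos: "0 < 1 + d / a" "0 < 1 + d / b" using assms by (auto simp: add_pos_nonneg)
  have t: "0 \<le> a / b" "a / b \<le> 1" using assms by auto
  have "(1 - a / b) * ln 1 + a / b * ln (1 + d / a) \<le> ln ((1 - a / b) *\<^sub>R 1 + (a / b) *\<^sub>R (1 + d / a))"
    by (rule concave_onD[OF ln_concave]) (use t pos in auto)
  also have "(1 - a / b) *\<^sub>R 1 + (a / b) *\<^sub>R (1 + d / a) = 1 + d / b"
    using assms b by (simp add: field_simps)
  finally have "a * ln (1 + d / a) \<le> b * ln (1 + d / b)" using b by (simp add: field_simps)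
  then show ?thesis using pos by (simp add: powr_def)
qed

lemma student_weight_tendsto:
  fixes d s :: real
  assumes "0 \<le> d"
  shows "((\<lambda>\<nu>. (1 + d / \<nu>) powr (- (\<nu> + s) / 2)) \<longlongrightarrow> exp (- d / 2)) at_top"
proof -
  have "((\<lambda>\<nu>. ((1 + d / \<nu>) powr \<nu>) powr (- 1 / 2) * (1 + d / \<nu>) powr (- s / 2)) \<longlongrightarrow> exp d powr (- 1 / 2) * 1 powr (- s / 2)) at_top"
  proof (intro tendsto_mult tendsto_powr tendsto_const tendsto_exp_limit_at_top)
    show "((\<lambda>\<nu>. 1 + d / \<nu>) \<longlongrightarrow> 1) at_top" by real_asymp
  qed auto
  moreover have "((1 + d / \<nu>) powr \<nu>) powr (- 1 / 2) * (1 + d / \<nu>) powr (- s / 2) = (1 + d / \<nu>) powr (- (\<nu> + s) / 2)" for \<nu>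
    by (simp add: powr_powr flip: powr_add) (simp add: diff_divide_distrib)
  ultimately show ?thesis by (simp add: exp_powr_real)
qed

text \<open>After \<open>L_prob_ratio\<close>, numerator and denominator converge to the same
  integral \<open>e\<close> of the Gaussian kernel over the box, and \<open>e\<close> is nonzero
  because the box has positive volume.\<close>

lemma L_prob_ratio_tendsto:
  fixes S :: "real ^ 'n::finite ^ 'n"
  assumes S: "dispersion_matrix S" and B: "emeasure lborel {z. in_limits \<alpha> \<beta> z} \<noteq> 0"
  shows "((\<lambda>\<nu>. \<nu> / (\<nu> - 2) * (L_prob \<alpha> \<beta> \<xi> ((\<nu> / (\<nu> - 2)) *\<^sub>R S) (\<nu> - 2) / L_prob \<alpha> \<beta> \<xi> S \<nu>)) \<longlongrightarrow> 1) at_top"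
proof -
  let ?n = "real CARD('n)"
  let ?B = "{z. in_limits \<alpha> \<beta> z} :: (real ^ 'n) set"
  let ?d = "mahalanobis \<xi> S"
  note md = mahalanobis_nonneg[OF S, of \<xi>]
  have n: "1 \<le> ?n" by (simp add: Suc_leI)
  define e where "e = (\<integral>x. indicator ?B x * exp (- ?d x / 2) \<partial>lborel)"
  \<comment> \<open>The dominating function. For \<nu> \<ge> n + 4 the weight is at most (1 + d/(n +
    4)) to the power -(n/2 + 2), and the extra factor is at most 2 (1 + d/(n + 4)). The product has
    exponent -(n/2 + 1), still beyond the integrability threshold.\<close>
  define W where "W x = 2 * (1 + ?d x / (?n + 4)) powr - (?n / 2 + 1)" for x
  obtain L :: "real ^ 'n ^ 'n" where L: "L ** transpose L = S" using dispersion_matrix_factor[OF S] .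
  obtain C where C: "0 < C"
    "\<And>c f. f \<in> borel_measurable borel \<Longrightarrow>
      (\<integral>\<^sup>+x. f x \<partial>lborel) = ennreal C * (\<integral>\<^sup>+y. f (c + L *v y) \<partial>lborel)"
    using nn_integral_lborel_affine_matrix[OF dispersion_factor_invertible[OF S L]] by metis
  have Wm[measurable]: "W \<in> borel_measurable borel" unfolding W_def[abs_def] by measurable
  have W0: "0 \<le> W x" for x by (simp add: W_def)
  have "(\<integral>\<^sup>+x. ennreal (W x) \<partial>lborel) = ennreal C * (\<integral>\<^sup>+y. ennreal (W (\<xi> + L *v y)) \<partial>lborel)"
    by (rule C(2)) measurable
  also have "(\<integral>\<^sup>+y. ennreal (W (\<xi> + L *v y)) \<partial>lborel) =
      (\<integral>\<^sup>+y. ennreal 2 * ennreal ((1 + 1 / (?n + 4) * (y \<bullet> y)) powr - (?n / 2 + 1)) \<partial>(lborel :: (real ^ 'n) measure))"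
    by (simp add: W_def mahalanobis_factor[OF S L] ennreal_mult')
  also have "\<dots> = ennreal 2 * (\<integral>\<^sup>+y. ennreal ((1 + 1 / (?n + 4) * (y \<bullet> y)) powr - (?n / 2 + 1)) \<partial>(lborel :: (real ^ 'n) measure))"
    by (rule nn_integral_cmult) measurable
  also have "ennreal C * \<dots> < \<infinity>"
    using powr_radial_finite[where 'n = 'n, of "1 / (?n + 4)" "?n / 2 + 1"]
    by (simp add: ennreal_mult_less_top add_pos_nonneg del: powr_minus)
  finally have Wi: "integrable lborel W"
    using W0 by (intro integrableI_nonneg) auto
  have bound: "student_weight \<xi> S \<nu> x \<le> W x"
    "(\<nu> + ?d x) / (\<nu> + ?n - 2) * student_weight \<xi> S \<nu> x \<le> W x"
    if \<nu>: "?n + 4 \<le> \<nu>" for \<nu> x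
  proof -
    let ?a = "?n + 4"
    have \<nu>0: "0 < \<nu>" "0 < ?a" using \<nu> n by linarith+
    have p1: "1 \<le> 1 + ?d x / \<nu>" "1 \<le> 1 + ?d x / ?a" using md[of x] \<nu>0 by auto
    have w: "student_weight \<xi> S \<nu> x \<le> (1 + ?d x / ?a) powr (- ?a / 2)"
    proof -
      have "student_weight \<xi> S \<nu> x \<le> (1 + ?d x / \<nu>) powr (- \<nu> / 2)"
        unfolding student_weight_def by (rule powr_mono) (use p1 n in auto)
      also have "\<dots> \<le> (1 + ?d x / ?a) powr (- ?a / 2)"
        by (rule powr_one_plus_divide_antimono) (use \<nu> md[of x] \<nu>0 in auto)
      finally show ?thesis .
    qed
    have "(\<nu> + ?d x) / (\<nu> + ?n - 2) \<le> 2 * (1 + ?d x / \<nu>)"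
    proof -
      have "(\<nu> + ?d x) / (\<nu> + ?n - 2) \<le> (\<nu> + ?d x) / (\<nu> / 2)"
        by (rule divide_left_mono) (use md[of x] \<nu> \<nu>0 n in auto)
      also have "\<dots> = 2 * (1 + ?d x / \<nu>)" using \<nu>0 by (simp add: field_simps)
      finally show ?thesis .
    qed
    also have "\<dots> \<le> 2 * (1 + ?d x / ?a)"
      using md[of x] \<nu> \<nu>0 by (intro mult_left_mono add_left_mono divide_left_mono) auto
    finally have r: "(\<nu> + ?d x) / (\<nu> + ?n - 2) \<le> 2 * (1 + ?d x / ?a)" .
    have W: "2 * (1 + ?d x / ?a) * (1 + ?d x / ?a) powr (- ?a / 2) = W x"
    proof -
      have "- (?n / 2 + 1) = 1 + - ?a / 2" by (simp add: field_simps)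
      then show ?thesis unfolding W_def using p1 by (simp only: powr_add) simp
    qed
    show "(\<nu> + ?d x) / (\<nu> + ?n - 2) * student_weight \<xi> S \<nu> x \<le> W x"
      unfolding W[symmetric] by (rule mult_mono[OF r w]) (use p1 in \<open>auto simp: student_weight_def\<close>)
    have "1 * (1 + ?d x / ?a) powr (- ?a / 2) \<le> W x"
      unfolding W[symmetric] by (rule mult_right_mono) (use p1 in auto)
    with w show "student_weight \<xi> S \<nu> x \<le> W x" by simp
  qed
  have lim: "((\<lambda>\<nu>. student_weight \<xi> S \<nu> x) \<longlongrightarrow> exp (- ?d x / 2)) at_top" for x
    unfolding student_weight_def by (rule student_weight_tendsto[OF md])
  have lim2: "((\<lambda>\<nu>. (\<nu> + ?d x) / (\<nu> + ?n - 2) * student_weight \<xi> S \<nu> x) \<longlongrightarrow> exp (- ?d x / 2)) at_top" for x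
  proof -
    have "((\<lambda>\<nu>. (\<nu> + ?d x) / (\<nu> + ?n - 2)) \<longlongrightarrow> 1) at_top" by real_asymp
    from tendsto_mult[OF this lim[of x]] show ?thesis by simp
  qed
  have ind: "norm (indicator ?B x * v) \<le> w" if "0 \<le> v" "v \<le> w" for x and v w :: real
    using that by (simp add: indicator_def)
  have ge: "\<forall>\<^sub>F \<nu> in at_top. ?n + 4 \<le> \<nu>" by (rule eventually_ge_at_top)
  have D: "((\<lambda>\<nu>. \<integral>x. indicator ?B x * student_weight \<xi> S \<nu> x \<partial>lborel) \<longlongrightarrow> e) at_top"
    unfolding e_def
  proof (rule integral_dominated_convergence_at_top[where w = W])
    show "\<forall>\<^sub>F \<nu> in at_top. AE x in lborel. norm (indicator ?B x * student_weight \<xi> S \<nu> x) \<le> W x"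
      using ge by (rule eventually_mono)
        (use bound W0 in \<open>auto simp: indicator_def student_weight_def\<close>)
    show "AE x in lborel. ((\<lambda>\<nu>. indicator ?B x * student_weight \<xi> S \<nu> x) \<longlongrightarrow> indicator ?B x * exp (- ?d x / 2)) at_top"
      by (intro AE_I2 tendsto_mult tendsto_const lim)
  qed (use Wi in measurable)
  have N: "((\<lambda>\<nu>. \<integral>x. indicator ?B x * ((\<nu> + ?d x) / (\<nu> + ?n - 2) * student_weight \<xi> S \<nu> x) \<partial>lborel) \<longlongrightarrow> e) at_top"
    unfolding e_def
  proof (rule integral_dominated_convergence_at_top[where w = W])
    show "\<forall>\<^sub>F \<nu> in at_top. AE x in lborel. norm (indicator ?B x * ((\<nu> + ?d x) / (\<nu> + ?n - 2) * student_weight \<xi> S \<nu> x)) \<le> W x"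
    proof (rule eventually_mono[OF ge], rule AE_I2)
      fix \<nu> x assume \<nu>: "?n + 4 \<le> \<nu>"
      have "0 \<le> (\<nu> + ?d x) / (\<nu> + ?n - 2) * student_weight \<xi> S \<nu> x"
        using \<nu> n md[of x] by (intro mult_nonneg_nonneg divide_nonneg_nonneg) (auto simp: student_weight_def)
      then show "norm (indicator ?B x * ((\<nu> + ?d x) / (\<nu> + ?n - 2) * student_weight \<xi> S \<nu> x)) \<le> W x"
        using bound(2)[OF \<nu>, of x] by (intro ind)
    qed
    show "AE x in lborel. ((\<lambda>\<nu>. indicator ?B x * ((\<nu> + ?d x) / (\<nu> + ?n - 2) * student_weight \<xi> S \<nu> x)) \<longlongrightarrow> indicator ?B x * exp (- ?d x / 2)) at_top"
      by (intro AE_I2 tendsto_mult[OF tendsto_const] lim2)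
  qed (use Wi in measurable)
  have "e \<noteq> 0"
  proof
    assume e0: "e = 0"
    have i: "integrable lborel (\<lambda>x. indicator ?B x * exp (- ?d x / 2))"
    proof (rule Bochner_Integration.integrable_bound[OF Wi])
      show "AE x in lborel. norm (indicator ?B x * exp (- ?d x / 2)) \<le> norm (W x)"
      proof (rule AE_I2)
        fix x
        \<comment> \<open>The Gaussian kernel inherits the bound as the pointwise limit of the
          weights.\<close>
        have "exp (- ?d x / 2) \<le> W x"
          by (rule tendsto_upperbound[OF lim[of x]]) (use eventually_mono[OF ge bound(1)] in auto)
        then show "norm (indicator ?B x * exp (- ?d x / 2)) \<le> norm (W x)"
          using W0[of x] by (auto simp: indicator_def)
      qed
    qed measurable
    have "AE x in lborel. indicator ?B x * exp (- ?d x / 2) = 0"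
      using integral_nonneg_eq_0_iff_AE[OF i] e0 unfolding e_def by auto
    then have "AE x in lborel. x \<notin> ?B" by (rule eventually_mono) (auto simp: indicator_def split: if_splits)
    then have "emeasure lborel ?B = 0"
      by (subst (asm) AE_iff_measurable[of ?B]) auto
    then show False using B by simp
  qed
  with tendsto_divide[OF N D] have "((\<lambda>\<nu>. (\<integral>x. indicator ?B x * ((\<nu> + ?d x) / (\<nu> + ?n - 2) * student_weight \<xi> S \<nu> x) \<partial>lborel) /
      (\<integral>x. indicator ?B x * student_weight \<xi> S \<nu> x \<partial>lborel)) \<longlongrightarrow> 1) at_top"
    by simp
  then show ?thesis
    by (rule Lim_transform_eventually)
       (use eventually_gt_at_top[of 2] in \<open>eventually_elim\<close>, simp only: L_prob_ratio[OF S])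
qed

section \<open>Conditioning on an event\<close>

definition square_integrable :: "'a measure \<Rightarrow> ('a \<Rightarrow> real) \<Rightarrow> bool" where
  "square_integrable U f \<longleftrightarrow> f \<in> borel_measurable U \<and> integrable U (\<lambda>x. (f x)\<^sup>2)"

lemma square_integrable_mult:
  assumes "square_integrable U f" "square_integrable U g"
  shows "integrable U (\<lambda>x. f x * g x)"
proof (rule Bochner_Integration.integrable_bound[where f = "\<lambda>x. (f x)\<^sup>2 + (g x)\<^sup>2"])
  show "AE x in U. norm (f x * g x) \<le> norm ((f x)\<^sup>2 + (g x)\<^sup>2)"
  proof (rule AE_I2)
    fix x
    have "2 * (\<bar>f x\<bar> * \<bar>g x\<bar>) \<le> (f x)\<^sup>2 + (g x)\<^sup>2"
      using sum_squares_bound[of "\<bar>f x\<bar>" "\<bar>g x\<bar>"] by simp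
    moreover have "0 \<le> \<bar>f x\<bar> * \<bar>g x\<bar>" by simp
    ultimately show "norm (f x * g x) \<le> norm ((f x)\<^sup>2 + (g x)\<^sup>2)"
      unfolding real_norm_def abs_mult by linarith
  qed
qed (use assms in \<open>auto simp: square_integrable_def\<close>)

lemma square_integrable_add:
  assumes "square_integrable U f" "square_integrable U g"
  shows "square_integrable U (\<lambda>x. f x + g x)"
  using assms square_integrable_mult[OF assms]
  by (auto simp: square_integrable_def power2_sum mult.assoc)

lemma square_integrable_cmult:
  "square_integrable U f \<Longrightarrow> square_integrable U (\<lambda>x. c * f x)"
  by (auto simp: square_integrable_def power_mult_distrib)

lemma square_integrable_const:
  "finite_measure U \<Longrightarrow> square_integrable U (\<lambda>x. c)"
  by (simp add: square_integrable_def finite_measure.integrable_const)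

lemma square_integrable_diff:
  assumes "square_integrable U f" "square_integrable U g"
  shows "square_integrable U (\<lambda>x. f x - g x)"
  using square_integrable_add[OF assms(1) square_integrable_cmult[OF assms(2), of "-1"]] by simp

lemma square_integrable_sum:
  assumes "finite_measure U" "\<And>i. i \<in> I \<Longrightarrow> square_integrable U (f i)"
  shows "square_integrable U (\<lambda>x. \<Sum>i\<in>I. f i x)"
  using assms(2)
  by (induction I rule: infinite_finite_induct)
     (auto intro: square_integrable_add square_integrable_const[OF assms(1)])

lemma L2_imp_integrable:
  assumes "finite_measure U" "square_integrable U f"
  shows "integrable U f"
  using square_integrable_mult[OF square_integrable_const[OF assms(1), of 1] assms(2)] by simp

context prob_space
begin

context
  fixes A assumes A[measurable]: "A \<in> events" and pA: "0 < prob A"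
begin

text \<open>With a real-valued density, Bochner integrals under the conditional law become integrals
  under \<open>M\<close> with the indicator as a factor.\<close>

lemma uniform_measure_real_density:
  "uniform_measure M A = density M (\<lambda>x. ennreal (indicator A x / prob A))"
  unfolding uniform_measure_def
  using pA divide_ennreal[of 1 "prob A"]
  by (intro density_cong) (auto simp: emeasure_eq_measure indicator_def)

lemma integral_uniform_measure:
  fixes f :: "'a \<Rightarrow> real"
  assumes "f \<in> borel_measurable M"
  shows "(\<integral>x. f x \<partial>uniform_measure M A) = (\<integral>x. indicator A x * f x \<partial>M) / prob A"
  unfolding uniform_measure_real_density
  using assms pA by (subst integral_real_density) auto

lemma integrable_uniform_measure:
  fixes f :: "'a \<Rightarrow> real"
  assumes "f \<in> borel_measurable M"
  shows "integrable (uniform_measure M A) f \<longleftrightarrow> integrable M (\<lambda>x. indicator A x * f x)"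
proof -
  have "integrable (uniform_measure M A) f \<longleftrightarrow> integrable M (\<lambda>x. (1 / prob A) * (indicator A x * f x))"
    unfolding uniform_measure_real_density
    using assms pA by (subst integrable_real_density) auto
  also have "\<dots> \<longleftrightarrow> integrable M (\<lambda>x. indicator A x * f x)"
    using pA integrable_mult_left_iff[of M "1 / prob A" "\<lambda>x. indicator A x * f x"] by simp
  finally show ?thesis .
qed

lemma finite_measure_uniform_measure: "finite_measure (uniform_measure M A)"
  using pA by (intro prob_space.axioms prob_space_uniform_measure) (auto simp: emeasure_eq_measure)

end

end

text \<open>Integrability matters here: a nonintegrable vector has integral 0 by default, even where
  one of its components has a nonzero integral.\<close>

lemma integral_vec_component:
  fixes f :: "'a \<Rightarrow> real ^ 'n::finite"
  assumes "integrable U f"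
  shows "integral\<^sup>L U f $ i = (\<integral>x. f x $ i \<partial>U)"
  using integral_bounded_linear[OF bounded_linear_vec_nth assms, of i] by simp

lemma integrable_vec_iff_components:
  fixes f :: "'a \<Rightarrow> 'b::euclidean_space ^ 'n::finite"
  assumes "\<And>i. integrable U (\<lambda>x. f x $ i)"
  shows "integrable U f"
proof -
  have "integrable U (\<lambda>x. axis i (f x $ i))" for i
    by (rule integrable_bounded_linear[OF _ assms])
       (auto intro!: linear_conv_bounded_linear[THEN iffD1] linearI simp: axis_def vec_eq_iff)
  then have "integrable U (\<lambda>x. \<Sum>i\<in>UNIV. axis i (f x $ i))" by simp
  moreover have "(\<Sum>i\<in>UNIV. axis i (f x $ i)) = f x" for x
    by (simp add: vec_eq_iff axis_def if_distrib cong: if_cong)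
  ultimately show ?thesis by simp
qed

lemma integral_mat_component:
  fixes f :: "'a \<Rightarrow> real ^ 'n::finite ^ 'm::finite"
  assumes "\<And>i j. integrable U (\<lambda>x. f x $ i $ j)"
  shows "integral\<^sup>L U f $ i $ j = (\<integral>x. f x $ i $ j \<partial>U)"
proof -
  have r: "integrable U (\<lambda>x. f x $ i)" for i by (rule integrable_vec_iff_components) (rule assms)
  have "integral\<^sup>L U f $ i = (\<integral>x. f x $ i \<partial>U)"
    using integral_bounded_linear[OF bounded_linear_vec_nth integrable_vec_iff_components[OF r], of i] by simp
  then show ?thesis using integral_vec_component[OF r, of i j] by simp
qed

section \<open>Spherical random vectors\<close>

lemma borel_measurable_part_component [measurable]:
  "(\<lambda>x :: real ^ ('m::finite + 'n::finite). part1 x $ i) \<in> borel_measurable borel"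
  "(\<lambda>x :: real ^ ('m::finite + 'n::finite). part2 x $ j) \<in> borel_measurable borel"
  unfolding part_component by measurable

text \<open>Here \<open>h\<close> contains the normalizing constant; instances use a multiple of the
  generator of X.\<close>

locale spherical_vector = prob_space M for M :: "'w measure" +
  fixes Y :: "'w \<Rightarrow> real ^ ('m::finite + 'n::finite)" and h :: "real \<Rightarrow> real"
  assumes h_nonneg: "\<And>u. 0 \<le> u \<Longrightarrow> 0 \<le> h u"
    and Y_distr: "distributed M lborel Y (\<lambda>y. ennreal (h (y \<bullet> y)))"
begin

lemma Y_measurable [measurable]: "Y \<in> borel_measurable M"
  using distributed_measurable[OF Y_distr] by simp

text \<open>Measurability is known for the \<open>ennreal\<close> density only;
  \<open>enn2real\<close> recovers the real one because \<open>h\<close> is nonnegative on squared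
  norms.\<close>

lemma density_measurable [measurable]:
  "(\<lambda>y :: real ^ ('m + 'n). h (y \<bullet> y)) \<in> borel_measurable borel"
proof -
  have [measurable]: "(\<lambda>y :: real ^ ('m + 'n). ennreal (h (y \<bullet> y))) \<in> borel_measurable borel"
    using distributed_borel_measurable[OF Y_distr] by simp
  have "(\<lambda>y :: real ^ ('m + 'n). enn2real (ennreal (h (y \<bullet> y)))) \<in> borel_measurable borel"
    by measurable
  then show ?thesis by (simp add: h_nonneg)
qed

lemma density_pair_measurable [measurable]:
  "(\<lambda>(z :: real ^ 'm, v :: real ^ 'n). h (z \<bullet> z + v \<bullet> v)) \<in> borel_measurable (borel \<Otimes>\<^sub>M borel)"
  using measurable_compose[OF borel_measurable_stack density_measurable]
  by (simp add: case_prod_beta inner_stack)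

lemma density_pair_measurable' [measurable]:
  "(\<lambda>(v :: real ^ 'n, z :: real ^ 'm). h (z \<bullet> z + v \<bullet> v)) \<in> borel_measurable (borel \<Otimes>\<^sub>M borel)"
  using measurable_compose[OF measurable_pair_swap' density_pair_measurable] by (simp add: case_prod_beta)

lemma covariance_factor_measurable [measurable]:
  "(\<lambda>v :: real ^ 'n. covariance_factor TYPE('m) (conditional_generator TYPE('m) h (v \<bullet> v))) \<in> borel_measurable borel"
  unfolding covariance_factor_def conditional_generator_def marginal_generator_def
  by (subst add.commute[of "_ \<bullet> _ :: real" "(_ :: real ^ 'm) \<bullet> _"]) measurable

lemma nn_integral_Y:
  assumes "f \<in> borel_measurable borel"
  shows "(\<integral>\<^sup>+\<omega>. f (Y \<omega>) \<partial>M) = (\<integral>\<^sup>+y. ennreal (h (y \<bullet> y)) * f y \<partial>lborel)"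
  using distributed_nn_integral[OF Y_distr, of f] assms by simp

text \<open>The density depends on the norm alone and Lebesgue measure is preserved, so
  \<open>f (Y \<omega>)\<close> and \<open>Y \<omega>\<close> have the same law. Equality of laws
  also covers nonintegrable \<open>g\<close>, where both integrals are 0.\<close>

lemma integral_norm_preserving:
  fixes g :: "real ^ ('m + 'n) \<Rightarrow> real"
  assumes f: "linear f" "\<And>x. norm (f x) = norm x" and [measurable]: "g \<in> borel_measurable borel"
  shows "(\<integral>\<omega>. g (f (Y \<omega>)) \<partial>M) = (\<integral>\<omega>. g (Y \<omega>) \<partial>M)"
proof -
  have [measurable]: "f \<in> borel_measurable borel" by (rule borel_measurable_linear[OF f(1)])
  have ff: "f y \<bullet> f y = y \<bullet> y" for y using f(2)[of y] by (simp add: norm_eq_sqrt_inner)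
  have "distr M borel (\<lambda>\<omega>. f (Y \<omega>)) = distr M borel Y"
  proof (rule measure_eqI)
    fix S assume "S \<in> sets (distr M borel (\<lambda>\<omega>. f (Y \<omega>)))"
    then have [measurable]: "S \<in> sets borel" by simp
    have nn: "emeasure (distr M borel U) S = (\<integral>\<^sup>+\<omega>. indicator S (U \<omega>) \<partial>M)"
      if [measurable]: "U \<in> borel_measurable M" for U :: "'w \<Rightarrow> real ^ ('m + 'n)"
      by (simp add: emeasure_distr nn_integral_distr[symmetric, of _ _ borel] flip: nn_integral_indicator)
    have "emeasure (distr M borel (\<lambda>\<omega>. f (Y \<omega>))) S = (\<integral>\<^sup>+y. ennreal (h (y \<bullet> y)) * indicator S (f y) \<partial>lborel)"
      using nn_integral_Y[of "\<lambda>y. indicator S (f y)"] by (simp add: nn)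
    also have "\<dots> = (\<integral>\<^sup>+y. ennreal (h (f y \<bullet> f y)) * indicator S (f y) \<partial>lborel)" by (simp only: ff)
    also have "\<dots> = (\<integral>\<^sup>+y. ennreal (h (y \<bullet> y)) * indicator S y \<partial>lborel)"
      by (rule nn_integral_lborel_norm_preserving[OF f, symmetric]) measurable
    also have "\<dots> = emeasure (distr M borel Y) S"
      using nn_integral_Y[of "indicator S"] by (simp add: nn)
    finally show "emeasure (distr M borel (\<lambda>\<omega>. f (Y \<omega>))) S = emeasure (distr M borel Y) S" .
  qed simp
  then have "(\<integral>y. g y \<partial>distr M borel (\<lambda>\<omega>. f (Y \<omega>))) = (\<integral>y. g y \<partial>distr M borel Y)" by simp
  then show ?thesis by (simp add: integral_distr)
qed

text \<open>Reflecting the whole first block preserves the law and \<open>part2\<close>, so the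
  integral equals its own negative.\<close>

lemma odd_moment_zero:
  fixes g :: "real ^ 'm \<Rightarrow> real" and \<phi> :: "real ^ 'n \<Rightarrow> real"
  assumes [measurable]: "g \<in> borel_measurable borel" "\<phi> \<in> borel_measurable borel"
    and odd: "\<And>z. g (- z) = - g z"
  shows "(\<integral>\<omega>. \<phi> (part2 (Y \<omega>)) * g (part1 (Y \<omega>)) \<partial>M) = 0"
proof -
  let ?f = "\<lambda>y :: real ^ ('m + 'n). stack (- part1 y) (part2 y)"
  have l: "linear ?f"
    by (intro linearI) (auto simp: vec_eq_iff split_sum_all part_component)
  have "norm (?f y) = norm y" for y
    by (simp add: norm_eq_sqrt_inner inner_split_parts)
  from integral_norm_preserving[OF l this, of "\<lambda>y. \<phi> (part2 y) * g (part1 y)"]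
  show ?thesis by (simp add: odd)
qed

text \<open>Here only coordinate \<open>k\<close> is reflected: the product changes sign while the
  factor with index \<open>l\<close> stays.\<close>

lemma off_diagonal_moment_zero:
  fixes \<phi> :: "real ^ 'n \<Rightarrow> real"
  assumes [measurable]: "\<phi> \<in> borel_measurable borel" and kl: "k \<noteq> l"
  shows "(\<integral>\<omega>. \<phi> (part2 (Y \<omega>)) * (part1 (Y \<omega>) $ k * part1 (Y \<omega>) $ l) \<partial>M) = 0"
proof -
  let ?f = "\<lambda>y :: real ^ ('m + 'n). \<chi> i. if i = Inl k then - y $ i else y $ i"
  have l: "linear ?f" by (intro linearI) (auto simp: vec_eq_iff)
  have "norm (?f y) = norm y" for y
    by (simp add: norm_eq_sqrt_inner inner_vec_def) (auto intro: sum.cong)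
  moreover have "(\<lambda>y. \<phi> (part2 y) * (part1 y $ k * part1 y $ l)) \<in> borel_measurable borel"
    by measurable
  moreover have "part2 (?f y) = part2 y" "part1 (?f y) $ k = - part1 y $ k" "part1 (?f y) $ l = part1 y $ l" for y
    using kl by (simp_all add: part1_def part2_def)
  ultimately show ?thesis
    using integral_norm_preserving[OF l, of "\<lambda>y. \<phi> (part2 y) * (part1 y $ k * part1 y $ l)"] by simp
qed

lemma diagonal_moment_eq:
  fixes \<phi> :: "real ^ 'n \<Rightarrow> real"
  assumes [measurable]: "\<phi> \<in> borel_measurable borel"
  shows "(\<integral>\<omega>. \<phi> (part2 (Y \<omega>)) * (part1 (Y \<omega>) $ k * part1 (Y \<omega>) $ k) \<partial>M) =
    (\<integral>\<omega>. \<phi> (part2 (Y \<omega>)) * (part1 (Y \<omega>) $ l * part1 (Y \<omega>) $ l) \<partial>M)"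
proof -
  let ?t = "Transposition.transpose (Inl k) (Inl l :: 'm + 'n)"
  let ?f = "\<lambda>y :: real ^ ('m + 'n). \<chi> i. y $ ?t i"
  have l: "linear ?f" by (intro linearI) (auto simp: vec_eq_iff)
  have "norm (?f y) = norm y" for y
    using sum.reindex_bij_betw[of ?t UNIV UNIV "\<lambda>i. y $ i * y $ i"]
    by (simp add: norm_eq_sqrt_inner inner_vec_def)
  moreover have "(\<lambda>y. \<phi> (part2 y) * (part1 y $ l * part1 y $ l)) \<in> borel_measurable borel"
    by measurable
  moreover have "part2 (?f y) = part2 y" "part1 (?f y) $ l = part1 y $ k" for y
    by (simp_all add: part1_def part2_def Transposition.transpose_def)
  ultimately show ?thesis
    using integral_norm_preserving[OF l, of "\<lambda>y. \<phi> (part2 y) * (part1 y $ l * part1 y $ l)"] by simp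
qed

text \<open>The moment matrix is diagonal with equal entries, each being the trace over the
  dimension. The vectors \<open>a\<close> and \<open>b\<close> will be rows of
  \<open>L\<close>.\<close>

lemma isotropic_moment:
  fixes \<phi> :: "real ^ 'n \<Rightarrow> real" and a b :: "real ^ 'm"
  assumes [measurable]: "\<phi> \<in> borel_measurable borel"
    and int: "\<And>k l. integrable M (\<lambda>\<omega>. \<phi> (part2 (Y \<omega>)) * (part1 (Y \<omega>) $ k * part1 (Y \<omega>) $ l))"
  shows "(\<integral>\<omega>. \<phi> (part2 (Y \<omega>)) * ((a \<bullet> part1 (Y \<omega>)) * (b \<bullet> part1 (Y \<omega>))) \<partial>M) =
    (a \<bullet> b) * ((\<integral>\<omega>. \<phi> (part2 (Y \<omega>)) * (part1 (Y \<omega>) \<bullet> part1 (Y \<omega>)) \<partial>M) / CARD('m))"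
proof -
  let ?m = "\<lambda>k l. \<integral>\<omega>. \<phi> (part2 (Y \<omega>)) * (part1 (Y \<omega>) $ k * part1 (Y \<omega>) $ l) \<partial>M"
  let ?q = "\<integral>\<omega>. \<phi> (part2 (Y \<omega>)) * (part1 (Y \<omega>) \<bullet> part1 (Y \<omega>)) \<partial>M"
  have "?q = (\<integral>\<omega>. (\<Sum>k\<in>UNIV. \<phi> (part2 (Y \<omega>)) * (part1 (Y \<omega>) $ k * part1 (Y \<omega>) $ k)) \<partial>M)"
    by (simp add: inner_vec_def sum_distrib_left)
  also have "\<dots> = (\<Sum>k\<in>UNIV. ?m k k)" by (rule Bochner_Integration.integral_sum) (rule int)
  finally have q: "?q = (\<Sum>k\<in>UNIV. ?m k k)" .
  have d: "?m k k = ?q / CARD('m)" for k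
  proof -
    have "(\<Sum>l\<in>UNIV. ?m l l) = (\<Sum>l\<in>(UNIV :: 'm set). ?m k k)"
      by (rule sum.cong[OF refl]) (rule diagonal_moment_eq, measurable)
    then show ?thesis unfolding q by simp
  qed
  have m: "?m k l = (if l = k then ?q / CARD('m) else 0)" for k l
    using d[of k] off_diagonal_moment_zero[of \<phi> k l] by auto
  have "(a \<bullet> z) * (b \<bullet> z) = (\<Sum>k\<in>UNIV. \<Sum>l\<in>UNIV. a $ k * b $ l * (z $ k * z $ l))" for z :: "real ^ 'm"
    by (simp add: inner_vec_def sum_product mult_ac)
  then have "(\<integral>\<omega>. \<phi> (part2 (Y \<omega>)) * ((a \<bullet> part1 (Y \<omega>)) * (b \<bullet> part1 (Y \<omega>))) \<partial>M) =
    (\<integral>\<omega>. (\<Sum>k\<in>UNIV. \<Sum>l\<in>UNIV. a $ k * b $ l * (\<phi> (part2 (Y \<omega>)) * (part1 (Y \<omega>) $ k * part1 (Y \<omega>) $ l))) \<partial>M)"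
    by (simp add: sum_distrib_left mult_ac)
  also have "\<dots> = (\<Sum>k\<in>UNIV. \<Sum>l\<in>UNIV. a $ k * b $ l * ?m k l)"
    using int by (subst Bochner_Integration.integral_sum) (auto intro!: sum.cong Bochner_Integration.integrable_sum)
  also have "\<dots> = (\<Sum>k\<in>UNIV. a $ k * b $ k * (?q / CARD('m)))"
    unfolding m by (simp add: if_distrib[of "\<lambda>x. _ * x"] cong: if_cong)
  also have "\<dots> = (a \<bullet> b) * (?q / CARD('m))" unfolding inner_vec_def[of a b] sum_distrib_right by simp
  finally show ?thesis .
qed

lemma nn_integral_parts:
  assumes [measurable]: "f \<in> borel_measurable borel"
  shows "(\<integral>\<^sup>+\<omega>. f (Y \<omega>) \<partial>M) =
    (\<integral>\<^sup>+v. \<integral>\<^sup>+z. ennreal (h (z \<bullet> z + v \<bullet> v)) * f (stack z v) \<partial>lborel \<partial>lborel)"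
  by (subst nn_integral_Y[OF assms], subst nn_integral_lborel_stack) (auto simp: inner_stack)

lemma nn_integral_part2:
  assumes [measurable]: "f \<in> borel_measurable borel"
  shows "(\<integral>\<^sup>+\<omega>. f (part2 (Y \<omega>)) \<partial>M) =
    (\<integral>\<^sup>+v. (\<integral>\<^sup>+z. ennreal (h ((z :: real ^ 'm) \<bullet> z + v \<bullet> v)) \<partial>lborel) * f v \<partial>lborel)"
  by (subst nn_integral_parts[of "\<lambda>y. f (part2 y)"]) (auto simp: nn_integral_multc)

text \<open>With \<open>I\<close> the marginal density of the second block and \<open>J\<close> the
  second moment of the first block over a fiber, the covariance factor is J/(I r1). Weighting it by
  \<open>I\<close> leaves J/r1, and Fubini does the rest.\<close>

lemma integral_covariance_factor:
  fixes E :: "(real ^ 'n) set"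
  assumes [measurable]: "E \<in> sets borel"
    and int: "integrable M (\<lambda>\<omega>. indicator E (part2 (Y \<omega>)) * (part1 (Y \<omega>) \<bullet> part1 (Y \<omega>)))"
  shows "(\<integral>\<omega>. indicator E (part2 (Y \<omega>)) *
      covariance_factor TYPE('m) (conditional_generator TYPE('m) h (part2 (Y \<omega>) \<bullet> part2 (Y \<omega>))) \<partial>M)
    = (\<integral>\<omega>. indicator E (part2 (Y \<omega>)) * (part1 (Y \<omega>) \<bullet> part1 (Y \<omega>)) \<partial>M) / CARD('m)"
proof -
  let ?m = "real CARD('m)"
  define I where "I v = (\<integral>\<^sup>+z. ennreal (h ((z :: real ^ 'm) \<bullet> z + v \<bullet> v)) \<partial>lborel)" for v :: "real ^ 'n"
  define J where "J v = (\<integral>\<^sup>+z. ennreal ((z \<bullet> z) * h ((z :: real ^ 'm) \<bullet> z + v \<bullet> v)) \<partial>lborel)" for v :: "real ^ 'n"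
  define c where "c v = covariance_factor TYPE('m) (conditional_generator TYPE('m) h (v \<bullet> v))" for v :: "real ^ 'n"
  have hz[measurable]: "(\<lambda>z :: real ^ 'm. h (z \<bullet> z + v \<bullet> v)) \<in> borel_measurable borel" for v :: "real ^ 'n"
    using measurable_compose[OF measurable_Pair1' density_pair_measurable', of v] by simp
  have [measurable]: "I \<in> borel_measurable borel"
    unfolding I_def[abs_def] by measurable
  have [measurable]: "J \<in> borel_measurable borel"
    unfolding J_def[abs_def] by measurable
  have c: "c v = enn2real (J v) / enn2real (I v) / ?m" for v
  proof -
    have "marginal_generator TYPE('m) h (v \<bullet> v) = enn2real (I v)"
      unfolding marginal_generator_def I_def
      by (subst integral_eq_nn_integral) (auto simp: h_nonneg add.commute)
    moreover have "(\<integral>z. (z \<bullet> z) * h (z \<bullet> z + v \<bullet> v) \<partial>(lborel :: (real ^ 'm) measure)) = enn2real (J v)"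
      unfolding J_def by (subst integral_eq_nn_integral) (auto simp: h_nonneg)
    ultimately show ?thesis
      by (simp add: c_def covariance_factor_def conditional_generator_def)
  qed
  have [measurable]: "c \<in> borel_measurable borel" unfolding c[abs_def] by measurable
  have c0: "0 \<le> c v" for v by (simp add: c)
  let ?q = "\<integral>\<^sup>+\<omega>. ennreal (indicator E (part2 (Y \<omega>)) * (part1 (Y \<omega>) \<bullet> part1 (Y \<omega>))) \<partial>M"
  have "(\<integral>\<^sup>+v. I v \<partial>lborel) = (\<integral>\<^sup>+\<omega>. 1 \<partial>M)"
    unfolding I_def by (subst nn_integral_part2[of "\<lambda>_. 1"]) auto
  then have "(\<integral>\<^sup>+v. I v \<partial>lborel) \<noteq> \<infinity>" by (simp add: emeasure_space_1)
  \<comment> \<open>\<open>c\<close> is a quotient of \<open>enn2real\<close> values, which turn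
    infinity into 0, so fibers with infinite \<open>I\<close> must be excluded; they are null
    because \<open>I\<close> integrates to 1.\<close>
  then have finI: "AE v in lborel. I v \<noteq> \<infinity>" by (intro nn_integral_PInf_AE) auto
  have "?q = (\<integral>\<^sup>+v. \<integral>\<^sup>+z. indicator E v * ennreal ((z \<bullet> z) * h ((z :: real ^ 'm) \<bullet> z + v \<bullet> v)) \<partial>lborel \<partial>lborel)"
    by (subst nn_integral_parts[of "\<lambda>y. ennreal (indicator E (part2 y) * (part1 y \<bullet> part1 y))"])
       (auto intro!: nn_integral_cong simp: h_nonneg indicator_def ennreal_mult'[symmetric] mult.commute)
  also have "\<dots> = (\<integral>\<^sup>+v. indicator E v * J v \<partial>lborel)"
    unfolding J_def by (intro nn_integral_cong nn_integral_cmult) measurable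
  finally have q: "?q = (\<integral>\<^sup>+v. indicator E v * J v \<partial>lborel)" .
  have "?q < \<infinity>"
    using int by (subst (asm) integrable_iff_bounded) simp
  then have finJ: "AE v in lborel. indicator E v * J v \<noteq> \<infinity>"
    unfolding q by (intro nn_integral_PInf_AE) auto
  have key: "I v * ennreal (indicator E v * c v) = ennreal (1 / ?m) * (indicator E v * J v)"
    if I: "I v \<noteq> \<infinity>" and J: "indicator E v * J v \<noteq> \<infinity>" for v
  proof (cases "v \<in> E")
    case True
    then have "J v \<noteq> \<infinity>" using J by simp
    then obtain i j where ij: "I v = ennreal i" "J v = ennreal j" "0 \<le> i" "0 \<le> j"
      using I by (cases "I v"; cases "J v") auto
    \<comment> \<open>Where the marginal density vanishes, the density vanishes almost everywhere on
      the fiber, and so does the second moment; the convention 0/0 = 0 then gives the right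
      value.\<close>
    have "j = 0" if "i = 0"
    proof -
      have "AE z in lborel. ennreal (h ((z :: real ^ 'm) \<bullet> z + v \<bullet> v)) = 0"
      proof -
        have "I v = 0" using ij that by simp
        then show ?thesis unfolding I_def by (subst (asm) nn_integral_0_iff_AE) auto
      qed
      then have "AE z in lborel. ennreal ((z \<bullet> z) * h ((z :: real ^ 'm) \<bullet> z + v \<bullet> v)) = 0"
        by (rule eventually_mono) (simp add: ennreal_mult' h_nonneg)
      then have "J v = 0" unfolding J_def by (subst nn_integral_0_iff_AE) auto
      then show "j = 0" using ij by simp
    qed
    then have "i * c v = 1 / ?m * j" using ij by (auto simp: c)
    then show ?thesis
      using True ij c0[of v] by (simp only: ij(1,2) indicator_simps mult_1 of_bool_eq) (simp add: ennreal_mult'[symmetric] del: times_divide_eq_left)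
  qed simp
  have "(\<integral>\<^sup>+\<omega>. ennreal (indicator E (part2 (Y \<omega>)) * c (part2 (Y \<omega>))) \<partial>M)
    = (\<integral>\<^sup>+v. I v * ennreal (indicator E v * c v) \<partial>lborel)"
    unfolding I_def by (subst nn_integral_part2[of "\<lambda>v. ennreal (indicator E v * c v)"]) auto
  also have "\<dots> = (\<integral>\<^sup>+v. ennreal (1 / ?m) * (indicator E v * J v) \<partial>lborel)"
  proof (rule nn_integral_cong_AE)
    show "AE v in lborel. I v * ennreal (indicator E v * c v) = ennreal (1 / ?m) * (indicator E v * J v)"
      using finI finJ by eventually_elim (rule key)
  qed
  also have "\<dots> = ennreal (1 / ?m) * ?q" unfolding q by (rule nn_integral_cmult) measurable
  finally have "enn2real (\<integral>\<^sup>+\<omega>. ennreal (indicator E (part2 (Y \<omega>)) * c (part2 (Y \<omega>))) \<partial>M) = 1 / ?m * enn2real ?q"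
    by (simp add: enn2real_mult)
  moreover have "(\<integral>\<omega>. indicator E (part2 (Y \<omega>)) * c (part2 (Y \<omega>)) \<partial>M) =
      enn2real (\<integral>\<^sup>+\<omega>. ennreal (indicator E (part2 (Y \<omega>)) * c (part2 (Y \<omega>))) \<partial>M)"
    by (rule integral_eq_nn_integral) (measurable, simp add: c0)
  moreover have "(\<integral>\<omega>. indicator E (part2 (Y \<omega>)) * (part1 (Y \<omega>) \<bullet> part1 (Y \<omega>)) \<partial>M) = enn2real ?q"
    by (rule integral_eq_nn_integral) (auto simp: indicator_def)
  ultimately show ?thesis
    unfolding c_def[symmetric] by simp
qed

end

section \<open>Partitioned elliptical vectors\<close>

text \<open>This is how the constant of \<open>distributed_standardize\<close> disappears from the
  result.\<close>

lemma conditional_generator_cmult: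
  assumes "C \<noteq> 0"
  shows "conditional_generator T (\<lambda>u. C * h u) = conditional_generator T h"
  using assms by (simp add: conditional_generator_def[abs_def] marginal_generator_def)

text \<open>\<open>L\<close> and \<open>K\<close> are parameters, not choices made inside, so that
  \<open>Y\<close> and \<open>omega\<close> are the same objects for every generator of the law of
  X. This later allows the t or normal generator to replace \<open>h\<close>.\<close>

locale elliptical_pair = prob_space M for M :: "'w measure" +
  fixes X :: "'w \<Rightarrow> real ^ ('m::finite + 'n::finite)"
    and \<xi> :: "real ^ ('m + 'n)" and \<Omega> :: "real ^ ('m + 'n) ^ ('m + 'n)"
    and h :: "real \<Rightarrow> real" and L :: "real ^ 'm ^ 'm" and K :: "real ^ 'n ^ 'n"
  assumes X_elliptical: "elliptical M X \<xi> \<Omega> h"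
    and L: "L ** transpose L = block11 \<Omega> - block12 \<Omega> ** matrix_inv (block22 \<Omega>) ** block21 \<Omega>"
    and K: "K ** transpose K = block22 \<Omega>"
begin

definition regression :: "real ^ 'n ^ 'm" where
  "regression = block12 \<Omega> ** matrix_inv (block22 \<Omega>)"

definition schur :: "real ^ 'm ^ 'm" where
  "schur = block11 \<Omega> - block12 \<Omega> ** matrix_inv (block22 \<Omega>) ** block21 \<Omega>"

definition dispersion_root :: "real ^ ('m + 'n) ^ ('m + 'n)" where
  "dispersion_root = block_matrix L (regression ** K) 0 K"

definition Y :: "'w \<Rightarrow> real ^ ('m + 'n)" where
  "Y \<omega> = matrix_inv dispersion_root *v (X \<omega> - \<xi>)"

abbreviation "X1 \<equiv> \<lambda>\<omega>. part1 (X \<omega>)"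
abbreviation "X2 \<equiv> \<lambda>\<omega>. part2 (X \<omega>)"
abbreviation "W \<equiv> \<lambda>\<omega>. L *v part1 (Y \<omega>)"
abbreviation "m1 \<equiv> \<lambda>x2. part1 \<xi> + regression *v (x2 - part2 \<xi>)"

lemma dispersion: "dispersion_matrix \<Omega>"
  using X_elliptical by (simp add: elliptical_def)

lemma h_nonneg: "0 \<le> u \<Longrightarrow> 0 \<le> h u"
  using X_elliptical by (simp add: elliptical_def)

lemma X_measurable [measurable]: "X \<in> borel_measurable M"
  using X_elliptical distributed_measurable[of M lborel X] by (auto simp: elliptical_def)

lemma dispersion_root: "dispersion_root ** transpose dispersion_root = \<Omega>"
  unfolding dispersion_root_def regression_def by (rule block_factor[OF dispersion L K])

lemmas dispersion_root_invertible = dispersion_factor_invertible[OF dispersion dispersion_root]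

lemma X_eq: "X \<omega> = \<xi> + dispersion_root *v Y \<omega>"
  by (simp add: Y_def matrix_vector_mul_assoc matrix_inv_mult[OF dispersion_root_invertible])

lemma X2_eq: "X2 \<omega> = part2 \<xi> + K *v part2 (Y \<omega>)"
proof -
  have "dispersion_root *v stack (part1 (Y \<omega>)) (part2 (Y \<omega>)) =
      stack (W \<omega> + (regression ** K) *v part2 (Y \<omega>)) (K *v part2 (Y \<omega>))"
    unfolding dispersion_root_def block_matrix_vector_mult by (simp add: matrix_vector_mult_0)
  then have "part2 (dispersion_root *v Y \<omega>) = K *v part2 (Y \<omega>)" by simp
  then show ?thesis by (simp add: X_eq[of \<omega>] linear_add[OF linear_parts(2)])
qed

lemma X1_eq: "X1 \<omega> = m1 (X2 \<omega>) + W \<omega>"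
proof -
  have "dispersion_root *v stack (part1 (Y \<omega>)) (part2 (Y \<omega>)) =
      stack (W \<omega> + (regression ** K) *v part2 (Y \<omega>)) (K *v part2 (Y \<omega>))"
    unfolding dispersion_root_def block_matrix_vector_mult by (simp add: matrix_vector_mult_0)
  then have "part1 (dispersion_root *v Y \<omega>) = W \<omega> + (regression ** K) *v part2 (Y \<omega>)" by simp
  then show ?thesis
    unfolding X2_eq by (simp add: X_eq[of \<omega>] linear_add[OF linear_parts(1)] matrix_vector_mul_assoc)
qed

lemma mahalanobis_X2: "mahalanobis (part2 \<xi>) (block22 \<Omega>) (X2 \<omega>) = part2 (Y \<omega>) \<bullet> part2 (Y \<omega>)"
  unfolding X2_eq by (rule mahalanobis_factor[OF dispersion_block22[OF dispersion] K])

lemma affine_measurable [measurable]: "(\<lambda>v. part2 \<xi> + K *v v) \<in> borel_measurable borel"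
  by (intro borel_measurable_continuous_onI continuous_intros)

lemma spherical:
  obtains C where "0 < C" "spherical_vector M Y (\<lambda>u. C * h u)"
proof -
  have "distributed M lborel X (\<lambda>x. ennreal (elliptical_density \<xi> \<Omega> h x))"
    using X_elliptical by (simp add: elliptical_def)
  then obtain C where C: "0 < C"
    "distributed M lborel (\<lambda>\<omega>. matrix_inv dispersion_root *v (X \<omega> - \<xi>)) (\<lambda>y. ennreal (C * h (y \<bullet> y)))"
    by (rule distributed_standardize[OF dispersion dispersion_root])
  then have "distributed M lborel Y (\<lambda>y. ennreal (C * h (y \<bullet> y)))"
    by (simp only: Y_def[abs_def])
  note C = C(1) this
  have "spherical_vector M Y (\<lambda>u. C * h u)"
    by unfold_locales (use C h_nonneg in auto)
  with C(1) show ?thesis by (rule that)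
qed

lemma Y_measurable [measurable]: "Y \<in> borel_measurable M"
  using spherical spherical_vector.Y_measurable by metis

text \<open>For \<open>\<psi>\<close> an indicator this expresses that the residual has conditional
  mean zero given \<open>X2\<close>, in a form that does not require the residual to be
  integrable.\<close>

lemma residual_orthogonal:
  assumes [measurable]: "\<psi> \<in> borel_measurable borel"
  shows "(\<integral>\<omega>. \<psi> (X2 \<omega>) * W \<omega> $ i \<partial>M) = 0"
proof -
  obtain C where "spherical_vector M Y (\<lambda>u. C * h u)" using spherical .
  then interpret spherical_vector M Y "\<lambda>u. C * h u" .
  have "(\<lambda>z. (L *v z) $ i) \<in> borel_measurable borel"
    unfolding matrix_vector_mult_def by simp
  moreover have "(L *v - z) $ i = - (L *v z) $ i" for z
    by (simp add: matrix_vector_mult_def sum_negf)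
  ultimately show ?thesis
    unfolding X2_eq by (intro odd_moment_zero[of "\<lambda>z. (L *v z) $ i" "\<lambda>v. \<psi> (part2 \<xi> + K *v v)"]) auto
qed

section \<open>Moments conditional on a Borel event of the second block\<close>

context
  fixes E :: "(real ^ 'n) set"
  assumes E[measurable]: "E \<in> sets borel" and prob_E: "0 < prob {\<omega> \<in> space M. X2 \<omega> \<in> E}"
begin

abbreviation "A \<equiv> {\<omega> \<in> space M. X2 \<omega> \<in> E}"
abbreviation "U \<equiv> uniform_measure M A"

lemma A_event [measurable]: "A \<in> events" by measurable

lemma expectation_U:
  fixes f :: "'w \<Rightarrow> real"
  assumes "f \<in> borel_measurable M"
  shows "(\<integral>\<omega>. f \<omega> \<partial>U) = (\<integral>\<omega>. indicator E (X2 \<omega>) * f \<omega> \<partial>M) / prob A"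
  unfolding integral_uniform_measure[OF A_event prob_E assms]
  by (intro arg_cong2[where f = "(/)"] Bochner_Integration.integral_cong) (auto simp: indicator_def)

lemma integrable_U:
  fixes f :: "'w \<Rightarrow> real"
  assumes "f \<in> borel_measurable M"
  shows "integrable U f \<longleftrightarrow> integrable M (\<lambda>\<omega>. indicator E (X2 \<omega>) * f \<omega>)"
  unfolding integrable_uniform_measure[OF A_event prob_E assms]
  by (intro Bochner_Integration.integrable_cong) (auto simp: indicator_def)

lemma finite_U: "finite_measure U"
  by (rule finite_measure_uniform_measure[OF A_event prob_E])

lemma W_component_measurable [measurable]: "(\<lambda>\<omega>. W \<omega> $ i) \<in> borel_measurable M"
  unfolding matrix_vector_mult_def by simp

lemma residual_orthogonal_U:
  assumes [measurable]: "\<psi> \<in> borel_measurable borel"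
  shows "(\<integral>\<omega>. \<psi> (X2 \<omega>) * W \<omega> $ i \<partial>U) = 0"
  using residual_orthogonal[of "\<lambda>x. indicator E x * \<psi> x" i]
  by (subst expectation_U) (simp_all add: mult.assoc)

lemma conditional_mean:
  assumes X: "integrable U X"
  shows "event_expectation M A X =
    stack (m1 (event_expectation M A X2)) (event_expectation M A X2)"
proof -
  have Xc: "integrable U (\<lambda>\<omega>. X \<omega> $ k)" for k
    by (rule integrable_bounded_linear[OF bounded_linear_vec_nth X])
  have X2: "integrable U X2"
    by (rule integrable_vec_iff_components) (simp add: part_component Xc)
  have X2c: "integral\<^sup>L U X2 $ j = (\<integral>\<omega>. X2 \<omega> $ j \<partial>U)" for j
    by (rule integral_vec_component[OF X2])
  have X2i: "integrable U (\<lambda>\<omega>. X2 \<omega> $ j)" for j by (simp add: part_component Xc)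
  have m1: "m1 x $ i = part1 \<xi> $ i + (\<Sum>j\<in>UNIV. regression $ i $ j * (x $ j - part2 \<xi> $ j))" for x i
    by (simp add: matrix_vector_mult_def)
  interpret U: prob_space U
    using prob_E by (intro prob_space_uniform_measure) (auto simp: emeasure_eq_measure)
  have m1U: "(\<integral>\<omega>. m1 (X2 \<omega>) $ i \<partial>U) = m1 (integral\<^sup>L U X2) $ i"
    and m1i: "integrable U (\<lambda>\<omega>. m1 (X2 \<omega>) $ i)" for i
  proof -
    have "integrable U (\<lambda>\<omega>. part1 \<xi> $ i + (\<Sum>j\<in>UNIV. regression $ i $ j * (X2 \<omega> $ j - part2 \<xi> $ j)))"
      using X2i by simp
    then show "integrable U (\<lambda>\<omega>. m1 (X2 \<omega>) $ i)" by (simp only: m1)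
    have "(\<integral>\<omega>. part1 \<xi> $ i + (\<Sum>j\<in>UNIV. regression $ i $ j * (X2 \<omega> $ j - part2 \<xi> $ j)) \<partial>U)
      = part1 \<xi> $ i + (\<Sum>j\<in>UNIV. regression $ i $ j * ((\<integral>\<omega>. X2 \<omega> $ j \<partial>U) - part2 \<xi> $ j))"
      using X2i U.prob_space by simp
    then show "(\<integral>\<omega>. m1 (X2 \<omega>) $ i \<partial>U) = m1 (integral\<^sup>L U X2) $ i" by (simp only: m1 X2c)
  qed
  \<comment> \<open>A vanishing integral of the residual does not by itself permit splitting the
    integral of \<open>X1\<close>; its integrability is obtained as that of a difference.\<close>
  have Wi: "integrable U (\<lambda>\<omega>. W \<omega> $ i)" for i
  proof -
    have "integrable U (\<lambda>\<omega>. X \<omega> $ Inl i - m1 (X2 \<omega>) $ i)"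
      by (intro Bochner_Integration.integrable_diff Xc m1i)
    also have "(\<lambda>\<omega>. X \<omega> $ Inl i - m1 (X2 \<omega>) $ i) = (\<lambda>\<omega>. W \<omega> $ i)"
      by (simp add: part_component(1)[symmetric] X1_eq)
    finally show ?thesis .
  qed
  have W0: "(\<integral>\<omega>. W \<omega> $ i \<partial>U) = 0" for i
    using residual_orthogonal_U[of "\<lambda>_. 1" i] by simp
  have "(\<integral>\<omega>. X1 \<omega> $ i \<partial>U) = m1 (integral\<^sup>L U X2) $ i" for i
  proof -
    have "X1 \<omega> $ i = m1 (X2 \<omega>) $ i + W \<omega> $ i" for \<omega>
      by (subst X1_eq) (rule vector_add_component)
    then have "(\<integral>\<omega>. X1 \<omega> $ i \<partial>U) = (\<integral>\<omega>. m1 (X2 \<omega>) $ i \<partial>U) + (\<integral>\<omega>. W \<omega> $ i \<partial>U)"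
      by (simp only: Bochner_Integration.integral_add[OF m1i Wi])
    then show ?thesis by (simp only: m1U W0 add_0_right)
  qed
  then show ?thesis
    unfolding event_expectation_def vec_eq_iff split_sum_all
    by (simp add: integral_vec_component[OF X] X2c part_component)
qed

context
  assumes sq: "event_square_integrable M A X"
begin

lemma L2_X: "square_integrable U (\<lambda>\<omega>. X \<omega> $ k)"
  unfolding square_integrable_def
proof
  have m[measurable]: "(\<lambda>\<omega>. X \<omega> $ k) \<in> borel_measurable M"
    by (rule measurable_compose[OF X_measurable]) simp
  have "integrable U (\<lambda>\<omega>. (norm (X \<omega>))\<^sup>2)" using sq by (simp add: event_square_integrable_def)
  then show "integrable U (\<lambda>\<omega>. (X \<omega> $ k)\<^sup>2)"
  proof (rule Bochner_Integration.integrable_bound)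
    show "AE \<omega> in U. norm ((X \<omega> $ k)\<^sup>2) \<le> norm ((norm (X \<omega>))\<^sup>2)"
      using component_le_norm_cart[of "X _" k] by (intro AE_I2) (simp flip: abs_le_square_iff)
  qed measurable
  show "(\<lambda>\<omega>. X \<omega> $ k) \<in> borel_measurable U" by measurable
qed

lemma L2_linear:
  fixes T :: "real ^ 'a::finite ^ 'b::finite"
  assumes "\<And>k. square_integrable U (\<lambda>\<omega>. f \<omega> $ k)"
  shows "square_integrable U (\<lambda>\<omega>. (T *v (f \<omega> - c)) $ i)"
  unfolding matrix_vector_mult_def
  by (simp, intro square_integrable_sum square_integrable_cmult square_integrable_diff
      square_integrable_const finite_U assms)

lemma L2_Y: "square_integrable U (\<lambda>\<omega>. Y \<omega> $ k)"
  unfolding Y_def by (rule L2_linear[OF L2_X])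

lemma L2_X2: "square_integrable U (\<lambda>\<omega>. X2 \<omega> $ j)" "square_integrable U (\<lambda>\<omega>. X1 \<omega> $ i)"
  by (simp_all add: part_component L2_X)

lemma L2_W: "square_integrable U (\<lambda>\<omega>. W \<omega> $ i)"
  using L2_linear[of "\<lambda>\<omega>. part1 (Y \<omega>)" L 0 i] by (simp add: part_component L2_Y)

lemma L2_m1: "square_integrable U (\<lambda>\<omega>. m1 (X2 \<omega>) $ i)"
  by (simp, intro square_integrable_add square_integrable_const finite_U L2_linear L2_X2)

definition omega :: real where
  "omega = (\<integral>\<omega>. part1 (Y \<omega>) \<bullet> part1 (Y \<omega>) \<partial>U) / CARD('m)"

text \<open>Each component of the residual is the inner product of a row of \<open>L\<close> with
  \<open>part1 (Y \<omega>)\<close>, so \<open>isotropic_moment\<close> produces inner products of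
  rows, the entries of L L^T.\<close>

lemma residual_covariance: "(\<integral>\<omega>. W \<omega> $ i * W \<omega> $ j \<partial>U) = omega * schur $ i $ j"
proof -
  obtain C where "spherical_vector M Y (\<lambda>u. C * h u)" using spherical .
  then interpret spherical_vector M Y "\<lambda>u. C * h u" .
  let ?\<phi> = "\<lambda>v. indicator E (part2 \<xi> + K *v v) :: real"
  have "integrable U (\<lambda>\<omega>. part1 (Y \<omega>) $ k * part1 (Y \<omega>) $ l)" for k l
    by (rule square_integrable_mult) (simp_all add: part_component L2_Y)
  then have int: "integrable M (\<lambda>\<omega>. ?\<phi> (part2 (Y \<omega>)) * (part1 (Y \<omega>) $ k * part1 (Y \<omega>) $ l))" for k l
    by (subst (asm) integrable_U) (simp_all add: X2_eq)
  have Wr: "W \<omega> $ i = L $ i \<bullet> part1 (Y \<omega>)" for i \<omega>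
    by (simp add: matrix_vector_mult_def inner_vec_def)
  have "L $ i \<bullet> L $ j = schur $ i $ j"
    unfolding schur_def L[symmetric] by (simp add: matrix_matrix_mult_def transpose_def inner_vec_def)
  then have "(\<integral>\<omega>. indicator E (X2 \<omega>) * (W \<omega> $ i * W \<omega> $ j) \<partial>M) = schur $ i $ j *
      ((\<integral>\<omega>. indicator E (X2 \<omega>) * (part1 (Y \<omega>) \<bullet> part1 (Y \<omega>)) \<partial>M) / CARD('m))"
    unfolding Wr X2_eq using isotropic_moment[OF _ int, of "L $ i" "L $ j"] by simp
  then show ?thesis
    unfolding omega_def by (simp add: expectation_U mult_ac)
qed

text \<open>\<open>integral_covariance_factor\<close> speaks of \<open>Y\<close> and of the
  generator \<open>C * h\<close>. The set \<open>E\<close> is pulled back along the affine map from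
  \<open>part2 (Y \<omega>)\<close> to \<open>X2 \<omega>\<close>, and \<open>C\<close>
  cancels.\<close>

lemma omega_eq_covariance_factor:
  "omega = (\<integral>\<omega>. covariance_factor TYPE('m)
     (conditional_generator TYPE('m) h (mahalanobis (part2 \<xi>) (block22 \<Omega>) (X2 \<omega>))) \<partial>U)"
proof -
  obtain C where C: "0 < C" "spherical_vector M Y (\<lambda>u. C * h u)" using spherical .
  interpret spherical_vector M Y "\<lambda>u. C * h u" by (rule C)
  let ?E = "{v. part2 \<xi> + K *v v \<in> E}"
  let ?c = "\<lambda>d. covariance_factor TYPE('m) (conditional_generator TYPE('m) h d)"
  have cg: "conditional_generator TYPE('m) (\<lambda>u. C * h u) = conditional_generator TYPE('m) h"
    using C by (intro conditional_generator_cmult) simp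
  have Em: "?E \<in> sets borel"
    using measurable_sets_borel[OF affine_measurable E] by (simp add: vimage_def)
  have ind: "indicator ?E (part2 (Y \<omega>)) = (indicator E (X2 \<omega>) :: real)" for \<omega>
    by (simp add: X2_eq indicator_def)
  have cm: "(\<lambda>\<omega>. ?c (part2 (Y \<omega>) \<bullet> part2 (Y \<omega>))) \<in> borel_measurable M"
    using measurable_compose[OF _ covariance_factor_measurable[unfolded cg], of "\<lambda>\<omega>. part2 (Y \<omega>)" M] by measurable
  have "integrable U (\<lambda>\<omega>. part1 (Y \<omega>) \<bullet> part1 (Y \<omega>))"
    unfolding inner_vec_def inner_real_def
    by (intro Bochner_Integration.integrable_sum square_integrable_mult) (simp_all add: part_component L2_Y)
  then have int: "integrable M (\<lambda>\<omega>. indicator ?E (part2 (Y \<omega>)) * (part1 (Y \<omega>) \<bullet> part1 (Y \<omega>)))"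
    unfolding ind by (subst (asm) integrable_U) simp_all
  show ?thesis
    unfolding omega_def mahalanobis_X2
    using integral_covariance_factor[OF Em int] unfolding ind cg
    by (subst (1 2) expectation_U) (simp_all add: cm mult.commute)
qed

text \<open>The deviation of \<open>X1\<close> from its mean is the residual plus
  \<open>regression\<close> applied to the deviation of \<open>X2\<close>. The latter is a function
  of \<open>X2\<close>, so all mixed terms with the residual vanish.\<close>

lemma event_cov_eq:
  "event_cov M A X $ Inr j $ Inr j' = event_cov M A X2 $ j $ j'"
  "event_cov M A X $ Inl i $ Inr j' = (regression ** event_cov M A X2) $ i $ j'"
  "event_cov M A X $ Inr j $ Inl i' = (event_cov M A X2 ** transpose regression) $ j $ i'"
  "event_cov M A X $ Inl i $ Inl i' = omega * schur $ i $ i' + (regression ** event_cov M A X2 ** transpose regression) $ i $ i'"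
proof -
  let ?\<mu> = "event_expectation M A X2"
  let ?T = "\<lambda>\<omega> j. X2 \<omega> $ j - ?\<mu> $ j"
  let ?\<Sigma> = "event_cov M A X2"
  let ?B = regression
  have "integrable U X"
    by (rule integrable_vec_iff_components) (rule L2_imp_integrable[OF finite_U L2_X])
  note mean = conditional_mean[OF this]
  have dev2: "X \<omega> $ Inr j - event_expectation M A X $ Inr j = ?T \<omega> j" for \<omega> j
    by (simp add: mean part_component)
  have dev1: "X \<omega> $ Inl i - event_expectation M A X $ Inl i = W \<omega> $ i + (\<Sum>k\<in>UNIV. ?B $ i $ k * ?T \<omega> k)" for \<omega> i
  proof -
    have "X \<omega> $ Inl i = (m1 (X2 \<omega>) + W \<omega>) $ i" unfolding X1_eq[symmetric] by (simp add: part_component)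
    then show ?thesis
      by (simp add: mean matrix_vector_mult_def sum_subtractf[symmetric] right_diff_distrib algebra_simps)
         (simp add: sum_subtractf sum.distrib algebra_simps)
  qed
  have T2: "square_integrable U (\<lambda>\<omega>. ?T \<omega> j)" for j
    by (intro square_integrable_diff L2_X2 square_integrable_const finite_U)
  have TT: "integrable U (\<lambda>\<omega>. ?T \<omega> j * ?T \<omega> k)" "(\<integral>\<omega>. ?T \<omega> j * ?T \<omega> k \<partial>U) = ?\<Sigma> $ j $ k" for j k
    by (rule square_integrable_mult[OF T2 T2]) (simp add: event_cov_def event_expectation_def)
  have WT: "integrable U (\<lambda>\<omega>. W \<omega> $ i * ?T \<omega> j)" for i j
    by (intro square_integrable_mult T2 L2_W)
  have WT0: "(\<integral>\<omega>. W \<omega> $ i * ?T \<omega> j \<partial>U) = 0" for i j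
    using residual_orthogonal_U[of "\<lambda>x. x $ j - ?\<mu> $ j" i] by (simp add: mult.commute)
  have WW: "integrable U (\<lambda>\<omega>. W \<omega> $ i * W \<omega> $ j)" for i j
    by (intro square_integrable_mult L2_W)
  show "event_cov M A X $ Inr j $ Inr j' = ?\<Sigma> $ j $ j'"
    by (simp add: event_cov_def dev2)
  have lr: "(\<integral>\<omega>. (W \<omega> $ i + (\<Sum>k\<in>UNIV. ?B $ i $ k * ?T \<omega> k)) * ?T \<omega> j' \<partial>U) = (?B ** ?\<Sigma>) $ i $ j'" for i j'
  proof -
    have "(W \<omega> $ i + (\<Sum>k\<in>UNIV. ?B $ i $ k * ?T \<omega> k)) * ?T \<omega> j' =
        W \<omega> $ i * ?T \<omega> j' + (\<Sum>k\<in>UNIV. ?B $ i $ k * (?T \<omega> k * ?T \<omega> j'))" for \<omega>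
      by (simp only: distrib_right sum_distrib_right mult.assoc)
    then show ?thesis using TT WT by (simp add: WT0 matrix_matrix_mult_def)
  qed
  show "event_cov M A X $ Inl i $ Inr j' = (?B ** ?\<Sigma>) $ i $ j'"
    unfolding lr[symmetric]
    by (simp only: event_cov_def vec_lambda_beta dev1 dev2) (simp only: event_expectation_def)
  have sym: "?\<Sigma> $ j $ k = ?\<Sigma> $ k $ j" for j k
    by (simp add: event_cov_def mult.commute)
  show "event_cov M A X $ Inr j $ Inl i' = (?\<Sigma> ** transpose ?B) $ j $ i'"
  proof -
    have "event_cov M A X $ Inr j $ Inl i' = (?B ** ?\<Sigma>) $ i' $ j"
      unfolding lr[symmetric]
      by (simp only: event_cov_def vec_lambda_beta dev1 dev2) (simp only: event_expectation_def mult.commute)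
    also have "\<dots> = (?\<Sigma> ** transpose ?B) $ j $ i'"
      by (simp add: matrix_matrix_mult_def transpose_def sym[of j] mult.commute)
    finally show ?thesis .
  qed
  have "(W \<omega> $ i + (\<Sum>k\<in>UNIV. ?B $ i $ k * ?T \<omega> k)) * (W \<omega> $ i' + (\<Sum>k\<in>UNIV. ?B $ i' $ k * ?T \<omega> k)) =
     W \<omega> $ i * W \<omega> $ i' + (\<Sum>k\<in>UNIV. ?B $ i' $ k * (W \<omega> $ i * ?T \<omega> k)) + (\<Sum>k\<in>UNIV. ?B $ i $ k * (W \<omega> $ i' * ?T \<omega> k))
     + (\<Sum>k\<in>UNIV. \<Sum>l\<in>UNIV. ?B $ i $ k * ?B $ i' $ l * (?T \<omega> k * ?T \<omega> l))" for \<omega>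
  proof -
    \<comment> \<open>The expansion is carried out over arbitrary reals, keeping the random
      variables opaque.\<close>
    have "(a + (\<Sum>k\<in>UNIV. b k * t k)) * (a' + (\<Sum>k\<in>UNIV. c k * t k)) =
      a * a' + (\<Sum>k\<in>UNIV. c k * (a * t k)) + (\<Sum>k\<in>UNIV. b k * (a' * t k))
      + (\<Sum>k\<in>UNIV. \<Sum>l\<in>UNIV. b k * c l * (t k * t l))" for a a' :: real and b c t :: "'n \<Rightarrow> real"
    proof -
      have 1: "(\<Sum>k\<in>UNIV. \<Sum>l\<in>UNIV. b k * c l * (t k * t l)) = (\<Sum>k\<in>UNIV. b k * t k) * (\<Sum>k\<in>UNIV. c k * t k)"
        by (simp add: sum_product mult_ac)
      have 2: "(\<Sum>k\<in>UNIV. c k * (a * t k)) = a * (\<Sum>k\<in>UNIV. c k * t k)"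
        "(\<Sum>k\<in>UNIV. b k * (a' * t k)) = a' * (\<Sum>k\<in>UNIV. b k * t k)"
        by (simp_all add: sum_distrib_left mult_ac)
      show ?thesis unfolding 1 2 by (simp add: algebra_simps)
    qed
    then show ?thesis .
  qed
  then have "event_cov M A X $ Inl i $ Inl i' =
     (\<integral>\<omega>. W \<omega> $ i * W \<omega> $ i' + (\<Sum>k\<in>UNIV. ?B $ i' $ k * (W \<omega> $ i * ?T \<omega> k)) + (\<Sum>k\<in>UNIV. ?B $ i $ k * (W \<omega> $ i' * ?T \<omega> k))
     + (\<Sum>k\<in>UNIV. \<Sum>l\<in>UNIV. ?B $ i $ k * ?B $ i' $ l * (?T \<omega> k * ?T \<omega> l)) \<partial>U)"
    unfolding event_cov_def
    by (simp only: vec_lambda_beta dev1 event_expectation_def[of M A "\<lambda>\<omega>. (_ \<omega> * _ \<omega>)"])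
  also have "\<dots> = omega * schur $ i $ i' + (\<Sum>k\<in>UNIV. \<Sum>l\<in>UNIV. ?B $ i $ k * ?B $ i' $ l * ?\<Sigma> $ k $ l)"
    using TT WT WW by (simp add: WT0 residual_covariance)
  also have "(\<Sum>k\<in>UNIV. \<Sum>l\<in>UNIV. ?B $ i $ k * ?B $ i' $ l * ?\<Sigma> $ k $ l) = (?B ** ?\<Sigma> ** transpose ?B) $ i $ i'"
    unfolding matrix_matrix_mult_def transpose_def
    by (simp add: sum_distrib_right sum_distrib_left mult_ac) (rule sum.swap)
  finally show "event_cov M A X $ Inl i $ Inl i' = omega * schur $ i $ i' + (?B ** ?\<Sigma> ** transpose ?B) $ i $ i'" .
qed

text \<open>\<open>X1\<close> need not be integrable outside the event, so its conditional expectations are controlled only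
  after multiplication by the indicator of the event, which is measurable with respect to \<open>X2\<close>.\<close>

lemma conditional_covariance:
  "event_expectation M A (cond_cov M X1 X2) = omega *\<^sub>R schur"
proof -
  define F where "F = vimage_algebra (space M) X2 borel"
  have X2m: "X2 \<in> borel_measurable M" by measurable
  have X2F[measurable]: "X2 \<in> borel_measurable F"
    unfolding F_def by (rule measurable_vimage_algebra1) simp
  have sub: "subalgebra M F"
    using X2m unfolding subalgebra_def F_def by (simp add: measurable_iff_sets)
  interpret F: finite_measure_subalgebra M F by unfold_locales (rule sub)
  let ?I = "\<lambda>\<omega>. indicator E (X2 \<omega>) :: real"
  let ?ce = "\<lambda>i. real_cond_exp M F (\<lambda>\<omega>. X1 \<omega> $ i)"
  have X1m[measurable]: "(\<lambda>\<omega>. X1 \<omega> $ i) \<in> borel_measurable M" for i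
    by measurable
  have m1m[measurable]: "(\<lambda>x. m1 x $ i) \<in> borel_measurable borel" for i
    unfolding matrix_vector_mult_def by simp
  have m1F: "(\<lambda>\<omega>. ?I \<omega> * m1 (X2 \<omega>) $ i) \<in> borel_measurable F" for i
    by (intro borel_measurable_times measurable_compose[OF X2F m1m]) measurable
  have m1M: "(\<lambda>\<omega>. m1 (X2 \<omega>) $ i) \<in> borel_measurable M" for i
    using measurable_compose[OF X2m m1m] by simp
  have intX: "integrable M (\<lambda>\<omega>. ?I \<omega> * X1 \<omega> $ i)" for i
    using L2_imp_integrable[OF finite_U L2_X2(2)] by (subst (asm) integrable_U) simp_all
  have intm: "integrable M (\<lambda>\<omega>. ?I \<omega> * m1 (X2 \<omega>) $ i)" for i
    using L2_imp_integrable[OF finite_U L2_m1] by (subst (asm) integrable_U) (simp_all only: m1M)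
  have intW: "integrable M (\<lambda>\<omega>. ?I \<omega> * W \<omega> $ i)" for i
    using L2_imp_integrable[OF finite_U L2_W] by (subst (asm) integrable_U) (simp_all only: W_component_measurable)
  have X1c: "X1 \<omega> $ i = m1 (X2 \<omega>) $ i + W \<omega> $ i" for \<omega> i
    by (subst X1_eq) (rule vector_add_component)
  \<comment> \<open>On the event the conditional mean of \<open>X1\<close> is the regression
    function. The characterization by integrals over sets of the sigma-algebra of \<open>X2\<close>
    applies to the indicator times \<open>X1\<close>, which is integrable; the indicator is then
    taken out of the conditional expectation.\<close>
  have ce: "AE \<omega> in M. ?I \<omega> * ?ce i \<omega> = ?I \<omega> * m1 (X2 \<omega>) $ i" for i
  proof -
    have "AE \<omega> in M. real_cond_exp M F (\<lambda>\<omega>. ?I \<omega> * X1 \<omega> $ i) \<omega> = ?I \<omega> * m1 (X2 \<omega>) $ i"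
    proof (rule F.real_cond_exp_charact[OF _ intX intm m1F])
      fix S assume "S \<in> sets F"
      then obtain D where D[measurable]: "D \<in> sets borel" and S: "S = X2 -` D \<inter> space M"
        unfolding F_def by (auto simp: sets_vimage_algebra2)
      have Sm: "S \<in> events" using sub \<open>S \<in> sets F\<close> by (auto simp: subalgebra_def)
      have "(\<integral>\<omega>. indicator D (X2 \<omega>) * indicator E (X2 \<omega>) * W \<omega> $ i \<partial>M) = 0"
        by (rule residual_orthogonal[of "\<lambda>x. indicator D x * indicator E x"]) measurable
      also have "(\<integral>\<omega>. indicator D (X2 \<omega>) * indicator E (X2 \<omega>) * W \<omega> $ i \<partial>M)
          = (\<integral>\<omega>. indicator S \<omega> *\<^sub>R (?I \<omega> * W \<omega> $ i) \<partial>M)"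
        by (intro Bochner_Integration.integral_cong) (auto simp: S indicator_def)
      finally have W0: "(\<integral>\<omega>. indicator S \<omega> *\<^sub>R (?I \<omega> * W \<omega> $ i) \<partial>M) = 0" .
      have "(\<integral>\<omega>. indicator S \<omega> *\<^sub>R (?I \<omega> * X1 \<omega> $ i) \<partial>M)
        = (\<integral>\<omega>. indicator S \<omega> *\<^sub>R (?I \<omega> * m1 (X2 \<omega>) $ i) + indicator S \<omega> *\<^sub>R (?I \<omega> * W \<omega> $ i) \<partial>M)"
        unfolding X1c by (simp only: distrib_left scaleR_add_right)
      also have "\<dots> = (\<integral>\<omega>. indicator S \<omega> *\<^sub>R (?I \<omega> * m1 (X2 \<omega>) $ i) \<partial>M) + 0"
        unfolding W0[symmetric]
        by (intro Bochner_Integration.integral_add integrable_mult_indicator Sm intm intW)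
      finally show "(\<integral>\<omega>\<in>S. ?I \<omega> * X1 \<omega> $ i \<partial>M) = (\<integral>\<omega>\<in>S. ?I \<omega> * m1 (X2 \<omega>) $ i \<partial>M)"
        unfolding set_lebesgue_integral_def by simp
    qed
    moreover have "AE \<omega> in M. real_cond_exp M F (\<lambda>\<omega>. ?I \<omega> * X1 \<omega> $ i) \<omega> = ?I \<omega> * ?ce i \<omega>"
      by (rule F.real_cond_exp_mult[OF _ X1m intX]) measurable
    ultimately show ?thesis by eventually_elim simp
  qed
  let ?g = "\<lambda>i j \<omega>. (X1 \<omega> $ i - ?ce i \<omega>) * (X1 \<omega> $ j - ?ce j \<omega>)"
  have cc: "cond_cov M X1 X2 \<omega> $ i $ j = real_cond_exp M F (?g i j) \<omega>" for \<omega> i j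
    by (simp add: cond_cov_def cond_exp_given_def F_def)
  have gm[measurable]: "?g i j \<in> borel_measurable M" for i j by measurable
  have eqg: "AE \<omega> in M. ?I \<omega> * ?g i j \<omega> = ?I \<omega> * (W \<omega> $ i * W \<omega> $ j)" for i j
    using ce[of i] ce[of j]
  proof eventually_elim
    case (elim \<omega>)
    show ?case
    proof (cases "X2 \<omega> \<in> E")
      case True
      then have "?ce i \<omega> = m1 (X2 \<omega>) $ i" "?ce j \<omega> = m1 (X2 \<omega>) $ j" using elim by simp_all
      then show ?thesis by (simp only: X1c add_diff_cancel_left')
    qed simp
  qed
  have intWW: "integrable M (\<lambda>\<omega>. ?I \<omega> * (W \<omega> $ i * W \<omega> $ j))" for i j
    using square_integrable_mult[OF L2_W L2_W] by (subst (asm) integrable_U) simp_all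
  have intg: "integrable M (\<lambda>\<omega>. ?I \<omega> * ?g i j \<omega>)" for i j
  proof (rule integrable_cong_AE_imp[OF intWW[of i j]])
    show "AE \<omega> in M. ?I \<omega> * (W \<omega> $ i * W \<omega> $ j) = ?I \<omega> * ?g i j \<omega>"
      using eqg[of i j] by (rule eventually_mono) (rule sym)
  qed measurable
  have IF: "?I \<in> borel_measurable F" by measurable
  \<comment> \<open>Integrating the conditional expectation over the event relies on integrability
    of the product with the indicator; \<open>?g i j\<close> alone may fail to be
    integrable.\<close>
  note cg = F.real_cond_exp_intg[OF intg IF gm]
  have iU: "integrable U (\<lambda>\<omega>. cond_cov M X1 X2 \<omega> $ i $ j)" for i j
    unfolding cc by (subst integrable_U) (measurable, rule cg)
  have "integral\<^sup>L U (cond_cov M X1 X2) $ i $ j = omega * schur $ i $ j" for i j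
  proof -
    have "integral\<^sup>L U (cond_cov M X1 X2) $ i $ j = (\<integral>\<omega>. real_cond_exp M F (?g i j) \<omega> \<partial>U)"
      unfolding integral_mat_component[OF iU] cc ..
    also have "\<dots> = (\<integral>\<omega>. ?I \<omega> * ?g i j \<omega> \<partial>M) / prob A"
      by (subst expectation_U) (measurable, simp only: cg(2))
    also have "(\<integral>\<omega>. ?I \<omega> * ?g i j \<omega> \<partial>M) = (\<integral>\<omega>. ?I \<omega> * (W \<omega> $ i * W \<omega> $ j) \<partial>M)"
      by (rule integral_cong_AE) (measurable, rule eqg)
    also have "(\<integral>\<omega>. ?I \<omega> * (W \<omega> $ i * W \<omega> $ j) \<partial>M) / prob A = (\<integral>\<omega>. W \<omega> $ i * W \<omega> $ j \<partial>U)"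
      by (subst expectation_U) simp_all
    finally show ?thesis by (simp only: residual_covariance)
  qed
  then show ?thesis by (simp add: event_expectation_def vec_eq_iff)
qed

end

text \<open>\<open>X2\<close> has a density, so a Lebesgue null set would have probability zero.
  This supplies the positive volume that the limit in \<nu> requires.\<close>

lemma E_not_null: "emeasure lborel E \<noteq> 0"
proof
  assume E0: "emeasure lborel E = 0"
  obtain C where C: "0 < C" "spherical_vector M Y (\<lambda>u. C * h u)" using spherical .
  interpret spherical_vector M Y "\<lambda>u. C * h u" by (rule C)
  obtain D where D: "0 < D"
    "\<And>c f. f \<in> borel_measurable borel \<Longrightarrow> (\<integral>\<^sup>+x. f x \<partial>lborel) = ennreal D * (\<integral>\<^sup>+y. f (c + K *v y) \<partial>lborel)"
    using nn_integral_lborel_affine_matrix[OF dispersion_factor_invertible[OF dispersion_block22[OF dispersion] K]] by metis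
  have "(\<integral>\<^sup>+x. indicator E x \<partial>lborel) = ennreal D * (\<integral>\<^sup>+y. indicator E (part2 \<xi> + K *v y) \<partial>lborel)"
    by (rule D(2)) measurable
  then have "(\<integral>\<^sup>+y. indicator E (part2 \<xi> + K *v y) \<partial>lborel) = 0"
    using E0 D(1) by simp
  then have "AE v in lborel. indicator E (part2 \<xi> + K *v v) = (0::ennreal)"
    by (subst (asm) nn_integral_0_iff_AE) auto
  then have "(\<integral>\<^sup>+v. (\<integral>\<^sup>+z. ennreal (C * h ((z :: real ^ 'm) \<bullet> z + v \<bullet> v)) \<partial>lborel) * indicator E (part2 \<xi> + K *v v) \<partial>lborel) = (\<integral>\<^sup>+v. 0 \<partial>(lborel :: (real ^ 'n) measure))"
  proof (intro nn_integral_cong_AE)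
    assume "AE v in lborel. indicator E (part2 \<xi> + K *v v) = (0::ennreal)"
    then show "AE v in lborel. (\<integral>\<^sup>+z. ennreal (C * h ((z :: real ^ 'm) \<bullet> z + v \<bullet> v)) \<partial>lborel) * indicator E (part2 \<xi> + K *v v) = 0"
      by eventually_elim simp
  qed
  then have "(\<integral>\<^sup>+\<omega>. indicator E (X2 \<omega>) \<partial>M) = 0"
    unfolding X2_eq by (subst nn_integral_part2[of "\<lambda>v. indicator E (part2 \<xi> + K *v v)"]) auto
  also have "(\<integral>\<^sup>+\<omega>. indicator E (X2 \<omega>) \<partial>M) = (\<integral>\<^sup>+\<omega>. indicator A \<omega> \<partial>M)"
    by (intro nn_integral_cong) (simp add: indicator_def)
  finally show False using prob_E by (simp add: emeasure_eq_measure)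
qed

text \<open>Finiteness is inherited from the whole law: |X|^2 is at most 2 |\<xi>|^2 + 2 R^2 |Y|^2
  with \<open>R\<close> a bound for the root, and restriction to the event keeps
  integrability.\<close>

lemma second_moment_finite:
  assumes fin: "(\<integral>\<^sup>+y. ennreal ((y \<bullet> y) * h (y \<bullet> y)) \<partial>(lborel :: (real ^ ('m + 'n)) measure)) < \<infinity>"
  shows "event_square_integrable M A X"
proof -
  obtain C where C: "0 < C" "spherical_vector M Y (\<lambda>u. C * h u)" using spherical .
  interpret spherical_vector M Y "\<lambda>u. C * h u" by (rule C)
  have "(\<lambda>y :: real ^ ('m + 'n). 1 / C * (C * h (y \<bullet> y))) \<in> borel_measurable borel" by measurable
  then have hm[measurable]: "(\<lambda>y :: real ^ ('m + 'n). h (y \<bullet> y)) \<in> borel_measurable borel" using C by simp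
  have "(\<integral>\<^sup>+\<omega>. ennreal (Y \<omega> \<bullet> Y \<omega>) \<partial>M) = (\<integral>\<^sup>+y. ennreal (C * h (y \<bullet> y)) * ennreal (y \<bullet> y) \<partial>(lborel :: (real ^ ('m + 'n)) measure))"
    by (rule nn_integral_Y) measurable
  also have "\<dots> = (\<integral>\<^sup>+y. ennreal C * ennreal ((y \<bullet> y) * h (y \<bullet> y)) \<partial>(lborel :: (real ^ ('m + 'n)) measure))"
    using C elliptical_pair.h_nonneg[OF elliptical_pair_axioms]
    by (intro nn_integral_cong) (simp add: ennreal_mult[symmetric] mult_ac)
  also have "\<dots> = ennreal C * (\<integral>\<^sup>+y. ennreal ((y \<bullet> y) * h (y \<bullet> y)) \<partial>(lborel :: (real ^ ('m + 'n)) measure))"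
    by (rule nn_integral_cmult) measurable
  also have "\<dots> < \<infinity>" using fin by (simp add: ennreal_mult_less_top)
  finally have intY: "integrable M (\<lambda>\<omega>. Y \<omega> \<bullet> Y \<omega>)" by (intro integrableI_nonneg) auto
  obtain R where R: "\<And>y. norm (dispersion_root *v y) \<le> norm y * R"
    using bounded_linear.bounded[OF matrix_vector_mul_bounded_linear, of dispersion_root] by blast
  have "integrable M (\<lambda>\<omega>. (norm (X \<omega>))\<^sup>2)"
  proof (rule Bochner_Integration.integrable_bound)
    show "integrable M (\<lambda>\<omega>. 2 * (norm \<xi>)\<^sup>2 + 2 * R\<^sup>2 * (Y \<omega> \<bullet> Y \<omega>))" using intY by simp
    show "AE \<omega> in M. norm ((norm (X \<omega>))\<^sup>2) \<le> norm (2 * (norm \<xi>)\<^sup>2 + 2 * R\<^sup>2 * (Y \<omega> \<bullet> Y \<omega>))"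
    proof (rule AE_I2)
      fix \<omega>
      have "norm (X \<omega>) \<le> norm \<xi> + norm (Y \<omega>) * R"
        unfolding X_eq[of \<omega>] using R[of "Y \<omega>"] norm_triangle_ineq[of \<xi> "dispersion_root *v Y \<omega>"] by linarith
      then have "(norm (X \<omega>))\<^sup>2 \<le> (norm \<xi> + norm (Y \<omega>) * R)\<^sup>2" by (intro power_mono) auto
      also have "\<dots> \<le> 2 * (norm \<xi>)\<^sup>2 + 2 * (norm (Y \<omega>) * R)\<^sup>2"
        using sum_squares_bound[of "norm \<xi>" "norm (Y \<omega>) * R"] by (simp add: power2_sum)
      also have "\<dots> = 2 * (norm \<xi>)\<^sup>2 + 2 * R\<^sup>2 * (Y \<omega> \<bullet> Y \<omega>)"
        by (simp add: power_mult_distrib power2_norm_eq_inner)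
      finally show "norm ((norm (X \<omega>))\<^sup>2) \<le> norm (2 * (norm \<xi>)\<^sup>2 + 2 * R\<^sup>2 * (Y \<omega> \<bullet> Y \<omega>))" by simp
    qed
  qed measurable
  then have "integrable M (\<lambda>\<omega>. indicator A \<omega> *\<^sub>R (norm (X \<omega>))\<^sup>2)"
    by (intro integrable_mult_indicator) simp_all
  then have "integrable U (\<lambda>\<omega>. (norm (X \<omega>))\<^sup>2)"
    by (subst integrable_uniform_measure[OF A_event prob_E]) simp_all
  then show ?thesis by (simp add: event_square_integrable_def)
qed

text \<open>Integrating out the first block with \<open>student_marginal\<close> leaves a multiple
  \<open>k\<close> of the t kernel as the density of \<open>X2\<close>. The value of
  \<open>k\<close> is never computed and cancels between the integral and the probability of the
  event.\<close>

lemma student_expectation: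
  assumes \<nu>: "0 < \<nu>" and h: "h = student_generator CARD('m + 'n) \<nu>"
    and [measurable]: "\<psi> \<in> borel_measurable borel" and \<psi>: "\<And>x. 0 \<le> \<psi> x"
  shows "(\<integral>\<omega>. \<psi> (X2 \<omega>) \<partial>U) =
    (\<integral>x. indicator E x * (\<psi> x * student_weight (part2 \<xi>) (block22 \<Omega>) \<nu> x) \<partial>lborel) /
    (\<integral>x. indicator E x * student_weight (part2 \<xi>) (block22 \<Omega>) \<nu> x \<partial>lborel)"
proof -
  let ?w = "student_weight (part2 \<xi>) (block22 \<Omega>) \<nu>"
  have w0: "0 \<le> ?w x" for x by (simp add: student_weight_def)
  obtain C where C: "0 < C" "spherical_vector M Y (\<lambda>u. C * h u)" using spherical .
  interpret spherical_vector M Y "\<lambda>u. C * h u" by (rule C)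
  obtain D where D: "0 < D"
    "\<And>c f. f \<in> borel_measurable borel \<Longrightarrow> (\<integral>\<^sup>+x. f x \<partial>lborel) = ennreal D * (\<integral>\<^sup>+y. f (c + K *v y) \<partial>lborel)"
    using nn_integral_lborel_affine_matrix[OF dispersion_factor_invertible[OF dispersion_block22[OF dispersion] K]] by metis
  obtain c0 where c0: "0 < c0" "\<And>u. h u = c0 * (1 + u / \<nu>) powr - ((\<nu> + real CARD('m + 'n)) / 2)"
    using student_generator_eq[OF \<nu>, of "CARD('m + 'n)"] unfolding h by metis
  let ?a = "(\<nu> + real CARD('m) + real CARD('n)) / 2"
  define \<kappa> where "\<kappa> = (\<integral>\<^sup>+z. ennreal ((1 + (z \<bullet> z) / \<nu>) powr - ?a) \<partial>(lborel :: (real ^ 'm) measure))"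
  define k where "k = ennreal (C * c0) * \<kappa> * ennreal (1 / D)"
  have marg: "(\<integral>\<^sup>+z. ennreal (C * h ((z :: real ^ 'm) \<bullet> z + v \<bullet> v)) \<partial>lborel) = ennreal (C * c0) * \<kappa> * ennreal (?w (part2 \<xi> + K *v v))" for v
  proof -
    have "(\<integral>\<^sup>+z. ennreal (C * h ((z :: real ^ 'm) \<bullet> z + v \<bullet> v)) \<partial>lborel) =
        (\<integral>\<^sup>+z. ennreal (C * c0) * ennreal ((1 + (v \<bullet> v + z \<bullet> z) / \<nu>) powr - ?a) \<partial>(lborel :: (real ^ 'm) measure))"
      using C(1) c0(1) by (intro nn_integral_cong) (simp add: c0(2) ennreal_mult[symmetric] add_ac mult_ac)
    also have "\<dots> = ennreal (C * c0) * (\<integral>\<^sup>+z. ennreal ((1 + (v \<bullet> v + z \<bullet> z) / \<nu>) powr - ?a) \<partial>(lborel :: (real ^ 'm) measure))"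
      by (rule nn_integral_cmult) measurable
    also have "(\<integral>\<^sup>+z. ennreal ((1 + (v \<bullet> v + z \<bullet> z) / \<nu>) powr - ?a) \<partial>(lborel :: (real ^ 'm) measure)) =
        ennreal ((1 + (v \<bullet> v) / \<nu>) powr - ((\<nu> + real CARD('n)) / 2)) * \<kappa>"
      unfolding \<kappa>_def by (rule student_marginal[OF \<nu>]) simp
    also have "(1 + (v \<bullet> v) / \<nu>) powr - ((\<nu> + real CARD('n)) / 2) = ?w (part2 \<xi> + K *v v)"
      unfolding student_weight_def mahalanobis_factor[OF dispersion_block22[OF dispersion] K] minus_divide_left ..
    finally show ?thesis by (simp only: mult_ac)
  qed
  have law: "(\<integral>\<^sup>+\<omega>. \<phi> (X2 \<omega>) \<partial>M) = k * (\<integral>\<^sup>+x. \<phi> x * ennreal (?w x) \<partial>lborel)"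
    if [measurable]: "\<phi> \<in> borel_measurable borel" for \<phi>
  proof -
    have "(\<integral>\<^sup>+\<omega>. \<phi> (X2 \<omega>) \<partial>M) = (\<integral>\<^sup>+v. (ennreal (C * c0) * \<kappa>) * (\<phi> (part2 \<xi> + K *v v) * ennreal (?w (part2 \<xi> + K *v v))) \<partial>lborel)"
      unfolding X2_eq by (subst nn_integral_part2[of "\<lambda>v. \<phi> (part2 \<xi> + K *v v)"]) (measurable, simp only: marg mult_ac)
    also have "\<dots> = (ennreal (C * c0) * \<kappa>) * (\<integral>\<^sup>+v. \<phi> (part2 \<xi> + K *v v) * ennreal (?w (part2 \<xi> + K *v v)) \<partial>lborel)"
      by (rule nn_integral_cmult) measurable
    also have "(\<integral>\<^sup>+v. \<phi> (part2 \<xi> + K *v v) * ennreal (?w (part2 \<xi> + K *v v)) \<partial>lborel) =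
        ennreal (1 / D) * (\<integral>\<^sup>+x. \<phi> x * ennreal (?w x) \<partial>lborel)"
    proof -
      have "ennreal (1 / D) * ennreal D = 1" using D(1) by (simp add: ennreal_mult[symmetric])
      moreover have "(\<integral>\<^sup>+x. \<phi> x * ennreal (?w x) \<partial>lborel) = ennreal D * (\<integral>\<^sup>+v. \<phi> (part2 \<xi> + K *v v) * ennreal (?w (part2 \<xi> + K *v v)) \<partial>lborel)"
        by (rule D(2)) measurable
      ultimately show ?thesis by (simp only: mult.assoc[symmetric] mult_1)
    qed
    finally show ?thesis by (simp only: k_def mult.assoc)
  qed
  have "(\<integral>\<^sup>+x. ennreal (?w x) \<partial>lborel) \<noteq> 0"
  proof (rule nn_integral_lborel_pos)
    fix x
    have "0 < 1 + mahalanobis (part2 \<xi>) (block22 \<Omega>) x / \<nu>"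
      using mahalanobis_nonneg[OF dispersion_block22[OF dispersion]] \<nu> by (intro add_pos_nonneg) auto
    then show "0 < ?w x" by (simp add: student_weight_def)
  qed measurable
  \<comment> \<open>Total mass 1, together with a nonzero integral of the kernel, shows that
    \<open>k\<close> is neither 0 nor infinite.\<close>
  moreover have k1: "k * (\<integral>\<^sup>+x. ennreal (?w x) \<partial>lborel) = 1"
    using law[of "\<lambda>_. 1"] by (simp add: emeasure_space_1)
  ultimately have "k \<noteq> \<infinity>" "k \<noteq> 0"
    by (auto simp: ennreal_top_mult)
  then obtain r where r: "k = ennreal r" "0 < r" by (cases k) auto
  have real_law: "(\<integral>\<omega>. \<phi> (X2 \<omega>) \<partial>M) = r * (\<integral>x. \<phi> x * ?w x \<partial>lborel)"
    if [measurable]: "\<phi> \<in> borel_measurable borel" and \<phi>: "\<And>x. 0 \<le> \<phi> x" for \<phi>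
  proof -
    have "(\<integral>\<omega>. \<phi> (X2 \<omega>) \<partial>M) = enn2real (\<integral>\<^sup>+\<omega>. ennreal (\<phi> (X2 \<omega>)) \<partial>M)"
      by (rule integral_eq_nn_integral) (use \<phi> in auto)
    also have "\<dots> = r * enn2real (\<integral>\<^sup>+x. ennreal (\<phi> x) * ennreal (?w x) \<partial>lborel)"
      using r by (subst law) (simp_all add: enn2real_mult)
    also have "enn2real (\<integral>\<^sup>+x. ennreal (\<phi> x) * ennreal (?w x) \<partial>lborel) = (\<integral>x. \<phi> x * ?w x \<partial>lborel)"
      by (subst integral_eq_nn_integral) (use \<phi> w0 in \<open>auto simp: ennreal_mult\<close>)
    finally show ?thesis .
  qed
  have "prob A = (\<integral>\<omega>. indicator A \<omega> \<partial>M)" by simp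
  also have "\<dots> = (\<integral>\<omega>. indicator E (X2 \<omega>) \<partial>M)"
    by (intro Bochner_Integration.integral_cong) (auto simp: indicator_def)
  also have "\<dots> = r * (\<integral>x. indicator E x * ?w x \<partial>lborel)" by (rule real_law) auto
  finally have p: "prob A = r * (\<integral>x. indicator E x * ?w x \<partial>lborel)" .
  have "(\<integral>\<omega>. \<psi> (X2 \<omega>) \<partial>U) = (\<integral>\<omega>. indicator E (X2 \<omega>) * \<psi> (X2 \<omega>) \<partial>M) / prob A"
    by (rule expectation_U) measurable
  also have "(\<integral>\<omega>. indicator E (X2 \<omega>) * \<psi> (X2 \<omega>) \<partial>M) = r * (\<integral>x. indicator E x * \<psi> x * ?w x \<partial>lborel)"
    by (rule real_law[of "\<lambda>x. indicator E x * \<psi> x"]) (use \<psi> in auto)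
  finally show ?thesis using r(2) unfolding p by (simp add: mult.assoc)
qed

end

end

theorem mainTheorem7:
  fixes M :: "'w measure"
    and X :: "'w \<Rightarrow> real ^ ('m::finite + 'n::finite)"
    and \<xi> :: "real ^ ('m + 'n)"
    and \<Omega> :: "real ^ ('m + 'n) ^ ('m + 'n)"
    and h :: "real \<Rightarrow> real"
    and \<alpha> \<beta> :: "ereal ^ ('m + 'n)"
  defines "X1 \<equiv> \<lambda>\<omega>. part1 (X \<omega>)"
    and "X2 \<equiv> \<lambda>\<omega>. part2 (X \<omega>)"
    and "\<xi>1 \<equiv> part1 \<xi>" and "\<xi>2 \<equiv> part2 \<xi>"
    and "\<alpha>1 \<equiv> part1 \<alpha>" and "\<alpha>2 \<equiv> part2 \<alpha>"
    and "\<beta>1 \<equiv> part1 \<beta>" and "\<beta>2 \<equiv> part2 \<beta>"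
    and "\<Omega>11 \<equiv> block11 \<Omega>" and "\<Omega>12 \<equiv> block12 \<Omega>"
    and "\<Omega>21 \<equiv> block21 \<Omega>" and "\<Omega>22 \<equiv> block22 \<Omega>"
    and "r2 \<equiv> real CARD('n)"
  defines "\<Omega>22inv \<equiv> matrix_inv \<Omega>22"
    and "\<delta> \<equiv> mahalanobis \<xi>2 \<Omega>22"
    and "A \<equiv> trunc_event M X \<alpha> \<beta>"
    and "A2 \<equiv> trunc_event M X2 \<alpha>2 \<beta>2"
  assumes "prob_space M"
    and "elliptical M X \<xi> \<Omega> h"
    and "\<alpha>1 = (\<chi> i. - \<infinity>)" and "\<beta>1 = (\<chi> i. \<infinity>)"
    and "\<forall>j. \<bar>\<alpha>2 $ j\<bar> \<noteq> \<infinity> \<or> \<bar>\<beta>2 $ j\<bar> \<noteq> \<infinity>"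
    and "0 < measure M A"
  defines "\<mu>2 \<equiv> event_expectation M A2 X2"
    and "\<Sigma>22 \<equiv> event_cov M A2 X2"
  shows
    "(integrable (uniform_measure M A) X \<longrightarrow>
        event_expectation M A X = stack (\<xi>1 + \<Omega>12 ** \<Omega>22inv *v (\<mu>2 - \<xi>2)) \<mu>2)
     \<and>
     (event_square_integrable M A X \<longrightarrow>
        (\<exists>!\<omega>12. event_expectation M A2 (cond_cov M X1 X2)
                  = \<omega>12 *\<^sub>R (\<Omega>11 - \<Omega>12 ** \<Omega>22inv ** \<Omega>21)) \<and>
        (\<forall>\<omega>12. event_expectation M A2 (cond_cov M X1 X2)
                  = \<omega>12 *\<^sub>R (\<Omega>11 - \<Omega>12 ** \<Omega>22inv ** \<Omega>21) \<longrightarrow>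
           event_cov M A X = block_matrix
             (\<omega>12 *\<^sub>R \<Omega>11 - \<Omega>12 ** \<Omega>22inv ** (\<omega>12 *\<^sub>R mat 1 - \<Sigma>22 ** \<Omega>22inv) ** \<Omega>21)
             (\<Omega>12 ** \<Omega>22inv ** \<Sigma>22)
             (\<Sigma>22 ** \<Omega>22inv ** \<Omega>21)
             \<Sigma>22 \<and>
           \<omega>12 = event_expectation M A2
             (\<lambda>\<omega>. covariance_factor TYPE('m) (conditional_generator TYPE('m) h (\<delta> (X2 \<omega>)))) \<and>
           (\<forall>\<nu>. student_t M X \<xi> \<Omega> \<nu> \<and> 2 < \<nu> + r2 \<longrightarrow>
              \<omega>12 = event_expectation M A2 (\<lambda>\<omega>. (\<nu> + \<delta> (X2 \<omega>)) / (\<nu> + r2 - 2))) \<and>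
           (\<forall>\<nu>. student_t M X \<xi> \<Omega> \<nu> \<and> 2 < \<nu> \<longrightarrow>
              \<omega>12 = \<nu> / (\<nu> - 2) *
                (L_prob \<alpha>2 \<beta>2 \<xi>2 ((\<nu> / (\<nu> - 2)) *\<^sub>R \<Omega>22) (\<nu> - 2) / L_prob \<alpha>2 \<beta>2 \<xi>2 \<Omega>22 \<nu>)) \<and>
           (multivariate_normal M X \<xi> \<Omega> \<longrightarrow> \<omega>12 = 1)))
     \<and> (\<forall>\<nu>. student_t M X \<xi> \<Omega> \<nu> \<and> 2 < \<nu> \<longrightarrow> event_square_integrable M A X)
     \<and> (multivariate_normal M X \<xi> \<Omega> \<longrightarrow> event_square_integrable M A X)
     \<and> ((\<lambda>\<nu>. \<nu> / (\<nu> - 2) *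
           (L_prob \<alpha>2 \<beta>2 \<xi>2 ((\<nu> / (\<nu> - 2)) *\<^sub>R \<Omega>22) (\<nu> - 2) / L_prob \<alpha>2 \<beta>2 \<xi>2 \<Omega>22 \<nu>))
         \<longlongrightarrow> 1) at_top"
proof -
  interpret prob_space M by fact
  have disp: "dispersion_matrix \<Omega>" using \<open>elliptical M X \<xi> \<Omega> h\<close> by (simp add: elliptical_def)
  define S where "S = \<Omega>11 - \<Omega>12 ** \<Omega>22inv ** \<Omega>21"
  have dispS: "dispersion_matrix S"
    using dispersion_schur[OF disp] by (simp add: S_def \<Omega>11_def \<Omega>12_def \<Omega>21_def \<Omega>22inv_def \<Omega>22_def)
  have disp22: "dispersion_matrix \<Omega>22" unfolding \<Omega>22_def by (rule dispersion_block22[OF disp])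
  obtain L :: "real ^ 'm ^ 'm" where L: "L ** transpose L = S" using dispersion_matrix_factor[OF dispS] .
  obtain K :: "real ^ 'n ^ 'n" where K: "K ** transpose K = \<Omega>22" using dispersion_matrix_factor[OF disp22] .
  \<comment> \<open>The generator is left free: \<open>L\<close> and \<open>K\<close> depend on
    \<Omega> alone and serve every generator of the law of X.\<close>
  have EP: "elliptical_pair M X \<xi> \<Omega> h' L K" if "elliptical M X \<xi> \<Omega> h'" for h'
    by unfold_locales
       (use that L K in \<open>simp_all add: S_def \<Omega>11_def \<Omega>12_def \<Omega>21_def \<Omega>22inv_def \<Omega>22_def\<close>)
  interpret P: elliptical_pair M X \<xi> \<Omega> h L K by (rule EP) fact
  define E where "E = {z. in_limits \<alpha>2 \<beta>2 z}"
  have E: "E \<in> sets borel" unfolding E_def by (rule in_limits_sets)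
  have inf1: "\<alpha> $ Inl i = - \<infinity>" "\<beta> $ Inl i = \<infinity>" for i
    using \<open>\<alpha>1 = _\<close> \<open>\<beta>1 = _\<close> by (simp_all add: \<alpha>1_def \<beta>1_def part1_def vec_eq_iff)
  \<comment> \<open>Infinite limits impose nothing on the first block, so truncating X and
    truncating \<open>X2\<close> are the same event.\<close>
  have A: "A = {\<omega> \<in> space M. part2 (X \<omega>) \<in> E}"
    by (simp add: A_def trunc_event_def in_limits_def split_sum_all inf1 E_def \<alpha>2_def \<beta>2_def part_component)
  have A2: "A2 = {\<omega> \<in> space M. part2 (X \<omega>) \<in> E}"
    by (simp add: A2_def trunc_event_def E_def X2_def)
  have pE: "0 < prob {\<omega> \<in> space M. part2 (X \<omega>) \<in> E}" using \<open>0 < measure M A\<close> by (simp add: A)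
  let ?B = "\<Omega>12 ** \<Omega>22inv"
  have B: "P.regression = ?B" by (simp add: P.regression_def \<Omega>12_def \<Omega>22inv_def \<Omega>22_def)
  have Bt: "transpose ?B = \<Omega>22inv ** \<Omega>21"
    using transpose_blocks[OF disp] transpose_matrix_inv[OF dispersion_matrix_invertible[OF disp22]]
    by (simp add: matrix_transpose_mul \<Omega>12_def \<Omega>21_def \<Omega>22inv_def \<Omega>22_def)
  have schur: "P.schur = S"
    by (simp add: P.schur_def S_def \<Omega>11_def \<Omega>12_def \<Omega>21_def \<Omega>22inv_def \<Omega>22_def)
  \<comment> \<open>A nonzero \<open>S\<close> is what makes its scalar coefficient unique.\<close>
  have S0: "S \<noteq> 0"
  proof
    assume "S = 0"
    moreover have "(1 :: real ^ 'm) \<noteq> 0" by simp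
    ultimately show False using dispS unfolding dispersion_matrix_def
      by (metis inner_zero_right less_irrefl matrix_vector_mult_0)
  qed
  have d0: "0 \<le> \<delta> x" for x unfolding \<delta>_def by (rule mahalanobis_nonneg[OF disp22])
  have dm: "\<delta> \<in> borel_measurable borel" unfolding \<delta>_def by (rule mahalanobis_measurable)
  have r2: "1 \<le> r2" by (simp add: r2_def Suc_leI)
  interpret U: prob_space "uniform_measure M A"
    using pE by (intro prob_space_uniform_measure) (auto simp: A emeasure_eq_measure)
  let ?ratio = "\<lambda>\<nu>. \<nu> / (\<nu> - 2) *
    (L_prob \<alpha>2 \<beta>2 \<xi>2 ((\<nu> / (\<nu> - 2)) *\<^sub>R \<Omega>22) (\<nu> - 2) / L_prob \<alpha>2 \<beta>2 \<xi>2 \<Omega>22 \<nu>)"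
  have mean: "event_expectation M A X = stack (\<xi>1 + ?B *v (\<mu>2 - \<xi>2)) \<mu>2"
    if "integrable (uniform_measure M A) X"
    using P.conditional_mean[OF E pE] that
    by (simp add: A A2 \<mu>2_def X2_def \<xi>1_def \<xi>2_def B)
  have main: "(\<exists>!\<omega>12. event_expectation M A2 (cond_cov M X1 X2) = \<omega>12 *\<^sub>R S) \<and>
        (\<forall>\<omega>12. event_expectation M A2 (cond_cov M X1 X2) = \<omega>12 *\<^sub>R S \<longrightarrow>
           event_cov M A X = block_matrix
             (\<omega>12 *\<^sub>R \<Omega>11 - ?B ** (\<omega>12 *\<^sub>R mat 1 - \<Sigma>22 ** \<Omega>22inv) ** \<Omega>21)
             (?B ** \<Sigma>22)
             (\<Sigma>22 ** \<Omega>22inv ** \<Omega>21)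
             \<Sigma>22 \<and>
           \<omega>12 = event_expectation M A2
             (\<lambda>\<omega>. covariance_factor TYPE('m) (conditional_generator TYPE('m) h (\<delta> (X2 \<omega>)))) \<and>
           (\<forall>\<nu>. student_t M X \<xi> \<Omega> \<nu> \<and> 2 < \<nu> + r2 \<longrightarrow>
              \<omega>12 = event_expectation M A2 (\<lambda>\<omega>. (\<nu> + \<delta> (X2 \<omega>)) / (\<nu> + r2 - 2))) \<and>
           (\<forall>\<nu>. student_t M X \<xi> \<Omega> \<nu> \<and> 2 < \<nu> \<longrightarrow> \<omega>12 = ?ratio \<nu>) \<and>
           (multivariate_normal M X \<xi> \<Omega> \<longrightarrow> \<omega>12 = 1))"
    if sq0: "event_square_integrable M A X"
  proof -
    have sq: "event_square_integrable M {\<omega> \<in> space M. part2 (X \<omega>) \<in> E} X" using sq0 by (simp add: A)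
    define w where "w = P.omega E"
    have cc: "event_expectation M A2 (cond_cov M X1 X2) = w *\<^sub>R S"
      using P.conditional_covariance[OF E pE sq] by (simp add: A2 X1_def X2_def schur w_def)
    have uniq: "event_expectation M A2 (cond_cov M X1 X2) = \<omega>12 *\<^sub>R S \<longleftrightarrow> \<omega>12 = w" for \<omega>12
      unfolding cc using S0 by auto
    \<comment> \<open>\<open>w\<close> does not involve the generator, so the formula holds for each
      \<open>h'\<close> that describes the law of X; the t and normal cases below insert
      theirs.\<close>
    have fac: "w = event_expectation M A2
        (\<lambda>\<omega>. covariance_factor TYPE('m) (conditional_generator TYPE('m) h' (\<delta> (X2 \<omega>))))"
      if "elliptical M X \<xi> \<Omega> h'" for h'
      using elliptical_pair.omega_eq_covariance_factor[OF EP[OF that] E pE sq]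
      by (simp add: event_expectation_def A2 \<delta>_def \<xi>2_def \<Omega>22_def X2_def w_def)
    have st: "w = event_expectation M A2 (\<lambda>\<omega>. (\<nu> + \<delta> (X2 \<omega>)) / (\<nu> + r2 - 2))"
      if \<nu>: "student_t M X \<xi> \<Omega> \<nu>" "2 < \<nu> + r2" for \<nu>
    proof -
      have el: "elliptical M X \<xi> \<Omega> (student_generator CARD('m + 'n) \<nu>)" and \<nu>0: "0 < \<nu>"
        using \<nu>(1) by (auto simp: student_t_def)
      show ?thesis
        unfolding fac[OF el] covariance_factor_student[OF \<nu>0 \<nu>(2)[unfolded r2_def] d0] r2_def ..
    qed
    have ra: "w = ?ratio \<nu>" if \<nu>: "student_t M X \<xi> \<Omega> \<nu>" "2 < \<nu>" for \<nu>
    proof -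
      have el: "elliptical M X \<xi> \<Omega> (student_generator CARD('m + 'n) \<nu>)" and \<nu>0: "0 < \<nu>"
        using \<nu>(1) by (auto simp: student_t_def)
      have pos: "0 \<le> (\<nu> + \<delta> x) / (\<nu> + r2 - 2)" for x
        using \<nu>(2) r2 d0[of x] by (intro divide_nonneg_nonneg) auto
      have meas: "(\<lambda>x. (\<nu> + \<delta> x) / (\<nu> + r2 - 2)) \<in> borel_measurable borel"
        using dm by measurable
      have "w = (\<integral>\<omega>. (\<nu> + \<delta> (X2 \<omega>)) / (\<nu> + r2 - 2) \<partial>uniform_measure M {\<omega> \<in> space M. part2 (X \<omega>) \<in> E})"
        using st[OF \<nu>(1)] \<nu>(2) r2 by (simp add: event_expectation_def A2)
      \<comment> \<open>Both sides are the same quotient of integrals against the weight: the ratio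
        by \<open>L_prob_ratio\<close>, the conditional mean by
        \<open>student_expectation\<close>.\<close>
      also have "\<dots> = ?ratio \<nu>"
        unfolding L_prob_ratio[OF disp22 \<nu>(2)] X2_def
          elliptical_pair.student_expectation[OF EP[OF el] E pE \<nu>0 refl meas pos]
        by (simp add: E_def \<xi>2_def \<Omega>22_def \<delta>_def r2_def)
      finally show ?thesis .
    qed
    have no: "w = 1" if "multivariate_normal M X \<xi> \<Omega>"
    proof -
      have el: "elliptical M X \<xi> \<Omega> (normal_generator CARD('m + 'n))"
        using that by (simp add: multivariate_normal_def)
      show ?thesis
        unfolding fac[OF el] covariance_factor_normal
        using U.prob_space by (simp add: event_expectation_def A A2)
    qed
    have cov: "event_cov M A X = block_matrix
             (w *\<^sub>R \<Omega>11 - ?B ** (w *\<^sub>R mat 1 - \<Sigma>22 ** \<Omega>22inv) ** \<Omega>21)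
             (?B ** \<Sigma>22) (\<Sigma>22 ** \<Omega>22inv ** \<Omega>21) \<Sigma>22"
    proof -
      have \<Sigma>: "event_cov M {\<omega> \<in> space M. part2 (X \<omega>) \<in> E} (\<lambda>\<omega>. part2 (X \<omega>)) = \<Sigma>22"
        by (simp add: \<Sigma>22_def A2 X2_def)
      have "?B ** (w *\<^sub>R mat 1 - \<Sigma>22 ** \<Omega>22inv) = w *\<^sub>R ?B - ?B ** \<Sigma>22 ** \<Omega>22inv"
      proof -
        have "X ** (Y - Z) = X ** Y - X ** Z" for X :: "real ^ 'n ^ 'm" and Y Z :: "real ^ 'n ^ 'n"
          by (simp add: matrix_matrix_mult_def vec_eq_iff right_diff_distrib sum_subtractf)
        moreover have "X ** (w *\<^sub>R mat 1) = w *\<^sub>R X" for X :: "real ^ 'n ^ 'm"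
          by (simp add: matrix_matrix_mult_def vec_eq_iff mat_def if_distrib[of "\<lambda>x. _ * x"] cong: if_cong)
        ultimately show ?thesis by (simp only: matrix_mul_assoc)
      qed
      moreover have "(w *\<^sub>R X - Y) ** Z = w *\<^sub>R (X ** Z) - Y ** Z"
        for X Y :: "real ^ 'n ^ 'm" and Z :: "real ^ 'm ^ 'n"
        by (simp add: matrix_matrix_mult_def vec_eq_iff left_diff_distrib sum_subtractf sum_distrib_left mult.assoc)
      \<comment> \<open>The stated block rearranges to w S + B \<Sigma>22 B^T with B the regression
        matrix: mean conditional covariance plus covariance of the conditional mean.\<close>
      ultimately have "w *\<^sub>R \<Omega>11 - ?B ** (w *\<^sub>R mat 1 - \<Sigma>22 ** \<Omega>22inv) ** \<Omega>21
          = w *\<^sub>R S + ?B ** \<Sigma>22 ** transpose ?B"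
        by (simp only: Bt S_def) (simp add: matrix_mul_assoc scaleR_diff_right)
      moreover have "\<Sigma>22 ** \<Omega>22inv ** \<Omega>21 = \<Sigma>22 ** transpose ?B"
        by (simp only: Bt matrix_mul_assoc)
      ultimately show ?thesis
        using P.event_cov_eq[OF E pE sq]
        by (simp only: vec_eq_iff split_sum_all block_matrix_component A \<Sigma> B schur w_def[symmetric])
           (simp only: vector_add_component vector_scaleR_component real_scaleR_def simp_thms)
    qed
    show ?thesis
      unfolding uniq using cov fac[OF \<open>elliptical M X \<xi> \<Omega> h\<close>] st ra no by blast
  qed
  have sq_st: "event_square_integrable M A X" if "student_t M X \<xi> \<Omega> \<nu>" "2 < \<nu>" for \<nu>
    using elliptical_pair.second_moment_finite[OF EP E pE student_second_moment_finite[OF that(2)]] that(1)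
    by (simp add: student_t_def A)
  have sq_no: "event_square_integrable M A X" if "multivariate_normal M X \<xi> \<Omega>"
    using elliptical_pair.second_moment_finite[OF EP E pE normal_second_moment_finite] that
    by (simp add: multivariate_normal_def A)
  \<comment> \<open>The limit concerns t box probabilities only; the law of X enters solely through
    the positive volume of the box.\<close>
  have lim: "(?ratio \<longlongrightarrow> 1) at_top"
    by (rule L_prob_ratio_tendsto[OF disp22]) (use P.E_not_null[OF E pE] in \<open>simp add: E_def\<close>)
  show ?thesis
    using mean main sq_st sq_no lim unfolding S_def by blast
qed

end
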